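(* Let $T=T(L_1\times\cdots\times L_d)$ be a level-uniform tree and let $\kappa=(\kappa_0,\dots,\kappa_d)$ be a capacity function with $1\le\kappa_d\le\kappa_{d-1}\le\cdots\le\kappa_0\le\prod_{j=1}^d|L_j|$. Assume that all $|L_j|$ ($1\le j\le d$) and all $\kappa_j$ are powers of two. Let $\Gamma=\mathbb{F}_p$ where $p\ge 4\prod_{j=1}^d|L_j|^2$. There is a sketch-and-recover scheme for hierarchical mismatch recovery for $(L_1\times\cdots\times L_d)$-sequences over $\Gamma$, given by procedures $\textsc{hmr-sketch}$ and $\textsc{hmr-recover}$, that given $\delta>0$ satisfies: (1) if $R\ge 4d$ then for any two inputs $u,w$, the probability that the scheme fails to satisfy Soundness and Completeness for $\mathbf{HMR}(T,\kappa,R)$ is at most $\delta$; (2) the sketch has bit-size $O\big(\kappa_0\cdot\log|\Gamma|\cdot(\sum_{j=1}^d\log|L_j|+\log(1/\delta))\big)$; (3) the sketching algorithm runs in time $O\big(\prod_{j=1}^d|L_j|\cdot\log^{O(1)}|\Gamma|\cdot\log(1/\delta)\big)$; (4) the recovery algorithm runs in time $O(\kappa_0\cdot\log^{O(1)}|\Gamma|\cdot\log(1/\delta))$; (5) if the sequence $u$ is given by its sparse representation $\{(j,u_j): j\in\mathrm{supp}(u)\}$, where $\mathrm{supp}(u)=\{\ell: u_\ell\ne 0\}$, then the sketch can be constructed in time $O\big((\kappa_0+|\mathrm{supp}(u)|)\cdot\log^{O(1)}|\Gamma|\cdot\log(1/\delta)\big)$; (6) the number of mismatch triples output by the recovery algorithm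 is at most $\kappa_0$.
   Context: $T(L_1\times\cdots\times L_d)$ is the rooted tree of depth $d$ whose nodes at depth $j$ are the sequences in $L_1\times\cdots\times L_j$ (the root is the empty sequence), the children of a node $v$ at depth $j-1$ being $v\circ a$, $a\in L_j$; its leaves are $L_1\times\cdots\times L_d$. Nodes at depth $j$ have capacity $\kappa_j$. A sketch-and-recover scheme consists of a randomized sketching algorithm (using a public random parameter $\rho$) mapping a sequence to a sketch, and a recovery algorithm mapping two sketches (made with the same $\rho$) to a set of mismatch triples $(i,a,b)$. For two sequences $u,w\in\Gamma^{L_1\times\cdots\times L_d}$, let $I_{\ne}(u,w)=\{i: u_i\ne w_i\}$ and $\mathrm{MIS}(u,w)=\{(i,u_i,w_i): i\in I_{\ne}(u,w)\}$. The load function is defined by: for a leaf $v$, $\mathrm{load}_v=1$ if $u_v\ne w_v$ and $0$ otherwise; for an internal node $v$ at depth $j<d$, $\mathrm{load}_v=\min(\kappa_j,\sum_{v'\text{ child of }v}\mathrm{load}_{v'})$. For an integer $R>0$, an internal node $v$ at depth $j$ is $R$-overloaded if $\mathrm{load}_v\ge\kappa_j/R$ and $R$-underloaded otherwise; a leaf is $R$-accessible if every internal node on its path to the root is $R$-underloaded. The target set $F(u,w)$ is the set of $R$-accessible leaves $\ell$ with $u_\ell\ne w_\ell$, and $\mathrm{MIS}_F(u,w)=\{(i,u_i,w_i): i\in F(u,w)\}$. The problem $\mathbf{HMR}(T,\kappa,R)$ requires, for inputs $u,w$: Soundness, that the recovered set is contained in $\mathrm{MIS}(u,w)$; and Completeness,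 that $\mathrm{MIS}_F(u,w)$ is contained in the recovered set. *)

theory Defs
  imports
    "HOL-Probability.Probability"
    "HOL-Computational_Algebra.Primes"
    "HOL-Library.Log_Nat"
begin

section \<open>Level-uniform trees and hierarchical mismatches\<close>

text \<open>
  The alphabet \<open>L\<^sub>j\<close> (\<open>1 \<le> j \<le> d\<close>) is identified with \<open>{0, \<dots>, L j - 1}\<close>, so that
  \<open>L j\<close> is its size, and the field \<open>\<Gamma> = F\<^sub>p\<close> (\<open>p\<close> prime) is identified with its residues
  \<open>{0, \<dots>, p - 1}\<close>.  The node \<open>(a\<^sub>1, \<dots>, a\<^sub>j)\<close> is a list, \<open>a\<^sub>i\<close> having list position \<open>i - 1\<close>.
\<close>

definition nodes :: "(nat \<Rightarrow> nat) \<Rightarrow> nat \<Rightarrow> nat list set" where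
  "nodes L j = {v. length v = j \<and> (\<forall>i<j. v ! i < L (Suc i))}"

abbreviation leaves :: "nat \<Rightarrow> (nat \<Rightarrow> nat) \<Rightarrow> nat list set" where
  "leaves d L \<equiv> nodes L d"

definition num_leaves :: "nat \<Rightarrow> (nat \<Rightarrow> nat) \<Rightarrow> nat" where
  "num_leaves d L = (\<Prod>j=1..d. L j)"

definition seqs :: "nat \<Rightarrow> (nat \<Rightarrow> nat) \<Rightarrow> nat \<Rightarrow> (nat list \<Rightarrow> nat) set" where
  "seqs d L p = (leaves d L \<rightarrow>\<^sub>E {..<p})"

definition supp :: "nat \<Rightarrow> (nat \<Rightarrow> nat) \<Rightarrow> (nat list \<Rightarrow> nat) \<Rightarrow> nat list set" where
  "supp d L u = {l \<in> leaves d L. u l \<noteq> 0}"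

function load :: "nat \<Rightarrow> (nat \<Rightarrow> nat) \<Rightarrow> (nat \<Rightarrow> nat) \<Rightarrow>
    (nat list \<Rightarrow> nat) \<Rightarrow> (nat list \<Rightarrow> nat) \<Rightarrow> nat list \<Rightarrow> nat" where
  "load d L \<kappa> u w v =
     (if length v < d
      then min (\<kappa> (length v)) (\<Sum>a<L (Suc (length v)). load d L \<kappa> u w (v @ [a]))
      else if u v \<noteq> w v then 1 else 0)"
  by pat_completeness auto
termination
  by (relation "Wellfounded.measure (\<lambda>(d, L, \<kappa>, u, w, v). d - length v)") auto

declare load.simps [simp del]

definition node_overloaded :: "nat \<Rightarrow> (nat \<Rightarrow> nat) \<Rightarrow> (nat \<Rightarrow> nat) \<Rightarrow> nat \<Rightarrow>
    (nat list \<Rightarrow> nat) \<Rightarrow> (nat list \<Rightarrow> nat) \<Rightarrow> nat list \<Rightarrow> bool" where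
  "node_overloaded d L \<kappa> R u w v \<longleftrightarrow> real (load d L \<kappa> u w v) \<ge> real (\<kappa> (length v)) / real R"

definition accessible :: "nat \<Rightarrow> (nat \<Rightarrow> nat) \<Rightarrow> (nat \<Rightarrow> nat) \<Rightarrow> nat \<Rightarrow>
    (nat list \<Rightarrow> nat) \<Rightarrow> (nat list \<Rightarrow> nat) \<Rightarrow> nat list \<Rightarrow> bool" where
  "accessible d L \<kappa> R u w l \<longleftrightarrow> (\<forall>j<d. \<not> node_overloaded d L \<kappa> R u w (take j l))"

definition target :: "nat \<Rightarrow> (nat \<Rightarrow> nat) \<Rightarrow> (nat \<Rightarrow> nat) \<Rightarrow> nat \<Rightarrow>
    (nat list \<Rightarrow> nat) \<Rightarrow> (nat list \<Rightarrow> nat) \<Rightarrow> nat list set" where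
  "target d L \<kappa> R u w = {l \<in> leaves d L. accessible d L \<kappa> R u w l \<and> u l \<noteq> w l}"

definition MIS :: "nat \<Rightarrow> (nat \<Rightarrow> nat) \<Rightarrow>
    (nat list \<Rightarrow> nat) \<Rightarrow> (nat list \<Rightarrow> nat) \<Rightarrow> (nat list \<times> nat \<times> nat) set" where
  "MIS d L u w = (\<lambda>i. (i, u i, w i)) ` {i \<in> leaves d L. u i \<noteq> w i}"

definition MIS_target :: "nat \<Rightarrow> (nat \<Rightarrow> nat) \<Rightarrow> (nat \<Rightarrow> nat) \<Rightarrow> nat \<Rightarrow>
    (nat list \<Rightarrow> nat) \<Rightarrow> (nat list \<Rightarrow> nat) \<Rightarrow> (nat list \<times> nat \<times> nat) set" where
  "MIS_target d L \<kappa> R u w = (\<lambda>i. (i, u i, w i)) ` target d L \<kappa> R u w"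

text \<open>
  Algorithms refer to a leaf by its lexicographic rank (mixed-radix value).
\<close>

definition leaf_index :: "(nat \<Rightarrow> nat) \<Rightarrow> nat list \<Rightarrow> nat" where
  "leaf_index L v = foldl (\<lambda>k i. k * L (Suc i) + v ! i) 0 [0..<length v]"

definition encode_triple :: "(nat \<Rightarrow> nat) \<Rightarrow> nat list \<times> nat \<times> nat \<Rightarrow> nat \<times> nat \<times> nat" where
  "encode_triple L = (\<lambda>(i, a, b). (leaf_index L i, a, b))"

lemma leaf_index_snoc:
  "leaf_index L (v @ [a]) = leaf_index L v * L (Suc (length v)) + a"
proof -
  have "foldl (\<lambda>k i. k * L (Suc i) + (v @ [a]) ! i) 0 [0..<length v]
      = foldl (\<lambda>k i. k * L (Suc i) + v ! i) 0 [0..<length v]"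
    by (rule foldl_cong) (auto simp: nth_append)
  then show ?thesis
    by (simp add: leaf_index_def)
qed

lemma nodes_Suc: "nodes L (Suc j) = {v @ [a] | v a. v \<in> nodes L j \<and> a < L (Suc j)}"
proof (intro equalityI subsetI)
  fix x assume x: "x \<in> nodes L (Suc j)"
  then have "x \<noteq> []" by (auto simp: nodes_def)
  then obtain v a where va: "x = v @ [a]" by (metis rev_exhaust)
  from x va have len: "length v = j" by (auto simp: nodes_def)
  have "v ! i < L (Suc i)" if "i < j" for i
  proof -
    have "x ! i < L (Suc i)" using x that by (auto simp: nodes_def)
    with va len that show ?thesis by (simp add: nth_append)
  qed
  moreover have "x ! j < L (Suc j)" using x by (auto simp: nodes_def)
  then have "a < L (Suc j)" using va len by (simp add: nth_append)
  ultimately show "x \<in> {v @ [a] | v a. v \<in> nodes L j \<and> a < L (Suc j)}"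
    using va len by (auto simp: nodes_def)
next
  fix x assume "x \<in> {v @ [a] | v a. v \<in> nodes L j \<and> a < L (Suc j)}"
  then show "x \<in> nodes L (Suc j)"
    by (auto simp: nodes_def nth_append less_Suc_eq)
qed

lemma bij_betw_leaf_index: "bij_betw (leaf_index L) (nodes L d) {..<num_leaves d L}"
proof (induction d)
  case 0
  have "nodes L 0 = {[]}" by (auto simp: nodes_def)
  then show ?case
    by (auto simp: num_leaves_def leaf_index_def bij_betw_def)
next
  case (Suc d)
  have prod: "num_leaves (Suc d) L = num_leaves d L * L (Suc d)"
    by (simp add: num_leaves_def)
  have len: "length v = d" if "v \<in> nodes L d" for v
    using that by (simp add: nodes_def)
  have inj: "inj_on (leaf_index L) (nodes L d)"
    and img: "leaf_index L ` nodes L d = {..<num_leaves d L}"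
    using Suc.IH by (auto simp: bij_betw_def)
  show ?case
  proof (rule bij_betw_imageI)
    show "inj_on (leaf_index L) (nodes L (Suc d))"
    proof (rule inj_onI)
      fix x y assume x: "x \<in> nodes L (Suc d)" and y: "y \<in> nodes L (Suc d)"
        and eq: "leaf_index L x = leaf_index L y"
      from x obtain v a where va: "x = v @ [a]" "v \<in> nodes L d" "a < L (Suc d)"
        unfolding nodes_Suc by blast
      from y obtain v' a' where va': "y = v' @ [a']" "v' \<in> nodes L d" "a' < L (Suc d)"
        unfolding nodes_Suc by blast
      let ?m = "L (Suc d)"
      have eq': "leaf_index L v * ?m + a = leaf_index L v' * ?m + a'"
        using eq va va' len by (simp add: leaf_index_snoc)
      have "(leaf_index L v * ?m + a) div ?m = leaf_index L v" "(leaf_index L v * ?m + a) mod ?m = a"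
        "(leaf_index L v' * ?m + a') div ?m = leaf_index L v'" "(leaf_index L v' * ?m + a') mod ?m = a'"
        using va va' by auto
      then have "leaf_index L v = leaf_index L v'" "a = a'"
        using eq' by auto
      then show "x = y" using inj va va' by (auto dest: inj_onD)
    qed
    show "leaf_index L ` nodes L (Suc d) = {..<num_leaves (Suc d) L}"
    proof (intro equalityI subsetI)
      fix k assume "k \<in> leaf_index L ` nodes L (Suc d)"
      then obtain v a where va: "v \<in> nodes L d" "a < L (Suc d)" "k = leaf_index L (v @ [a])"
        unfolding nodes_Suc by blast
      have "leaf_index L v < num_leaves d L" using va img by blast
      then have "Suc (leaf_index L v) * L (Suc d) \<le> num_leaves d L * L (Suc d)"
        by (intro mult_right_mono) auto
      then show "k \<in> {..<num_leaves (Suc d) L}"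
        using va len by (simp add: leaf_index_snoc prod)
    next
      fix k assume k: "k \<in> {..<num_leaves (Suc d) L}"
      then have pos: "L (Suc d) > 0" by (cases "L (Suc d)") (auto simp: prod)
      have "k div L (Suc d) < num_leaves d L"
        using k by (simp add: prod less_mult_imp_div_less)
      then obtain v where v: "v \<in> nodes L d" "leaf_index L v = k div L (Suc d)"
        using img by (metis (no_types, lifting) imageE lessThan_iff)
      have "k = leaf_index L (v @ [k mod L (Suc d)])"
        using v len by (simp add: leaf_index_snoc)
      moreover have "v @ [k mod L (Suc d)] \<in> nodes L (Suc d)"
        unfolding nodes_Suc using v pos by auto
      ultimately show "k \<in> leaf_index L ` nodes L (Suc d)" by blast
    qed
  qed
qed

section \<open>Word RAM programs\<close>

text \<open>
  Algorithms are structured programs for a unit-cost word RAM with \<open>W\<close>-bit words.  A program has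
  finitely many named registers and finitely many named arrays indexed by words, all initially
  \<open>0\<close> except for the input.  Every operation returns a word (arithmetic is modulo \<open>2 ^ W\<close>;
  subtraction is cut off at \<open>0\<close>, division by \<open>0\<close> gives \<open>0\<close>).  The public random parameter \<open>\<rho>\<close> is a
  read-only array of words with random access.
\<close>

type_synonym name = string

record state =
  reg :: "name \<Rightarrow> nat"
  arr :: "name \<Rightarrow> nat \<Rightarrow> nat"

datatype bop = Add | Sub | Mul | Div | Mod | BAnd | BOr | BXor | Shl | Shr | Less | Equal

datatype exp =
    Const nat
  | Reg name
  | Elem name exp
  | Rnd exp
  | Bin bop exp exp

datatype com =
    Skip
  | Assign name exp
  | Store name exp exp
  | Seq com com
  | Cond exp com com
  | Loop exp com

primrec bop_val :: "bop \<Rightarrow> nat \<Rightarrow> nat \<Rightarrow> nat" where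
  "bop_val Add a b = a + b"
| "bop_val Sub a b = a - b"
| "bop_val Mul a b = a * b"
| "bop_val Div a b = a div b"
| "bop_val Mod a b = a mod b"
| "bop_val BAnd a b = Bit_Operations.and a b"
| "bop_val BOr a b = Bit_Operations.or a b"
| "bop_val BXor a b = Bit_Operations.xor a b"
| "bop_val Shl a b = push_bit b a"
| "bop_val Shr a b = drop_bit b a"
| "bop_val Less a b = (if a < b then 1 else 0)"
| "bop_val Equal a b = (if a = b then 1 else 0)"

primrec aval :: "nat \<Rightarrow> (nat \<Rightarrow> nat) \<Rightarrow> state \<Rightarrow> exp \<Rightarrow> nat" where
  "aval W \<rho> s (Const n) = n mod 2 ^ W"
| "aval W \<rho> s (Reg x) = reg s x"
| "aval W \<rho> s (Elem a e) = arr s a (aval W \<rho> s e)"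
| "aval W \<rho> s (Rnd e) = \<rho> (aval W \<rho> s e)"
| "aval W \<rho> s (Bin f e1 e2) = bop_val f (aval W \<rho> s e1) (aval W \<rho> s e2) mod 2 ^ W"

primrec ecost :: "exp \<Rightarrow> nat" where
  "ecost (Const n) = 1"
| "ecost (Reg x) = 1"
| "ecost (Elem a e) = 1 + ecost e"
| "ecost (Rnd e) = 1 + ecost e"
| "ecost (Bin f e1 e2) = 1 + ecost e1 + ecost e2"

text \<open>
  \<open>exec W \<rho> c s T s'\<close>: program \<open>c\<close> started in \<open>s\<close> halts in \<open>s'\<close> after \<open>T\<close> steps.
\<close>

inductive exec :: "nat \<Rightarrow> (nat \<Rightarrow> nat) \<Rightarrow> com \<Rightarrow> state \<Rightarrow> nat \<Rightarrow> state \<Rightarrow> bool"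
  for W :: nat and \<rho> :: "nat \<Rightarrow> nat" where
  Skip: "exec W \<rho> Skip s 1 s"
| Assign: "exec W \<rho> (Assign x e) s (1 + ecost e)
    (s\<lparr>reg := (reg s)(x := aval W \<rho> s e)\<rparr>)"
| Store: "exec W \<rho> (Store a e1 e2) s (1 + ecost e1 + ecost e2)
    (s\<lparr>arr := (arr s)(a := (arr s a)(aval W \<rho> s e1 := aval W \<rho> s e2))\<rparr>)"
| Seq: "exec W \<rho> c1 s T1 s1 \<Longrightarrow> exec W \<rho> c2 s1 T2 s2 \<Longrightarrow>
    exec W \<rho> (Seq c1 c2) s (T1 + T2) s2"
| CondTrue: "aval W \<rho> s e \<noteq> 0 \<Longrightarrow> exec W \<rho> c1 s T s1 \<Longrightarrow>
    exec W \<rho> (Cond e c1 c2) s (1 + ecost e + T) s1"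
| CondFalse: "aval W \<rho> s e = 0 \<Longrightarrow> exec W \<rho> c2 s T s1 \<Longrightarrow>
    exec W \<rho> (Cond e c1 c2) s (1 + ecost e + T) s1"
| LoopFalse: "aval W \<rho> s e = 0 \<Longrightarrow> exec W \<rho> (Loop e c) s (1 + ecost e) s"
| LoopTrue: "aval W \<rho> s e \<noteq> 0 \<Longrightarrow> exec W \<rho> c s T1 s1 \<Longrightarrow> exec W \<rho> (Loop e c) s1 T2 s2 \<Longrightarrow>
    exec W \<rho> (Loop e c) s (1 + ecost e + T1 + T2) s2"

inductive_cases exec_SkipE: "exec W \<rho> Skip s T s'"
inductive_cases exec_AssignE: "exec W \<rho> (Assign x e) s T s'"
inductive_cases exec_StoreE: "exec W \<rho> (Store a e1 e2) s T s'"
inductive_cases exec_SeqE: "exec W \<rho> (Seq c1 c2) s T s'"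
inductive_cases exec_CondE: "exec W \<rho> (Cond e c1 c2) s T s'"
inductive_cases exec_LoopE: "exec W \<rho> (Loop e c) s T s'"

lemma exec_deterministic:
  assumes "exec W \<rho> c s T s1" and "exec W \<rho> c s T' s2'"
  shows "T = T' \<and> s1 = s2'"
  using assms
proof (induction arbitrary: T' s2' rule: exec.induct)
  case (Skip s)
  then show ?case by (auto elim: exec_SkipE)
next
  case (Assign x e s)
  then show ?case by (auto elim: exec_AssignE)
next
  case (Store a e1 e2 s)
  then show ?case by (auto elim: exec_StoreE)
next
  case (Seq c1 s T1 s1 c2 T2 s2)
  from Seq.prems obtain U1 r U2
    where "exec W \<rho> c1 s U1 r" "exec W \<rho> c2 r U2 s2'" "T' = U1 + U2"
    by (rule exec_SeqE)
  then show ?case using Seq.IH by metis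
next
  case (CondTrue s e c1 T s1 c2)
  from CondTrue.prems CondTrue.hyps(1) obtain U
    where "exec W \<rho> c1 s U s2'" "T' = 1 + ecost e + U"
    by (auto elim: exec_CondE)
  then show ?case using CondTrue.IH by blast
next
  case (CondFalse s e c2 T s1 c1)
  from CondFalse.prems CondFalse.hyps(1) obtain U
    where "exec W \<rho> c2 s U s2'" "T' = 1 + ecost e + U"
    by (auto elim: exec_CondE)
  then show ?case using CondFalse.IH by blast
next
  case (LoopFalse s e c)
  from LoopFalse.prems LoopFalse.hyps show ?case by (auto elim: exec_LoopE)
next
  case (LoopTrue s e c T1 s1 T2 s2)
  from LoopTrue.prems LoopTrue.hyps(1) obtain U1 r U2
    where "exec W \<rho> c s U1 r" "exec W \<rho> (Loop e c) r U2 s2'" "T' = 1 + ecost e + U1 + U2"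
    by (auto elim: exec_LoopE)
  then show ?case using LoopTrue.IH by metis
qed

definition runs_within ::
    "nat \<Rightarrow> (nat \<Rightarrow> nat) \<Rightarrow> com \<Rightarrow> state \<Rightarrow> real \<Rightarrow> (state \<Rightarrow> bool) \<Rightarrow> bool" where
  "runs_within W \<rho> c s B Q \<longleftrightarrow> (\<exists>T s'. exec W \<rho> c s T s' \<and> real T \<le> B \<and> Q s')"

definition rand_words :: "nat \<Rightarrow> (nat \<Rightarrow> nat) set" where
  "rand_words W = ({..<2 ^ W} \<rightarrow>\<^sub>E {..<2 ^ W})"

definition rand :: "nat \<Rightarrow> (nat \<Rightarrow> nat) pmf" where
  "rand W = pmf_of_set (rand_words W)"

section \<open>Problem instances, inputs and outputs\<close>

definition hmr_params :: "nat \<Rightarrow> (nat \<Rightarrow> nat) \<Rightarrow> (nat \<Rightarrow> nat) \<Rightarrow> nat \<Rightarrow> bool" where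
  "hmr_params d L \<kappa> p \<longleftrightarrow>
     1 \<le> d \<and>
     (\<forall>j\<in>{1..d}. \<exists>k. L j = 2 ^ k) \<and>
     (\<forall>j\<in>{0..d}. \<exists>k. \<kappa> j = 2 ^ k) \<and>
     1 \<le> \<kappa> d \<and> (\<forall>j<d. \<kappa> (Suc j) \<le> \<kappa> j) \<and> \<kappa> 0 \<le> (\<Prod>j=1..d. L j) \<and>
     prime p \<and> p \<ge> 4 * (\<Prod>j=1..d. (L j)\<^sup>2)"

text \<open>
  The real \<open>\<delta>\<close> is given to a program as the integer \<open>\<lceil>log\<^sub>2 (1/\<delta>)\<rceil>\<close> (\<open>0\<close> if \<open>\<delta> \<ge> 1\<close>).  In the
  asymptotic bounds, \<open>log (1/\<delta>)\<close> is read as \<open>max 1 (log\<^sub>2 (1/\<delta>))\<close>, which is \<open>log\<^sub>2 (1/\<delta>)\<close> for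
  \<open>\<delta> \<le> 1/2\<close>: running times and sizes must not be forced to \<open>0\<close> (or below) as \<open>\<delta>\<close> reaches \<open>1\<close>.
\<close>

definition delta_bits :: "real \<Rightarrow> nat" where
  "delta_bits \<delta> = nat \<lceil>log 2 (1 / \<delta>)\<rceil>"

definition log_inv :: "real \<Rightarrow> real" where
  "log_inv \<delta> = max 1 (log 2 (1 / \<delta>))"

text \<open>
  The word length is a constant multiple of the number of bits needed to write the parameters;
  since \<open>p\<close> exceeds the number of leaves, this also covers all indices and symbols.
\<close>

definition word_length :: "nat \<Rightarrow> nat \<Rightarrow> nat \<Rightarrow> real \<Rightarrow> nat" where
  "word_length K d p \<delta> = K * floorlog 2 (p + d + delta_bits \<delta>)"

definition param_state :: "nat \<Rightarrow> (nat \<Rightarrow> nat) \<Rightarrow> (nat \<Rightarrow> nat) \<Rightarrow> nat \<Rightarrow> real \<Rightarrow> state" where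
  "param_state d L \<kappa> p \<delta> =
     \<lparr>reg = (\<lambda>_. 0)(''d'' := d, ''p'' := p, ''t'' := delta_bits \<delta>),
      arr = (\<lambda>_ _. 0)(''L'' := (\<lambda>j. if 1 \<le> j \<and> j \<le> d then L j else 0),
                      ''kappa'' := (\<lambda>j. if j \<le> d then \<kappa> j else 0))\<rparr>"

definition set_reg :: "name \<Rightarrow> nat \<Rightarrow> state \<Rightarrow> state" where
  "set_reg x n s = s\<lparr>reg := (reg s)(x := n)\<rparr>"

definition set_arr :: "name \<Rightarrow> nat list \<Rightarrow> state \<Rightarrow> state" where
  "set_arr a xs s = s\<lparr>arr := (arr s)(a := (\<lambda>k. if k < length xs then xs ! k else 0))\<rparr>"

definition dense_input :: "nat \<Rightarrow> (nat \<Rightarrow> nat) \<Rightarrow> (nat list \<Rightarrow> nat) \<Rightarrow> state \<Rightarrow> state" where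
  "dense_input d L u =
     set_arr ''u'' (map (\<lambda>k. u (inv_into (leaves d L) (leaf_index L) k)) [0..<num_leaves d L])"

definition sparse_rep :: "nat \<Rightarrow> (nat \<Rightarrow> nat) \<Rightarrow>
    (nat list \<Rightarrow> nat) \<Rightarrow> (nat list \<times> nat) list \<Rightarrow> bool" where
  "sparse_rep d L u xs \<longleftrightarrow> distinct xs \<and> set xs = (\<lambda>l. (l, u l)) ` supp d L u"

definition sparse_input :: "(nat \<Rightarrow> nat) \<Rightarrow> (nat list \<times> nat) list \<Rightarrow> state \<Rightarrow> state" where
  "sparse_input L xs s =
     set_reg ''n'' (length xs)
       (set_arr ''idx'' (map (\<lambda>x. leaf_index L (fst x)) xs) (set_arr ''val'' (map snd xs) s))"

definition sketch_input :: "bool list \<Rightarrow> bool list \<Rightarrow> state \<Rightarrow> state" where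
  "sketch_input x y s =
     set_reg ''n1'' (length x) (set_arr ''s1'' (map of_bool x)
       (set_reg ''n2'' (length y) (set_arr ''s2'' (map of_bool y) s)))"

definition sketch_output :: "bool list \<Rightarrow> state \<Rightarrow> bool" where
  "sketch_output x s \<longleftrightarrow>
     reg s ''n'' = length x \<and> (\<forall>k<length x. arr s ''out'' k = of_bool (x ! k))"

definition triples_output :: "(nat \<times> nat \<times> nat) list \<Rightarrow> state \<Rightarrow> bool" where
  "triples_output xs s \<longleftrightarrow>
     reg s ''n'' = length xs \<and>
     (\<forall>k<length xs. (arr s ''i'' k, arr s ''a'' k, arr s ''b'' k) = xs ! k)"

definition hmr_sound :: "nat \<Rightarrow> (nat \<Rightarrow> nat) \<Rightarrow>
    (nat list \<Rightarrow> nat) \<Rightarrow> (nat list \<Rightarrow> nat) \<Rightarrow> (nat \<times> nat \<times> nat) list \<Rightarrow> bool" where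
  "hmr_sound d L u w xs \<longleftrightarrow> set xs \<subseteq> encode_triple L ` MIS d L u w"

definition hmr_complete :: "nat \<Rightarrow> (nat \<Rightarrow> nat) \<Rightarrow> (nat \<Rightarrow> nat) \<Rightarrow> nat \<Rightarrow>
    (nat list \<Rightarrow> nat) \<Rightarrow> (nat list \<Rightarrow> nat) \<Rightarrow> (nat \<times> nat \<times> nat) list \<Rightarrow> bool" where
  "hmr_complete d L \<kappa> R u w xs \<longleftrightarrow> encode_triple L ` MIS_target d L \<kappa> R u w \<subseteq> set xs"

end

theory Submission
  imports Defs
begin

text \<open>
  The public random words provide fully random hash functions.  Bottom up, the \<open>\<kappa>\<^sub>j\<close> buckets of every
  child at depth \<open>j\<close> are hashed into the \<open>\<kappa>\<^sub>j\<^sub>-\<^sub>1\<close> buckets of its parent, so every leaf reaches one of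
  \<open>\<kappa>\<^sub>0\<close> root buckets.  By induction, the buckets of a node \<open>v\<close> that contain a mismatch number at most
  \<open>load\<^sub>v\<close>; hence at an \<open>R\<close>-underloaded node an accessible mismatch collides with probability at most
  \<open>1/R\<close>, and it is alone in its root bucket with probability at least \<open>3/4\<close>.  A bucket stores two power
  sums, from which a single mismatch is decoded, and a random linear fingerprint, which exposes a
  bucket with several mismatches.  With \<open>4 z\<close> repetitions, \<open>z = O(log n + log (1/\<delta>))\<close>, a triple is output
  when it is decoded in more than \<open>z\<close> of them: an accessible mismatch is missed with probability at
  most \<open>2\<^sup>4\<^sup>z 4\<^sup>-\<^sup>3\<^sup>z\<close>, and a false triple appears with probability at most \<open>2\<^sup>4\<^sup>z 64\<^sup>-\<^sup>z\<close>.
\<close>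

text \<open>The words that hash a leaf are selected by random words drawn deeper in the tree, so
  nothing is conditioned on explicitly: probabilities are counts of word arrays in which one word is
  exchanged. The moduli \<open>\<kappa> j\<close> and \<open>64 * N\<close> are powers of two
  dividing \<open>2 ^ W\<close>, hence residues of a random word are exactly uniform. The hypothesis
  \<open>R \<ge> 4 * d\<close> splits a collision budget of 1/4 evenly over the \<open>d\<close>
  levels. Fingerprint coefficients take \<open>64 * N\<close> values because a false match must be
  excluded for all \<open>\<kappa> 0 \<le> N\<close> buckets at once, leaving 1/64 per repetition.
  The threshold \<open>t + clog N + 1\<close> pays for a union over one soundness event and at most
  \<open>N\<close> accessible leaves. Cutting the output to \<open>\<kappa> 0\<close> triples loses
  no required triple: if the root is overloaded no leaf is accessible, and otherwise at most a
  quarter of its buckets are occupied in each repetition. Working with integers rather than residues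
  replaces modular inverses by one exact division.\<close>

section \<open>Counting random words\<close>

text \<open>
  Exchanging the drawn value with the word \<open>\<rho> (X \<rho>)\<close> is an involution on pairs (\<open>\<rho>\<close>, fresh value); this
  replaces conditioning even though the resampled position \<open>X \<rho>\<close> itself depends on \<open>\<rho>\<close>.
\<close>

lemma resample_card_le:
  fixes X :: "('a \<Rightarrow> 'b) \<Rightarrow> 'a"
  defines "Om \<equiv> \<lambda>I V. PiE I (\<lambda>_. V)"
  assumes fin: "finite I" "finite V" and ne: "V \<noteq> {}"
    and X: "\<And>\<rho>. \<rho> \<in> Om I V \<Longrightarrow> X \<rho> \<in> I"
    and Xinv: "\<And>\<rho> v. \<rho> \<in> Om I V \<Longrightarrow> v \<in> V \<Longrightarrow> X (\<rho>(X \<rho> := v)) = X \<rho>"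
    and Einv: "\<And>\<rho> v. \<rho> \<in> Om I V \<Longrightarrow> v \<in> V \<Longrightarrow> E (\<rho>(X \<rho> := v)) = E \<rho>"
    and F: "\<And>\<rho>. \<rho> \<in> Om I V \<Longrightarrow> real (card {v\<in>V. F (\<rho>(X \<rho> := v))}) \<le> c * real (card V)"
  shows "real (card {\<rho> \<in> Om I V. E \<rho> \<and> F \<rho>}) \<le> c * real (card {\<rho> \<in> Om I V. E \<rho>})"
proof -
  let ?E = "{\<rho> \<in> Om I V. E \<rho>}" and ?EF = "{\<rho> \<in> Om I V. E \<rho> \<and> F \<rho>}"
  let ?phi = "\<lambda>(\<rho>, v). (\<rho>(X \<rho> := v), \<rho> (X \<rho>))"
  let ?S = "Sigma ?E (\<lambda>\<rho>. {v\<in>V. F (\<rho>(X \<rho> := v))})"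
  have finOm: "finite (Om I V)"
    unfolding Om_def using fin by (intro finite_PiE) auto
  have upd: "\<rho>(X \<rho> := v) \<in> Om I V" if "\<rho> \<in> Om I V" "v \<in> V" for \<rho> v
    using that X[OF that(1)] unfolding Om_def by (auto simp: PiE_def Pi_def extensional_def)
  have val: "\<rho> (X \<rho>) \<in> V" if "\<rho> \<in> Om I V" for \<rho>
    using that X[OF that] unfolding Om_def by (auto simp: PiE_def Pi_def)
  have inj: "inj_on ?phi (?EF \<times> V)"
  proof (rule inj_onI, clarify)
    fix \<rho> v \<rho>' v'
    assume a: "\<rho> \<in> Om I V" "v \<in> V" "\<rho>' \<in> Om I V" "v' \<in> V"
      "\<rho>(X \<rho> := v) = \<rho>'(X \<rho>' := v')" "\<rho> (X \<rho>) = \<rho>' (X \<rho>')"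
    \<comment> \<open>By \<open>Xinv\<close> the updated array still determines the exchanged
      position, and the second component restores the overwritten word.\<close>
    have "X \<rho> = X \<rho>'" using Xinv a by metis
    then show "\<rho> = \<rho>' \<and> v = v'" using a(5,6)
      by (metis fun_upd_same fun_upd_triv fun_upd_upd)
  qed
  have sub: "?phi ` (?EF \<times> V) \<subseteq> ?S"
    using upd val Xinv Einv by auto
  have "card ?EF * card V = card (?phi ` (?EF \<times> V))"
    using inj by (simp add: card_image card_cartesian_product)
  also have "\<dots> \<le> card ?S"
    using finOm fin by (intro card_mono sub finite_SigmaI) auto
  also have "\<dots> = (\<Sum>\<rho>\<in>?E. card {v\<in>V. F (\<rho>(X \<rho> := v))})"
    by (rule card_SigmaI) (use finOm fin in auto)
  finally have "card ?EF * card V \<le> (\<Sum>\<rho>\<in>?E. card {v\<in>V. F (\<rho>(X \<rho> := v))})" .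
  from of_nat_mono[OF this, where 'a = real]
  have "real (card ?EF) * real (card V) \<le> (\<Sum>\<rho>\<in>?E. real (card {v\<in>V. F (\<rho>(X \<rho> := v))}))"
    by (simp only: of_nat_mult of_nat_sum)
  also have "\<dots> \<le> (\<Sum>\<rho>\<in>?E. c * real (card V))"
    using F by (intro sum_mono) auto
  also have "\<dots> = (c * real (card ?E)) * real (card V)" by simp
  finally show ?thesis
    using fin ne by (simp add: card_gt_0_iff)
qed

text \<open>Repetitions are peeled off one at a time, with the badness of those already treated as
  the event \<open>E\<close>. The predicate \<open>indep r E\<close> is left abstract; it only has
  to license this conditioning.\<close>

lemma card_all_bad_le:
  assumes "finite S" "finite Om" "\<beta> \<ge> 0"
    and step: "\<And>r E. r \<in> S \<Longrightarrow> indep r E \<Longrightarrow>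
      real (card {\<rho>\<in>Om. E \<rho> \<and> Bad r \<rho>}) \<le> \<beta> * real (card {\<rho>\<in>Om. E \<rho>})"
    and ind: "\<And>r S'. r \<in> S \<Longrightarrow> r \<notin> S' \<Longrightarrow> S' \<subseteq> S \<Longrightarrow> indep r (\<lambda>\<rho>. \<forall>r'\<in>S'. Bad r' \<rho>)"
  shows "real (card {\<rho>\<in>Om. \<forall>r\<in>S. Bad r \<rho>}) \<le> \<beta> ^ card S * real (card Om)"
proof -
  have "real (card {\<rho>\<in>Om. \<forall>r\<in>S'. Bad r \<rho>}) \<le> \<beta> ^ card S' * real (card Om)" if "S' \<subseteq> S" for S'
    using finite_subset[OF that assms(1)] that
  proof (induction S' rule: finite_induct)
    case (insert r S')
    have "real (card {\<rho>\<in>Om. \<forall>r\<in>insert r S'. Bad r \<rho>})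
        = real (card {\<rho>\<in>Om. (\<forall>r'\<in>S'. Bad r' \<rho>) \<and> Bad r \<rho>})"
      by (intro arg_cong[where f = "\<lambda>A. real (card A)"]) auto
    also have "\<dots> \<le> \<beta> * real (card {\<rho>\<in>Om. \<forall>r'\<in>S'. Bad r' \<rho>})"
      by (rule step[OF _ ind]) (use insert.hyps insert.prems in auto)
    also have "\<dots> \<le> \<beta> * (\<beta> ^ card S' * real (card Om))"
      by (rule mult_left_mono[OF insert.IH \<open>\<beta> \<ge> 0\<close>]) (use insert.prems in auto)
    finally show ?case using insert.hyps by (simp add: mult_ac)
  qed simp
  then show ?thesis by simp
qed

text \<open>A union bound over the at most \<open>2 ^ q\<close> sets of at least \<open>h\<close>
  repetitions; as \<open>\<beta> \<le> 1\<close>, larger sets only help.\<close>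

lemma card_many_bad_le:
  assumes "finite Om" "\<beta> \<ge> 0" "\<beta> \<le> 1"
    and step: "\<And>r E. r < q \<Longrightarrow> indep r E \<Longrightarrow>
      real (card {\<rho>\<in>Om. E \<rho> \<and> Bad r \<rho>}) \<le> \<beta> * real (card {\<rho>\<in>Om. E \<rho>})"
    and ind: "\<And>r S'. r < q \<Longrightarrow> r \<notin> S' \<Longrightarrow> indep r (\<lambda>\<rho>. \<forall>r'\<in>S'. Bad r' \<rho>)"
  shows "real (card {\<rho>\<in>Om. h \<le> card {r. r < q \<and> Bad r \<rho>}}) \<le> 2 ^ q * \<beta> ^ h * real (card Om)"
proof -
  let ?T = "{S. S \<subseteq> {..<q} \<and> h \<le> card S}"
  let ?A = "\<lambda>S. {\<rho>\<in>Om. \<forall>r\<in>S. Bad r \<rho>}"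
  have finT: "finite ?T" by (rule finite_subset[of _ "Pow {..<q}"]) auto
  have "{\<rho>\<in>Om. h \<le> card {r. r < q \<and> Bad r \<rho>}} \<subseteq> (\<Union>S\<in>?T. ?A S)"
  proof
    fix \<rho> assume "\<rho> \<in> {\<rho>\<in>Om. h \<le> card {r. r < q \<and> Bad r \<rho>}}"
    then show "\<rho> \<in> (\<Union>S\<in>?T. ?A S)"
      by (intro UN_I[of "{r. r < q \<and> Bad r \<rho>}"]) auto
  qed
  then have "card {\<rho>\<in>Om. h \<le> card {r. r < q \<and> Bad r \<rho>}} \<le> card (\<Union>S\<in>?T. ?A S)"
    using assms(1) by (intro card_mono finite_UN_I[OF finT]) auto
  also have "\<dots> \<le> (\<Sum>S\<in>?T. card (?A S))" by (rule card_UN_le[OF finT])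
  finally have "card {\<rho>\<in>Om. h \<le> card {r. r < q \<and> Bad r \<rho>}} \<le> (\<Sum>S\<in>?T. card (?A S))" .
  from of_nat_mono[OF this, where 'a = real]
  have "real (card {\<rho>\<in>Om. h \<le> card {r. r < q \<and> Bad r \<rho>}}) \<le> (\<Sum>S\<in>?T. real (card (?A S)))"
    by (simp only: of_nat_sum)
  also have "\<dots> \<le> (\<Sum>S\<in>?T. \<beta> ^ h * real (card Om))"
  proof (rule sum_mono)
    fix S assume S: "S \<in> ?T"
    then have "finite S" by (auto intro: finite_subset[of _ "{..<q}"])
    have "real (card (?A S)) \<le> \<beta> ^ card S * real (card Om)"
    proof (intro card_all_bad_le[where indep = indep])
      fix r E assume r: "r \<in> S" and E: "indep r E"
      have "r < q" using r S by blast
      then show "real (card {\<rho>\<in>Om. E \<rho> \<and> Bad r \<rho>}) \<le> \<beta> * real (card {\<rho>\<in>Om. E \<rho>})"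
        using E by (rule step)
    next
      fix r S' assume r: "r \<in> S" "r \<notin> S'" "S' \<subseteq> S"
      have "r < q" using r S by blast
      then show "indep r (\<lambda>\<rho>. \<forall>r'\<in>S'. Bad r' \<rho>)"
        using r(2) by (rule ind)
    qed fact+
    also have "\<dots> \<le> \<beta> ^ h * real (card Om)"
      using S assms(2,3) by (intro mult_right_mono power_decreasing) auto
    finally show "real (card (?A S)) \<le> \<beta> ^ h * real (card Om)" .
  qed
  also have "\<dots> = real (card ?T) * (\<beta> ^ h * real (card Om))" by simp
  also have "\<dots> \<le> 2 ^ q * (\<beta> ^ h * real (card Om))"
  proof (rule mult_right_mono)
    have "card ?T \<le> card (Pow {..<q})" by (intro card_mono) auto
    then have "card ?T \<le> 2 ^ q" by (simp add: card_Pow)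
    then show "real (card ?T) \<le> 2 ^ q" by (metis of_nat_le_iff of_nat_numeral of_nat_power)
  qed (use assms(2) in simp)
  finally show ?thesis by (simp add: mult_ac)
qed

text \<open>Since \<open>M\<close> divides \<open>N\<close>, every residue class has exactly
  \<open>N div M\<close> members below \<open>N\<close>: reduction is uniform.\<close>

lemma card_mod_in_le:
  fixes M N :: nat
  assumes "M dvd N" "M > 0" "finite C"
  shows "card {v\<in>{..<N}. v mod M \<in> C} \<le> card C * (N div M)"
proof -
  have "{v\<in>{..<N}. v mod M \<in> C} \<subseteq> (\<lambda>(c, i). i * M + c) ` (C \<times> {..<N div M})"
  proof
    fix v assume v: "v \<in> {v\<in>{..<N}. v mod M \<in> C}"
    have "v div M < N div M"
      using v assms by (auto simp: div_less_iff_less_mult)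
    then show "v \<in> (\<lambda>(c, i). i * M + c) ` (C \<times> {..<N div M})"
      using v by (intro image_eqI[of _ _ "(v mod M, v div M)"]) auto
  qed
  then have "card {v\<in>{..<N}. v mod M \<in> C} \<le> card (C \<times> {..<N div M})"
    using assms by (intro surj_card_le) auto
  then show ?thesis by (simp add: card_cartesian_product)
qed

section \<open>Hashing the leaves up the tree\<close>

text \<open>The binary logarithm rounded up, defined on the naturals so that it is characterised by
  the Galois connection \<open>clog_le_iff\<close>.\<close>

definition clog :: "nat \<Rightarrow> nat" where
  "clog x = (LEAST k. x \<le> 2 ^ k)"

lemma clog_le_iff: "clog x \<le> k \<longleftrightarrow> x \<le> 2 ^ k"
proof
  have "x \<le> 2 ^ x" using less_exp[of x] by simp
  then have "x \<le> 2 ^ clog x" unfolding clog_def by (rule LeastI)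
  also assume "clog x \<le> k"
  then have "(2::nat) ^ clog x \<le> 2 ^ k" by simp
  finally show "x \<le> 2 ^ k" .
qed (simp add: clog_def Least_le)

lemma clog_pow2 [simp]: "clog (2 ^ k) = k"
  using clog_le_iff[of "2 ^ k"] by (metis dual_order.antisym le_refl power_increasing_iff one_less_numeral_iff semiring_norm(76))

lemma clog_le_self: "clog x \<le> x"
  using less_exp[of x] by (simp add: clog_le_iff)

lemma mixed_radix_eqD:
  fixes a b a' b' :: nat
  assumes "a * B + b = a' * B + b'" "b < B" "b' < B"
  shows "a = a'" "b = b'"
proof -
  have "a = (a * B + b) div B" using assms(2) by simp
  also have "\<dots> = (a' * B + b') div B" by (simp only: assms(1))
  also have "\<dots> = a'" using assms(3) by simp
  finally show "a = a'" .
  then show "b = b'" using assms(1) by simp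
qed

lemma mixed_radix_less:
  fixes a b :: nat
  assumes "a < A" "b < B"
  shows "a * B + b < A * B"
proof -
  have "a * B + b < Suc a * B" using assms by simp
  also have "\<dots> \<le> A * B" using assms by (intro mult_right_mono) auto
  finally show ?thesis .
qed

text \<open>
  If \<open>4 d \<ge> \<kappa>\<^sub>0\<close>, then every node on the path to a mismatch is overloaded and the programs stop at
  once; so \<open>big\<close> costs nothing, and it makes one pass over all \<open>d\<close> levels affordable.
\<close>

locale hmr =
  fixes d :: nat and L \<kappa> :: "nat \<Rightarrow> nat" and p t W :: nat
  assumes params: "hmr_params d L \<kappa> p"
    and word: "(p + d + t) ^ 8 < 2 ^ W"
    and big: "4 * d < \<kappa> 0"
begin

section \<open>Sizes of the scheme and elementary bounds on the parameters\<close>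

definition "N = num_leaves d L"
text \<open>Chosen so that \<open>2 * N\<close> failure events of probability
  \<open>(1/4) ^ thr\<close> together weigh at most \<open>(1/2) ^ t\<close>.\<close>

definition "thr = t + clog N + 1"
definition "nrep = 4 * thr"
text \<open>Cells stay below \<open>p ^ 3\<close> (\<open>cell_le\<close>), hence three times the
  bits of a symbol suffice.\<close>

definition "width = 3 * clog (p + 1)"
definition "ncell = nrep * \<kappa> 0"
definition "nbit = 3 * ncell * width"

lemma d_pos: "1 \<le> d" and prime_p: "prime p"
  using params by (auto simp: hmr_params_def)

lemma L_pow: "1 \<le> j \<Longrightarrow> j \<le> d \<Longrightarrow> \<exists>k. L j = 2 ^ k"
  using params by (auto simp: hmr_params_def)

lemma L_pos: "1 \<le> j \<Longrightarrow> j \<le> d \<Longrightarrow> 0 < L j"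
  using L_pow[of j] by auto

lemma kap_pow: "j \<le> d \<Longrightarrow> \<exists>k. \<kappa> j = 2 ^ k"
  using params by (auto simp: hmr_params_def)

lemma kap_pos: "j \<le> d \<Longrightarrow> 0 < \<kappa> j"
  using kap_pow[of j] by auto

lemma kap_mono: "i \<le> j \<Longrightarrow> j \<le> d \<Longrightarrow> \<kappa> j \<le> \<kappa> i"
proof (induction j rule: dec_induct)
  case (step j)
  moreover have "\<kappa> (Suc j) \<le> \<kappa> j"
    using params step.prems by (auto simp: hmr_params_def)
  ultimately show ?case by simp
qed simp

lemma kap0_le: "\<kappa> 0 \<le> N"
  using params by (auto simp: hmr_params_def N_def num_leaves_def)

lemma kap_le: "j \<le> d \<Longrightarrow> \<kappa> j \<le> N"
  using kap_mono[of 0 j] kap0_le by simp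

lemma N_pow: "N = 2 ^ clog N"
proof -
  have "\<exists>k. (\<Prod>j=1..m. L j) = 2 ^ k" if "m \<le> d" for m
    using that
  proof (induction m)
    case (Suc m)
    then obtain k k' where "(\<Prod>j=1..m. L j) = 2 ^ k" "L (Suc m) = 2 ^ k'"
      using L_pow[of "Suc m"] by auto
    then have "(\<Prod>j=1..Suc m. L j) = 2 ^ (k + k')" by (simp add: power_add)
    then show ?case by blast
  qed (auto intro: exI[of _ 0])
  then obtain k where "N = 2 ^ k" by (auto simp: N_def num_leaves_def)
  then show ?thesis by simp
qed

lemma N_ge: "8 \<le> N"
proof -
  obtain k where k: "\<kappa> 0 = 2 ^ k" using kap_pow[of 0] by auto
  have "(2::nat) ^ 2 < 2 ^ k" using big d_pos k by simp
  then have "3 \<le> k" by (drule_tac power_less_imp_less_exp[rotated]) auto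
  then have "(2::nat) ^ 3 \<le> 2 ^ k" by (intro power_increasing) auto
  then show ?thesis using kap0_le k by simp
qed

lemma N_pos: "0 < N" using N_ge by simp

lemma d_less_N: "d < N" using big kap0_le by simp

lemma p_ge: "4 * N\<^sup>2 \<le> p"
  using params by (auto simp: hmr_params_def N_def num_leaves_def prod_power_distrib)

lemma N_le_p: "N \<le> p"
proof -
  have "N * 1 \<le> N * N" using N_pos by (intro mult_left_mono) auto
  then show ?thesis using p_ge unfolding power2_eq_square by linarith
qed

text \<open>This absorbs numerical constants: factors such as 4, 36 or 64 are traded for one more
  factor \<open>p\<close> or \<open>Q\<close> in the word-size estimates.\<close>

lemma p_ge_256: "256 \<le> p"
proof -
  have "8 ^ 2 \<le> N\<^sup>2" using N_ge by (intro power_mono) auto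
  then show ?thesis using p_ge by simp
qed

abbreviation "Q \<equiv> p + d + t"

lemma thr_le: "thr \<le> Q"
  using clog_le_self[of N] less_exp[of "clog N"] N_pow N_le_p unfolding thr_def by linarith

lemma nrep_le: "nrep \<le> 4 * Q"
  using thr_le by (simp add: nrep_def)

text \<open>
  The word that hashes item \<open>b\<close> of node \<open>k\<close> at depth \<open>j\<close> in repetition \<open>r\<close>.  Depth \<open>0\<close> is never hashed:
  its slots hold the fingerprint coefficients \<open>fp\<close>.
\<close>

definition addr :: "nat \<Rightarrow> nat \<Rightarrow> nat \<Rightarrow> nat \<Rightarrow> nat" where
  "addr r j k b = ((r * (d + 1) + j) * N + k) * N + b"

lemma addr_inj:
  assumes "addr r j k b = addr r' j' k' b'" "j \<le> d" "k < N" "b < N" "j' \<le> d" "k' < N" "b' < N"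
  shows "r = r' \<and> j = j' \<and> k = k' \<and> b = b'"
proof -
  note * = assms(1)[unfolded addr_def]
  have 1: "(r * (d + 1) + j) * N + k = (r' * (d + 1) + j') * N + k'" "b = b'"
    using mixed_radix_eqD[OF *] assms by auto
  have 2: "r * (d + 1) + j = r' * (d + 1) + j'" "k = k'"
    using mixed_radix_eqD[OF 1(1)] assms by auto
  have "r = r'" "j = j'" using mixed_radix_eqD[OF 2(1)] assms by auto
  then show ?thesis using 1 2 by simp
qed

lemma addr_less:
  assumes "r < nrep" "j \<le> d" "k < N" "b < N"
  shows "addr r j k b < 2 ^ W"
proof -
  have "r * (d + 1) + j < nrep * (d + 1)" using assms by (intro mixed_radix_less) auto
  then have "(r * (d + 1) + j) * N + k < nrep * (d + 1) * N" using assms by (intro mixed_radix_less) auto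
  then have "addr r j k b < nrep * (d + 1) * N * N"
    unfolding addr_def using assms by (intro mixed_radix_less) auto
  also have "\<dots> \<le> (4 * Q) * Q * Q * Q"
    using nrep_le N_le_p p_ge_256 d_less_N by (intro mult_mono) auto
  also have "\<dots> \<le> Q * Q * Q * Q * Q"
    using p_ge_256 by (intro mult_right_mono) auto
  also have "\<dots> = Q ^ 5" by (simp add: numeral_eq_Suc)
  also have "\<dots> \<le> Q ^ 8" using p_ge_256 by (intro power_increasing) auto
  finally show ?thesis using word by simp
qed

text \<open>
  A level with a single child passes its bucket on unchanged.  Only the at most \<open>log N\<close> other levels
  have to be visited per leaf, whereas \<open>d\<close> need not be polylogarithmic in \<open>p\<close>.
\<close>

definition step :: "(nat \<Rightarrow> nat) \<Rightarrow> nat \<Rightarrow> nat \<Rightarrow> nat \<times> nat \<Rightarrow> nat \<times> nat" where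
  "step \<rho> r j x = (fst x div L j,
     if L j = 1 then snd x else \<rho> (addr r j (fst x) (snd x)) mod \<kappa> (j - 1))"

text \<open>The state of leaf \<open>i\<close> after \<open>s\<close> levels of ascent: the rank of
  its ancestor at depth \<open>d - s\<close> and the bucket reached there. A leaf starts in bucket 0
  of its own node.\<close>

primrec st :: "(nat \<Rightarrow> nat) \<Rightarrow> nat \<Rightarrow> nat \<Rightarrow> nat \<Rightarrow> nat \<times> nat" where
  "st \<rho> r i 0 = (i, 0)"
| "st \<rho> r i (Suc s) = step \<rho> r (d - s) (st \<rho> r i s)"

definition bucket :: "(nat \<Rightarrow> nat) \<Rightarrow> nat \<Rightarrow> nat \<Rightarrow> nat" where
  "bucket \<rho> r i = snd (st \<rho> r i d)"

lemma st_fst_le: "fst (st \<rho> r i s) \<le> i"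
  by (induction s) (auto simp: step_def intro: order_trans[OF div_le_dividend])

lemma st_snd_less: "s \<le> d \<Longrightarrow> snd (st \<rho> r i s) < \<kappa> (d - s)"
proof (induction s)
  case 0
  then show ?case using kap_pos[of d] by simp
next
  case (Suc s)
  have "\<kappa> (d - s) \<le> \<kappa> (d - Suc s)" by (intro kap_mono) auto
  then show ?case using Suc kap_pos[of "d - Suc s"] by (auto simp: step_def)
qed

lemma st_less: "i < N \<Longrightarrow> s \<le> d \<Longrightarrow> fst (st \<rho> r i s) < N \<and> snd (st \<rho> r i s) < N"
  using st_fst_le[of \<rho> r i s] st_snd_less[of s \<rho> r i] kap_le[of "d - s"] by auto

lemma bucket_less: "bucket \<rho> r i < \<kappa> 0"
  using st_snd_less[of d \<rho> r i] by (simp add: bucket_def)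

text \<open>After \<open>s\<close> levels only words of depth greater than \<open>d - s\<close> have
  been read. This makes a position computed from the state invariant under resampling the word
  stored there.\<close>

lemma st_upd:
  assumes "i < N" "s \<le> d"
    and "\<And>j k b. d - s < j \<Longrightarrow> j \<le> d \<Longrightarrow> k < N \<Longrightarrow> b < N \<Longrightarrow> a \<noteq> addr r j k b"
  shows "st (\<rho>(a := v)) r i s = st \<rho> r i s"
  using assms(2,3)
proof (induction s)
  case (Suc s)
  have "st (\<rho>(a := v)) r i s = st \<rho> r i s"
    by (rule Suc.IH) (use Suc.prems in auto)
  moreover have "a \<noteq> addr r (d - s) (fst (st \<rho> r i s)) (snd (st \<rho> r i s))"
    using Suc.prems st_less[of i s \<rho> r] assms(1) by auto
  ultimately show ?case by (simp add: step_def fun_upd_def)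
qed simp

section \<open>Resampling a word of one repetition\<close>

definition Om :: "(nat \<Rightarrow> nat) set" where
  "Om = rand_words W"

lemma finite_Om: "finite Om"
  unfolding Om_def rand_words_def by (intro finite_PiE) auto

text \<open>Independence in functional form: no word of block \<open>r\<close> influences
  \<open>E\<close>, so words of that block may be exchanged while \<open>E\<close> is kept.\<close>

definition indep :: "nat \<Rightarrow> ((nat \<Rightarrow> nat) \<Rightarrow> bool) \<Rightarrow> bool" where
  "indep r E \<longleftrightarrow> (\<forall>\<rho>\<in>Om. \<forall>j\<le>d. \<forall>k<N. \<forall>b<N. \<forall>v<2 ^ W. E (\<rho>(addr r j k b := v)) = E \<rho>)"

lemma resample:
  assumes "r < nrep" "indep r E"
    and X: "\<And>\<rho>. \<rho> \<in> Om \<Longrightarrow> j \<rho> \<le> d \<and> k \<rho> < N \<and> b \<rho> < N \<and> X \<rho> = addr r (j \<rho>) (k \<rho>) (b \<rho>)"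
    and Xinv: "\<And>\<rho> v. \<rho> \<in> Om \<Longrightarrow> v < 2 ^ W \<Longrightarrow> X (\<rho>(X \<rho> := v)) = X \<rho>"
    and F: "\<And>\<rho>. \<rho> \<in> Om \<Longrightarrow> real (card {v\<in>{..<2 ^ W}. F (\<rho>(X \<rho> := v))}) \<le> c * 2 ^ W"
  shows "real (card {\<rho>\<in>Om. E \<rho> \<and> F \<rho>}) \<le> c * real (card {\<rho>\<in>Om. E \<rho>})"
  unfolding Om_def rand_words_def
proof (rule resample_card_le[where X = X], fold rand_words_def, fold Om_def)
  show "X \<rho> \<in> {..<2 ^ W}" if "\<rho> \<in> Om" for \<rho>
    using X[OF that] addr_less assms(1) by auto
  show "E (\<rho>(X \<rho> := v)) = E \<rho>" if "\<rho> \<in> Om" "v \<in> {..<2 ^ W}" for \<rho> v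
    using X[OF that(1)] that assms(2) by (auto simp: indep_def)
  show "{..<(2::nat) ^ W} \<noteq> {}" by (metis lessThan_iff empty_iff zero_less_numeral zero_less_power)
qed (use Xinv F in auto)

text \<open>Used for the moduli \<open>\<kappa> j\<close> and \<open>64 * N\<close>: being powers of
  two that fit in a word, they divide the number of words.\<close>

lemma pow2_dvd_word: "2 ^ k \<le> Q ^ 8 \<Longrightarrow> (2::nat) ^ k dvd 2 ^ W"
proof -
  assume "2 ^ k \<le> Q ^ 8"
  then have "(2::nat) ^ k < 2 ^ W" by (rule le_less_trans[OF _ word])
  then show ?thesis by (intro le_imp_power_dvd less_imp_le) (rule power_less_imp_less_exp[of "2::nat"], auto)
qed

lemma kap_dvd_word: "j \<le> d \<Longrightarrow> \<kappa> j dvd 2 ^ W"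
proof -
  assume j: "j \<le> d"
  then obtain k where k: "\<kappa> j = 2 ^ k" using kap_pow by blast
  have "\<kappa> j \<le> Q" using kap_le[OF j] N_le_p by simp
  also have "\<dots> = Q ^ 1" by simp
  also have "\<dots> \<le> Q ^ 8" using p_ge_256 by (intro power_increasing) auto
  finally show ?thesis using pow2_dvd_word k by simp
qed

section \<open>Leaves, their ranks and the ancestors of a leaf\<close>

definition by_index :: "(nat list \<Rightarrow> nat) \<Rightarrow> nat \<Rightarrow> nat" where
  "by_index u i = u (inv_into (leaves d L) (leaf_index L) i)"

lemma by_index_leaf: "l \<in> leaves d L \<Longrightarrow> by_index u (leaf_index L l) = u l"
  unfolding by_index_def using bij_betw_leaf_index[of L d] by (simp add: bij_betw_inv_into_left)

lemma leaf_index_less: "l \<in> leaves d L \<Longrightarrow> leaf_index L l < N"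
  using bij_betw_leaf_index[of L d] by (auto simp: bij_betw_def N_def)

lemma leaf_of_index: "i < N \<Longrightarrow> \<exists>l\<in>leaves d L. leaf_index L l = i"
  using bij_betw_imp_surj_on[OF bij_betw_leaf_index[of L d]] by (metis N_def imageE lessThan_iff)

definition mism :: "(nat \<Rightarrow> nat) \<Rightarrow> (nat \<Rightarrow> nat) \<Rightarrow> nat set" where
  "mism U V = {i. i < N \<and> U i \<noteq> V i}"

lemma mism_by_index: "mism (by_index u) (by_index w) = leaf_index L ` {l \<in> leaves d L. u l \<noteq> w l}"
proof (intro equalityI subsetI)
  fix i assume i: "i \<in> mism (by_index u) (by_index w)"
  then obtain l where "l \<in> leaves d L" "leaf_index L l = i"
    using leaf_of_index by (auto simp: mism_def)
  with i show "i \<in> leaf_index L ` {l \<in> leaves d L. u l \<noteq> w l}"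
    by (auto simp: mism_def by_index_leaf)
qed (auto simp: mism_def by_index_leaf leaf_index_less)

lemma take_leaf:
  assumes "l \<in> leaves d L" "j < d"
  shows "take (Suc j) l = take j l @ [l ! j]" "l ! j < L (Suc j)" "take j l \<in> nodes L j"
  using assms by (auto simp: nodes_def take_Suc_conv_app_nth)

text \<open>Division by \<open>L j\<close> drops the last mixed-radix digit of a rank, which is the
  step to the parent.\<close>

lemma st_fst_leaf:
  assumes "l \<in> leaves d L" "s \<le> d"
  shows "fst (st \<rho> r (leaf_index L l) s) = leaf_index L (take (d - s) l)"
  using assms(2)
proof (induction s)
  case 0
  then show ?case using assms(1) by (simp add: nodes_def)
next
  case (Suc s)
  let ?j = "d - Suc s"
  have j: "d - s = Suc ?j" "?j < d" using Suc.prems by auto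
  have len: "length (take ?j l) = ?j" using assms(1) j(2) by (simp add: nodes_def)
  have "leaf_index L (take (Suc ?j) l) div L (Suc ?j) = leaf_index L (take ?j l)"
    unfolding take_leaf(1)[OF assms(1) j(2)] leaf_index_snoc len
    using take_leaf(2)[OF assms(1) j(2)] by simp
  then show ?case using Suc j by (simp add: step_def)
qed

section \<open>Occupied buckets are bounded by loads\<close>

definition below :: "(nat list \<Rightarrow> nat) \<Rightarrow> (nat list \<Rightarrow> nat) \<Rightarrow> nat list \<Rightarrow> nat list set" where
  "below u w v = {l \<in> leaves d L. u l \<noteq> w l \<and> take (length v) l = v}"

lemma finite_leaves: "finite (leaves d L)"
  using bij_betw_finite[OF bij_betw_leaf_index[of L d]] by simp

lemma finite_below: "finite (below u w v)"
  unfolding below_def using finite_leaves by simp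

lemma below_children:
  assumes "length v = j" "j < d"
  shows "below u w v \<subseteq> (\<Union>a<L (Suc j). below u w (v @ [a]))"
proof
  fix l assume l: "l \<in> below u w v"
  then have "l \<in> leaves d L" by (simp add: below_def)
  from take_leaf[OF this assms(2)] l assms(1)
  show "l \<in> (\<Union>a<L (Suc j). below u w (v @ [a]))"
    by (auto simp: below_def intro!: bexI[of _ "l ! j"])
qed

text \<open>The map \<open>f\<close> is arbitrary so that the same union over children serves both
  the induction on loads and the count of states competing at a parent.\<close>

lemma card_below_children:
  assumes IH: "\<And>a. a < L (Suc j) \<Longrightarrow> card (f ` below u w (v @ [a])) \<le> load d L \<kappa> u w (v @ [a])"
    and "length v = j" "j < d"
  shows "card (f ` below u w v) \<le> (\<Sum>a<L (Suc j). load d L \<kappa> u w (v @ [a]))"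
proof -
  have "f ` below u w v \<subseteq> (\<Union>a<L (Suc j). f ` below u w (v @ [a]))"
    using below_children[OF assms(2,3), of u w] by blast
  then have "card (f ` below u w v) \<le> card (\<Union>a<L (Suc j). f ` below u w (v @ [a]))"
    using finite_below by (intro card_mono) auto
  also have "\<dots> \<le> (\<Sum>a<L (Suc j). card (f ` below u w (v @ [a])))"
    by (rule card_UN_le) simp
  also have "\<dots> \<le> (\<Sum>a<L (Suc j). load d L \<kappa> u w (v @ [a]))"
    using IH by (intro sum_mono) auto
  finally show ?thesis .
qed

text \<open>Deterministic, for every \<open>\<rho>\<close>: one hashing step maps the states of the
  children onto those of the parent and so cannot create new ones, and a node has only
  \<open>\<kappa> j\<close> buckets. These are the two arguments of the minimum defining the
  load.\<close>

lemma card_states_le_load: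
  assumes "length v = j" "j \<le> d"
  shows "card ((\<lambda>l. st \<rho> r (leaf_index L l) (d - j)) ` below u w v) \<le> load d L \<kappa> u w v"
  using assms(2,1)
proof (induction j arbitrary: v rule: inc_induct)
  case base
  let ?c = "card ((\<lambda>l. st \<rho> r (leaf_index L l) (d - d)) ` below u w v)"
  have sub: "below u w v \<subseteq> (if u v \<noteq> w v then {v} else {})"
    using base by (auto simp: below_def nodes_def)
  have "?c \<le> card (below u w v)" by (rule card_image_le[OF finite_below])
  also have "\<dots> \<le> card (if u v \<noteq> w v then {v} else {})" by (rule card_mono[OF _ sub]) simp
  also have "\<dots> = load d L \<kappa> u w v" using base by (subst load.simps) simp
  finally show ?case .
next
  case (step j)
  then have lv: "length v = j" "j < d" by auto
  let ?f = "\<lambda>s l. st \<rho> r (leaf_index L l) s"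
  have j: "d - j = Suc (d - Suc j)" "d - (d - Suc j) = Suc j" using lv by auto
  have im: "?f (d - j) ` below u w v = hmr.step d L \<kappa> \<rho> r (Suc j) ` (?f (d - Suc j) ` below u w v)"
    unfolding j(1) image_image by (simp add: j(2))
  have "card (?f (d - j) ` below u w v) \<le> card (?f (d - Suc j) ` below u w v)"
    unfolding im by (intro card_image_le finite_imageI finite_below)
  also have "\<dots> \<le> (\<Sum>a<L (Suc j). load d L \<kappa> u w (v @ [a]))"
  proof (rule card_below_children[OF _ lv])
    fix a show "card (?f (d - Suc j) ` below u w (v @ [a])) \<le> load d L \<kappa> u w (v @ [a])"
      by (rule step.IH) (simp add: lv)
  qed
  finally have 1: "card (?f (d - j) ` below u w v) \<le> (\<Sum>a<L (Suc j). load d L \<kappa> u w (v @ [a]))" .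
  have "st \<rho> r (leaf_index L l) (d - j) \<in> {leaf_index L v} \<times> {..<\<kappa> j}" if "l \<in> below u w v" for l
    using st_fst_leaf[of l "d - j" \<rho> r] st_snd_less[of "d - j" \<rho> r "leaf_index L l"] lv that
    by (simp add: below_def mem_Times_iff)
  then have "?f (d - j) ` below u w v \<subseteq> {leaf_index L v} \<times> {..<\<kappa> j}"
    by blast
  then have "card (?f (d - j) ` below u w v) \<le> card ({leaf_index L v} \<times> {..<\<kappa> j})"
    by (intro card_mono) auto
  then have "card (?f (d - j) ` below u w v) \<le> \<kappa> j" by simp
  with 1 have "card (?f (d - j) ` below u w v)
      \<le> min (\<kappa> j) (\<Sum>a<L (Suc j). load d L \<kappa> u w (v @ [a]))" by simp
  also have "\<dots> = load d L \<kappa> u w v"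
    by (subst (2) load.simps) (simp add: lv)
  finally show ?case .
qed

lemma card_buckets_le_load: "card (bucket \<rho> r ` mism (by_index u) (by_index w)) \<le> load d L \<kappa> u w []"
proof -
  have "card (bucket \<rho> r ` mism (by_index u) (by_index w))
      = card (snd ` (\<lambda>l. st \<rho> r (leaf_index L l) (d - 0)) ` below u w [])"
    unfolding mism_by_index below_def image_image bucket_def by simp
  also have "\<dots> \<le> card ((\<lambda>l. st \<rho> r (leaf_index L l) (d - 0)) ` below u w [])"
    by (intro card_image_le finite_imageI finite_below)
  also have "\<dots> \<le> load d L \<kappa> u w []" by (intro card_states_le_load) auto
  finally show ?thesis .
qed


text \<open>Hashing in repetition \<open>r'\<close> reads only its own block and only depths from 1
  on. The disjunct \<open>j = 0\<close> lets fingerprint words of the same repetition be exchanged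
  with all buckets fixed.\<close>

lemma st_upd_other:
  assumes "r \<noteq> r' \<or> j = 0" "j \<le> d" "k < N" "b < N" "i < N" "s \<le> d"
  shows "st (\<rho>(addr r j k b := v)) r' i s = st \<rho> r' i s"
proof (rule st_upd[OF assms(5,6)])
  fix j' k' b' assume "d - s < j'" "j' \<le> d" "k' < N" "b' < N"
  then show "addr r j k b \<noteq> addr r' j' k' b'"
    using addr_inj[of r j k b r' j' k' b'] assms by auto
qed

lemma bucket_upd_other:
  assumes "r \<noteq> r' \<or> j = 0" "j \<le> d" "k < N" "b < N" "i < N"
  shows "bucket (\<rho>(addr r j k b := v)) r' i = bucket \<rho> r' i"
  using st_upd_other[OF assms, of d] by (simp add: bucket_def)

section \<open>Collisions\<close>

text \<open>Equal states stay equal, since a step depends on the state alone; hence a leaf that ends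
  in the bucket of \<open>i0\<close> is charged to the one level at which its state merges with that
  of \<open>i0\<close>.\<close>

definition coll :: "(nat \<Rightarrow> nat) \<Rightarrow> nat \<Rightarrow> nat set \<Rightarrow> nat \<Rightarrow> nat \<Rightarrow> bool" where
  "coll \<rho> r D i0 s \<longleftrightarrow>
     (\<exists>i\<in>D. st \<rho> r i s \<noteq> st \<rho> r i0 s \<and> st \<rho> r i (Suc s) = st \<rho> r i0 (Suc s))"

definition isolates :: "(nat \<Rightarrow> nat) \<Rightarrow> nat set \<Rightarrow> nat \<Rightarrow> nat \<Rightarrow> bool" where
  "isolates \<rho> D i0 r \<longleftrightarrow> (\<forall>i\<in>D. bucket \<rho> r i = bucket \<rho> r i0 \<longrightarrow> i = i0)"

lemma st_root:
  assumes "i < N"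
  shows "st \<rho> r i d = (0, bucket \<rho> r i)"
proof -
  obtain l where l: "l \<in> leaves d L" "leaf_index L l = i"
    using leaf_of_index[OF assms] by blast
  have "fst (st \<rho> r i d) = 0"
    using st_fst_leaf[OF l(1), of d \<rho> r] l(2) by (simp add: leaf_index_def)
  then show ?thesis by (simp add: bucket_def prod_eq_iff)
qed

text \<open>Distinct leaves start in distinct states because their ranks differ, and without a
  collision they remain distinct up to the root, where a state is just a bucket.\<close>

lemma isolates_if_no_coll:
  assumes "\<forall>s<d. \<not> coll \<rho> r D i0 s" "D \<subseteq> {..<N}" "i0 < N"
  shows "isolates \<rho> D i0 r"
  unfolding isolates_def
proof (intro ballI impI, rule ccontr)
  fix i assume i: "i \<in> D" "bucket \<rho> r i = bucket \<rho> r i0" "i \<noteq> i0"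
  have "st \<rho> r i s \<noteq> st \<rho> r i0 s" if "s \<le> d" for s
    using that
  proof (induction s)
    case (Suc s)
    then have "s < d" "st \<rho> r i s \<noteq> st \<rho> r i0 s" by auto
    then show ?case using assms(1) i(1) unfolding coll_def by blast
  qed (simp add: i(3))
  from this[of d] show False
    using st_root[of i \<rho> r] st_root[of i0 \<rho> r] i assms(2,3) by auto
qed

text \<open>Underloadedness on the path, with the real quotient cleared so that later counts stay in
  the naturals.\<close>

lemma accessible_load_less:
  assumes "l \<in> target d L \<kappa> R u w" "4 * d \<le> R" "j < d"
  shows "4 * d * load d L \<kappa> u w (take j l) < \<kappa> j"
proof -
  let ?l = "load d L \<kappa> u w (take j l)"
  have len: "length (take j l) = j"
    using assms by (simp add: target_def nodes_def)
  have "R > 0" using d_pos assms(2) by simp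
  have "\<not> node_overloaded d L \<kappa> R u w (take j l)"
    using assms by (simp add: target_def accessible_def)
  then have "real ?l < real (\<kappa> j) / real R"
    unfolding node_overloaded_def len by simp
  then have "real R * real ?l < real (\<kappa> j)"
    using \<open>R > 0\<close> by (simp add: field_simps)
  then have "R * ?l < \<kappa> j" by (metis of_nat_less_iff of_nat_mult)
  moreover have "4 * d * ?l \<le> R * ?l" using assms(2) by (rule mult_right_mono) simp
  ultimately show ?thesis by (rule le_less_trans[rotated])
qed

text \<open>The states that compete with \<open>i0\<close> when it is hashed into its parent fill at
  most a \<open>1 / (4 * d)\<close> fraction of the parent's buckets. They are counted by the loads
  of the children, and an underloaded parent has a load equal to that sum.\<close>

lemma card_sibling_states:
  assumes l: "l \<in> target d L \<kappa> R u w" "4 * d \<le> R" and s: "s < d"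
  defines "i0 \<equiv> leaf_index L l"
  shows "4 * d * card {x. \<exists>i\<in>mism (by_index u) (by_index w). x = st \<rho> r i s \<and>
      fst x div L (d - s) = fst (st \<rho> r i0 s) div L (d - s)} \<le> \<kappa> (d - Suc s)"
proof -
  let ?j = "d - Suc s"
  let ?v = "take ?j l"
  let ?f = "\<lambda>l. st \<rho> r (leaf_index L l) s"
  let ?O = "{x. \<exists>i\<in>mism (by_index u) (by_index w). x = st \<rho> r i s \<and>
      fst x div L (d - s) = fst (st \<rho> r i0 s) div L (d - s)}"
  have j: "d - s = Suc ?j" "?j < d" "d - Suc ?j = s" using s by auto
  have leaf: "l \<in> leaves d L" using l by (simp add: target_def)
  have len: "length ?v = ?j" using leaf j by (simp add: nodes_def)
  have par: "fst (st \<rho> r (leaf_index L l') s) div L (d - s) = leaf_index L (take ?j l')"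
    if "l' \<in> leaves d L" for l'
    using st_fst_leaf[OF that, of "Suc s" \<rho> r] s by (simp add: step_def)
  have "?O \<subseteq> ?f ` below u w ?v"
  proof
    fix x assume "x \<in> ?O"
    then obtain l' where l': "l' \<in> leaves d L" "u l' \<noteq> w l'" "x = ?f l'"
      "fst x div L (d - s) = fst (st \<rho> r i0 s) div L (d - s)"
      by (auto simp: mism_by_index)
    then have "leaf_index L (take ?j l') = leaf_index L ?v"
      using par[OF leaf] par[OF l'(1)] by (simp add: i0_def)
    then have "take ?j l' = ?v"
      using bij_betw_leaf_index[of L ?j] take_leaf(3)[OF leaf j(2)] take_leaf(3)[OF l'(1) j(2)]
      by (auto simp: bij_betw_def inj_on_def)
    then show "x \<in> ?f ` below u w ?v" using l' len by (auto simp: below_def)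
  qed
  then have "card ?O \<le> card (?f ` below u w ?v)"
    by (intro card_mono finite_imageI finite_below)
  also have "\<dots> \<le> (\<Sum>a<L (Suc ?j). load d L \<kappa> u w (?v @ [a]))"
  proof (rule card_below_children[OF _ len j(2)])
    fix a show "card (?f ` below u w (?v @ [a])) \<le> load d L \<kappa> u w (?v @ [a])"
      using card_states_le_load[of "?v @ [a]" "Suc ?j" \<rho> r u w] len j by simp
  qed
  finally have le: "card ?O \<le> (\<Sum>a<L (Suc ?j). load d L \<kappa> u w (?v @ [a]))" .
  have ld: "load d L \<kappa> u w ?v = min (\<kappa> ?j) (\<Sum>a<L (Suc ?j). load d L \<kappa> u w (?v @ [a]))"
    using load.simps[of d L \<kappa> u w ?v] len j(2) by simp
  have acc: "4 * d * load d L \<kappa> u w ?v < \<kappa> ?j" by (rule accessible_load_less[OF l j(2)])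
  \<comment> \<open>As \<open>d \<ge> 1\<close>, the load lies strictly below the cap, so the
    minimum in \<open>load\<close> is attained by the sum over the children.\<close>
  have "1 * load d L \<kappa> u w ?v \<le> 4 * d * load d L \<kappa> u w ?v"
    using d_pos by (intro mult_right_mono) auto
  then have "load d L \<kappa> u w ?v < \<kappa> ?j" using acc by linarith
  then have "load d L \<kappa> u w ?v = (\<Sum>a<L (Suc ?j). load d L \<kappa> u w (?v @ [a]))"
    using ld by (simp add: min_def split: if_splits)
  with le have "card ?O \<le> load d L \<kappa> u w ?v" by simp
  then have "4 * d * card ?O \<le> 4 * d * load d L \<kappa> u w ?v" by (rule mult_left_mono) simp
  then show ?thesis using acc by linarith
qed

text \<open>The word that hashes the state of \<open>i0\<close> at this level is resampled. The
  competing states keep their hash values, so the fresh value must avoid at most as many residues as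
  there are competitors.\<close>

lemma card_coll_le:
  assumes l: "l \<in> target d L \<kappa> R u w" "4 * d \<le> R" and "s < d" "r < nrep" "indep r E"
  shows "real (card {\<rho>\<in>Om. E \<rho> \<and> coll \<rho> r (mism (by_index u) (by_index w)) (leaf_index L l) s})
    \<le> 1 / (4 * real d) * real (card {\<rho>\<in>Om. E \<rho>})"
proof -
  let ?j = "d - s"
  let ?D = "mism (by_index u) (by_index w)"
  define i0 where "i0 = leaf_index L l"
  define X where "X \<rho> = addr r ?j (fst (st \<rho> r i0 s)) (snd (st \<rho> r i0 s))" for \<rho>
  have i0: "i0 < N" using l leaf_index_less by (auto simp: i0_def target_def)
  have D: "i < N" if "i \<in> ?D" for i using that by (simp add: mism_def)
  \<comment> \<open>The position \<open>X \<rho>\<close> lies at depth \<open>d - s\<close>, while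
    the first \<open>s\<close> steps read only deeper words.\<close>
  have st_X: "st (\<rho>(X \<rho> := v)) r i s = st \<rho> r i s" if "i < N" for \<rho> v i
  proof (rule st_upd[OF that])
    fix j' k' b' assume a: "d - s < j'" "j' \<le> d" "k' < N" "b' < N"
    show "X \<rho> \<noteq> addr r j' k' b'"
      unfolding X_def using addr_inj[OF _ _ _ _ a(2-4)] st_less[OF i0, of s \<rho> r] a(1) assms(3)
      by (metis diff_le_self less_imp_le less_irrefl)
  qed (use assms in simp)
  show ?thesis
  proof (rule resample[OF assms(4,5), where X = X and j = "\<lambda>_. ?j"
        and k = "\<lambda>\<rho>. fst (st \<rho> r i0 s)" and b = "\<lambda>\<rho>. snd (st \<rho> r i0 s)"], fold i0_def)
    fix \<rho> assume \<rho>: "\<rho> \<in> Om"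
    show "?j \<le> d \<and> fst (st \<rho> r i0 s) < N \<and> snd (st \<rho> r i0 s) < N \<and>
        X \<rho> = addr r ?j (fst (st \<rho> r i0 s)) (snd (st \<rho> r i0 s))"
      using st_less[OF i0, of s \<rho> r] assms(3) by (simp add: X_def)
    show "X (\<rho>(X \<rho> := v)) = X \<rho>" for v
      using st_X[OF i0, of \<rho> v] by (simp add: X_def)
    let ?V = "{v\<in>{..<2 ^ W}. coll (\<rho>(X \<rho> := v)) r ?D i0 s}"
    let ?k = "\<kappa> (d - Suc s)"
    let ?O = "{x. \<exists>i\<in>?D. x = st \<rho> r i s \<and> fst x div L ?j = fst (st \<rho> r i0 s) div L ?j}"
    let ?h = "\<lambda>x. \<rho> (addr r ?j (fst x) (snd x)) mod ?k"
    have "finite ?O" by (rule finite_subset[of _ "(\<lambda>i. st \<rho> r i s) ` ?D"]) (auto simp: mism_def)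
    \<comment> \<open>A collision forces the fresh value onto the unchanged hash value of another
      state with the same parent.\<close>
    have "v mod ?k \<in> ?h ` ?O" if v: "v \<in> ?V" for v
    proof -
      let ?\<rho> = "\<rho>(X \<rho> := v)"
      obtain i where i: "i \<in> ?D" "st ?\<rho> r i s \<noteq> st ?\<rho> r i0 s"
          "st ?\<rho> r i (Suc s) = st ?\<rho> r i0 (Suc s)"
        using v by (auto simp: coll_def)
      have ne: "st \<rho> r i s \<noteq> st \<rho> r i0 s"
        using i(2) st_X[OF i0, of \<rho> v] st_X[OF D[OF i(1)], of \<rho> v] by metis
      have eq: "hmr.step d L \<kappa> ?\<rho> r ?j (st \<rho> r i s) = hmr.step d L \<kappa> ?\<rho> r ?j (st \<rho> r i0 s)"
        using i(3) st_X[OF i0, of \<rho> v] st_X[OF D[OF i(1)], of \<rho> v] by simp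
      \<comment> \<open>A level with a single child copies the bucket and keeps the rank, so
        distinct states cannot merge there.\<close>
      have L1: "L ?j \<noteq> 1"
      proof
        assume "L ?j = 1"
        then have "st \<rho> r i s = st \<rho> r i0 s" using eq by (simp add: step_def prod_eq_iff)
        then show False using ne by simp
      qed
      \<comment> \<open>A different state has a different address, hence its hash value is not
        affected by the update at \<open>X \<rho>\<close>.\<close>
      have "addr r ?j (fst (st \<rho> r i s)) (snd (st \<rho> r i s)) \<noteq> X \<rho>"
      proof
        assume "addr r ?j (fst (st \<rho> r i s)) (snd (st \<rho> r i s)) = X \<rho>"
        from addr_inj[OF this[unfolded X_def]]
        show False
          using st_less[OF i0, of s \<rho> r] st_less[OF D[OF i(1)], of s \<rho> r] assms(3) ne
          by (auto simp: prod_eq_iff)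
      qed
      then have "?h (st \<rho> r i s) = v mod ?k" "fst (st \<rho> r i s) div L ?j = fst (st \<rho> r i0 s) div L ?j"
        using eq L1 by (auto simp: step_def X_def)
      then show ?thesis using i(1) by (intro image_eqI[of _ _ "st \<rho> r i s"]) auto
    qed
    then have "?V \<subseteq> {v\<in>{..<2 ^ W}. v mod ?k \<in> ?h ` ?O}" by blast
    then have "card ?V \<le> card {v\<in>{..<2 ^ W}. v mod ?k \<in> ?h ` ?O}" by (intro card_mono) auto
    also have "\<dots> \<le> card (?h ` ?O) * (2 ^ W div ?k)"
      using \<open>finite ?O\<close> by (intro card_mod_in_le kap_dvd_word kap_pos) auto
    also have "\<dots> \<le> card ?O * (2 ^ W div ?k)"
      using \<open>finite ?O\<close> by (intro mult_right_mono card_image_le) auto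
    finally have "4 * d * card ?V \<le> 4 * d * (card ?O * (2 ^ W div ?k))" by simp
    also have "\<dots> \<le> ?k * (2 ^ W div ?k)"
      using card_sibling_states[OF l assms(3), of \<rho> r, folded i0_def]
      by (simp add: mult.assoc[symmetric])
    also have "\<dots> \<le> 2 ^ W" by simp
    finally have "real (4 * d * card ?V) \<le> real (2 ^ W)" by (rule of_nat_mono)
    then show "real (card ?V) \<le> 1 / (4 * real d) * 2 ^ W"
      using d_pos by (simp add: field_simps)
  qed
qed

lemma card_not_isolates_le:
  assumes l: "l \<in> target d L \<kappa> R u w" "4 * d \<le> R" and "r < nrep" "indep r E"
  shows "real (card {\<rho>\<in>Om. E \<rho> \<and> \<not> isolates \<rho> (mism (by_index u) (by_index w)) (leaf_index L l) r})
    \<le> 1 / 4 * real (card {\<rho>\<in>Om. E \<rho>})"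
proof -
  let ?D = "mism (by_index u) (by_index w)" and ?i = "leaf_index L l"
  let ?C = "\<lambda>s. {\<rho>\<in>Om. E \<rho> \<and> coll \<rho> r ?D ?i s}"
  have i: "?i < N" using l leaf_index_less by (auto simp: target_def)
  have D: "?D \<subseteq> {..<N}" by (auto simp: mism_def)
  have "{\<rho>\<in>Om. E \<rho> \<and> \<not> isolates \<rho> ?D ?i r} \<subseteq> (\<Union>s<d. ?C s)"
    using isolates_if_no_coll[OF _ D i] by blast
  then have "card {\<rho>\<in>Om. E \<rho> \<and> \<not> isolates \<rho> ?D ?i r} \<le> card (\<Union>s<d. ?C s)"
    using finite_Om by (intro card_mono) auto
  also have "\<dots> \<le> (\<Sum>s<d. card (?C s))" by (rule card_UN_le) simp
  finally have "card {\<rho>\<in>Om. E \<rho> \<and> \<not> isolates \<rho> ?D ?i r} \<le> (\<Sum>s<d. card (?C s))" .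
  from of_nat_mono[OF this, where 'a = real]
  have "real (card {\<rho>\<in>Om. E \<rho> \<and> \<not> isolates \<rho> ?D ?i r}) \<le> (\<Sum>s<d. real (card (?C s)))"
    by (simp only: of_nat_sum)
  also have "\<dots> \<le> (\<Sum>s<d. 1 / (4 * real d) * real (card {\<rho>\<in>Om. E \<rho>}))"
    by (intro sum_mono card_coll_le[OF l]) (use assms in auto)
  also have "\<dots> = 1 / 4 * real (card {\<rho>\<in>Om. E \<rho>})" using d_pos by simp
  finally show ?thesis .
qed

section \<open>Cells and their decoding\<close>

text \<open>The range \<open>64 * N\<close> bounds a false match in one bucket by
  \<open>1 / (64 * N)\<close>, so that all \<open>\<kappa> 0 \<le> N\<close> buckets of a repetition
  together err with probability at most 1/64.\<close>

definition fp :: "(nat \<Rightarrow> nat) \<Rightarrow> nat \<Rightarrow> nat \<Rightarrow> nat" where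
  "fp \<rho> r x = \<rho> (addr r 0 x 0) mod (64 * N)"

text \<open>
  If \<open>i\<close> is the only mismatch of a cell, the quotient of the differences of the sums for \<open>f = 1\<close> and
  \<open>f = 0\<close> is \<open>i * 2p + (u\<^sub>i + w\<^sub>i)\<close>, so one division yields \<open>i\<close> and \<open>u\<^sub>i + w\<^sub>i\<close>.  All sums are taken over
  the integers: they are below \<open>p ^ 3\<close>.
\<close>

definition wt :: "(nat \<Rightarrow> nat) \<Rightarrow> nat \<Rightarrow> nat \<Rightarrow> nat \<Rightarrow> nat \<Rightarrow> nat" where
  "wt \<rho> f r x v = (if f = 0 then v else if f = 1 then (x * (2 * p) + v) * v else fp \<rho> r x * v)"

text \<open>Cells are numbered \<open>3 * (r * \<kappa> 0 + b) + f\<close>: sum \<open>f\<close> of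
  bucket \<open>b\<close> in repetition \<open>r\<close>.\<close>

definition contrib :: "(nat \<Rightarrow> nat) \<Rightarrow> nat \<Rightarrow> nat \<Rightarrow> nat \<Rightarrow> nat" where
  "contrib \<rho> c x v = (let y = c div 3; r = y div \<kappa> 0 in
     if bucket \<rho> r x = y mod \<kappa> 0 then wt \<rho> (c mod 3) r x v else 0)"

definition cell :: "(nat \<Rightarrow> nat) \<Rightarrow> (nat \<Rightarrow> nat) \<Rightarrow> nat \<Rightarrow> nat" where
  "cell \<rho> U c = (\<Sum>x<N. contrib \<rho> c x (U x))"

text \<open>As subtraction is truncated, \<open>(x - y) + (y - x)\<close> is the distance of \<open>x\<close> and \<open>y\<close>.\<close>

definition guess :: "nat \<Rightarrow> nat \<Rightarrow> nat \<Rightarrow> nat \<Rightarrow> nat \<times> nat \<times> nat" where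
  "guess a1 a2 b1 b2 =
     (let c = ((b1 - b2) + (b2 - b1)) div ((a1 - a2) + (a2 - a1)); s = c mod (2 * p) in
      (c div (2 * p) mod N, ((s + a1) - a2) div 2 mod p, ((s + a2) - a1) div 2 mod p))"

text \<open>The check says that the fingerprint difference of the two cells is the coefficient of
  \<open>x\<close> times \<open>a - b\<close>; the terms are rearranged so that no truncated
  subtraction occurs.\<close>

definition cand :: "(nat \<Rightarrow> nat) \<Rightarrow> (nat \<Rightarrow> nat) \<Rightarrow> (nat \<Rightarrow> nat) \<Rightarrow> nat \<Rightarrow> (nat \<times> nat \<times> nat) option" where
  "cand \<rho> S Z y =
     (case guess (S (3 * y)) (Z (3 * y)) (S (3 * y + 1)) (Z (3 * y + 1)) of (x, a, b) \<Rightarrow>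
        if S (3 * y) \<noteq> Z (3 * y) \<and>
           S (3 * y + 2) + fp \<rho> (y div \<kappa> 0) x * b = Z (3 * y + 2) + fp \<rho> (y div \<kappa> 0) x * a
        then Some (x, a, b) else None)"

definition triples :: "(nat \<Rightarrow> nat) \<Rightarrow> (nat \<Rightarrow> nat) \<Rightarrow> (nat \<times> nat \<times> nat) set" where
  "triples U V = (\<lambda>i. (i, U i, V i)) ` mism U V"

definition bmism :: "(nat \<Rightarrow> nat) \<Rightarrow> nat \<Rightarrow> nat \<Rightarrow> (nat \<Rightarrow> nat) \<Rightarrow> (nat \<Rightarrow> nat) \<Rightarrow> nat set" where
  "bmism \<rho> r b U V = {i \<in> mism U V. bucket \<rho> r i = b}"

lemma kap0_pos: "0 < \<kappa> 0" using kap_pos by simp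

lemma div_mod_3: "f < 3 \<Longrightarrow> (3 * y + f) div 3 = y \<and> (3 * y + f) mod 3 = (f::nat)"
  by auto

text \<open>By linearity, positions where the sequences agree cancel, and only the mismatches of the
  bucket survive.\<close>

lemma int_cell_diff:
  fixes r b f :: nat
  assumes "b < \<kappa> 0" "f < 3"
  defines "c \<equiv> 3 * (r * \<kappa> 0 + b) + f"
  shows "int (cell \<rho> U c) - int (cell \<rho> V c)
    = (\<Sum>i\<in>bmism \<rho> r b U V. int (wt \<rho> f r i (U i)) - int (wt \<rho> f r i (V i)))"
proof -
  have c: "c div 3 = r * \<kappa> 0 + b" "c mod 3 = f"
    unfolding c_def using div_mod_3[OF assms(2)] by blast+
  have y: "(r * \<kappa> 0 + b) div \<kappa> 0 = r" "(r * \<kappa> 0 + b) mod \<kappa> 0 = b" using assms(1) by auto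
  have con: "contrib \<rho> c x v = (if bucket \<rho> r x = b then wt \<rho> f r x v else 0)" for x v
    unfolding contrib_def c y Let_def by simp
  have "int (cell \<rho> U c) - int (cell \<rho> V c)
    = (\<Sum>x<N. int (contrib \<rho> c x (U x)) - int (contrib \<rho> c x (V x)))"
    by (simp add: cell_def sum_subtractf)
  also have "\<dots> = (\<Sum>i\<in>bmism \<rho> r b U V. int (wt \<rho> f r i (U i)) - int (wt \<rho> f r i (V i)))"
    by (rule sum.mono_neutral_cong_right) (auto simp: bmism_def mism_def con)
  finally show ?thesis .
qed

lemma nat_dist: "(a - b) + (b - a) = nat \<bar>int a - int b\<bar>"
  by auto

lemma cand_None_if_empty:
  assumes "b < \<kappa> 0" "bmism \<rho> r b U V = {}"
  shows "cand \<rho> (cell \<rho> U) (cell \<rho> V) (r * \<kappa> 0 + b) = None"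
proof -
  have "cell \<rho> U (3 * (r * \<kappa> 0 + b)) = cell \<rho> V (3 * (r * \<kappa> 0 + b))"
    using int_cell_diff[OF assms(1), of 0 \<rho> U r V] assms(2) by simp
  then show ?thesis by (simp add: cand_def split: prod.split)
qed

text \<open>With a single mismatch the second difference is an exact multiple of the first, and the
  quotient carries the rank and the sum of the two symbols.\<close>

lemma cand_if_single:
  assumes b: "b < \<kappa> 0" and D: "bmism \<rho> r b U V = {i}"
    and UV: "U i < p" "V i < p"
  shows "cand \<rho> (cell \<rho> U) (cell \<rho> V) (r * \<kappa> 0 + b) = Some (i, U i, V i)"
proof -
  let ?y = "r * \<kappa> 0 + b"
  let ?S = "cell \<rho> U" and ?Z = "cell \<rho> V"
  have i: "i < N" "U i \<noteq> V i" using D by (auto simp: bmism_def mism_def)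
  have d0: "int (?S (3 * ?y)) - int (?Z (3 * ?y)) = int (U i) - int (V i)"
    using int_cell_diff[OF b, of 0 \<rho> U r V] D by (simp add: wt_def)
  have d1: "int (?S (3 * ?y + 1)) - int (?Z (3 * ?y + 1))
      = (int (U i) - int (V i)) * int (i * (2 * p) + (U i + V i))"
    using int_cell_diff[OF b, of 1 \<rho> U r V] D by (simp add: wt_def algebra_simps)
  have d2: "int (?S (3 * ?y + 2)) - int (?Z (3 * ?y + 2)) = int (fp \<rho> r i) * (int (U i) - int (V i))"
    using int_cell_diff[OF b, of 2 \<rho> U r V] D by (simp add: wt_def algebra_simps)
  let ?e = "nat \<bar>int (U i) - int (V i)\<bar>" and ?c = "i * (2 * p) + (U i + V i)"
  have e: "?e > 0" using i by simp
  have g: "guess (?S (3 * ?y)) (?Z (3 * ?y)) (?S (3 * ?y + 1)) (?Z (3 * ?y + 1)) = (i, U i, V i)"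
  proof -
    have 0: "(?S (3 * ?y) - ?Z (3 * ?y)) + (?Z (3 * ?y) - ?S (3 * ?y)) = ?e"
      using d0 by linarith
    have 1: "(?S (3 * ?y + 1) - ?Z (3 * ?y + 1)) + (?Z (3 * ?y + 1) - ?S (3 * ?y + 1)) = ?e * ?c"
      unfolding nat_dist d1 by (simp only: abs_mult nat_mult_distrib abs_ge_zero abs_of_nat nat_int)
    have 2: "?e * ?c div ?e = ?c" using e by simp
    \<comment> \<open>Both symbols are below \<open>p\<close>, so their sum is a digit in base
      \<open>2 * p\<close>.\<close>
    have 3: "?c div (2 * p) = i" "?c mod (2 * p) = U i + V i" using UV by auto
    \<comment> \<open>Adding the signed difference of the symbols to their sum gives twice
      \<open>U i\<close>; subtracting it gives twice \<open>V i\<close>.\<close>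
    have 4: "(U i + V i + ?S (3 * ?y)) - ?Z (3 * ?y) = 2 * U i" using d0 by linarith
    have 5: "(U i + V i + ?Z (3 * ?y)) - ?S (3 * ?y) = 2 * V i" using d0 by linarith
    show ?thesis
      unfolding guess_def Let_def 0 1 2 3 4 5 using i UV by simp
  qed
  have ne: "?S (3 * ?y) \<noteq> ?Z (3 * ?y)" using d0 i by auto
  have "int (?S (3 * ?y + 2) + fp \<rho> r i * V i) = int (?Z (3 * ?y + 2) + fp \<rho> r i * U i)"
    using d2 by (simp add: algebra_simps)
  then have chk: "?S (3 * ?y + 2) + fp \<rho> r i * V i = ?Z (3 * ?y + 2) + fp \<rho> r i * U i"
    by (simp only: of_nat_eq_iff)
  have y: "?y div \<kappa> 0 = r" using b by simp
  show ?thesis unfolding cand_def g y using ne chk by simp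
qed

text \<open>The remainders in \<open>guess\<close> enforce this for arbitrary cells: even a
  meaningless guess names a leaf whose coefficient \<open>fp\<close> can be looked up.\<close>

lemma guess_less:
  assumes "guess a1 a2 b1 b2 = (x, a, b)"
  shows "x < N"
proof -
  have "x = fst (guess a1 a2 b1 b2)" using assms by simp
  also have "\<dots> < N" unfolding guess_def Let_def fst_conv using N_pos by (rule mod_less_divisor)
  finally show ?thesis .
qed

section \<open>False triples decoded from a bucket\<close>

definition fake :: "(nat \<Rightarrow> nat) \<Rightarrow> nat \<Rightarrow> (nat \<Rightarrow> nat) \<Rightarrow> (nat \<Rightarrow> nat) \<Rightarrow> nat \<Rightarrow> bool" where
  "fake \<rho> b U V r \<longleftrightarrow>
     (\<exists>k. cand \<rho> (cell \<rho> U) (cell \<rho> V) (r * \<kappa> 0 + b) = Some k \<and> k \<notin> triples U V)"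

text \<open>Separates the guess from the check: it uses the first two sums only and is thus
  determined before the fingerprint words are looked at.\<close>

definition guess_at :: "(nat \<Rightarrow> nat) \<Rightarrow> nat \<Rightarrow> nat \<Rightarrow> (nat \<Rightarrow> nat) \<Rightarrow> (nat \<Rightarrow> nat) \<Rightarrow> nat \<times> nat \<times> nat" where
  "guess_at \<rho> r b U V =
     (let c = 3 * (r * \<kappa> 0 + b) in
      guess (cell \<rho> U c) (cell \<rho> V c) (cell \<rho> U (c + 1)) (cell \<rho> V (c + 1)))"

text \<open>Fingerprint coefficients matter only for the third sum, whence the guard
  \<open>f = 2\<close>.\<close>

lemma cell_cong:
  assumes "\<And>i. i < N \<Longrightarrow> bucket \<rho>' r i = bucket \<rho> r i"
    and "f = 2 \<Longrightarrow> (\<And>i. i < N \<Longrightarrow> fp \<rho>' r i = fp \<rho> r i)" and "b < \<kappa> 0" "f < 3"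
  shows "cell \<rho>' U (3 * (r * \<kappa> 0 + b) + f) = cell \<rho> U (3 * (r * \<kappa> 0 + b) + f)"
proof -
  let ?c = "3 * (r * \<kappa> 0 + b) + f"
  have c: "?c div 3 = r * \<kappa> 0 + b" "?c mod 3 = f"
    using div_mod_3[OF assms(4)] by blast+
  have y: "(r * \<kappa> 0 + b) div \<kappa> 0 = r" "(r * \<kappa> 0 + b) mod \<kappa> 0 = b" using assms(3) by auto
  show ?thesis
    unfolding cell_def contrib_def c y Let_def
    by (intro sum.cong refl if_cong) (use assms in \<open>auto simp: wt_def\<close>)
qed

lemma fake_cong:
  assumes "\<And>i. i < N \<Longrightarrow> bucket \<rho>' r i = bucket \<rho> r i"
    and "\<And>i. i < N \<Longrightarrow> fp \<rho>' r i = fp \<rho> r i" and b: "b < \<kappa> 0"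
  shows "fake \<rho>' b U V r = fake \<rho> b U V r"
proof -
  let ?y = "r * \<kappa> 0 + b"
  have c: "cell \<rho>' U (3 * ?y + f) = cell \<rho> U (3 * ?y + f)" if "f < 3" for f U
    using that b by (intro cell_cong assms) auto
  have y: "?y div \<kappa> 0 = r" using b by simp
  have "cand \<rho>' (cell \<rho>' U) (cell \<rho>' V) ?y = cand \<rho> (cell \<rho> U) (cell \<rho> V) ?y"
    unfolding cand_def y using c[of 0] c[of 1] c[of 2] assms(2) guess_less
    by (auto split: prod.split)
  then show ?thesis by (simp add: fake_def)
qed

text \<open>If every mismatch of the bucket were the guessed leaf, the bucket would be empty and
  yield no candidate, or hold one mismatch and decode correctly. The other leaf found here has a
  coefficient that does not occur on the guessed side of the check.\<close>

lemma fake_imp_other: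
  assumes b: "b < \<kappa> 0" and UV: "\<And>i. i < N \<Longrightarrow> U i < p \<and> V i < p" and "fake \<rho> b U V r"
  shows "\<exists>i\<in>bmism \<rho> r b U V. i \<noteq> fst (guess_at \<rho> r b U V)"
proof (rule ccontr)
  assume "\<not> ?thesis"
  then have sub: "bmism \<rho> r b U V \<subseteq> {fst (guess_at \<rho> r b U V)}" by blast
  show False
  proof (cases "bmism \<rho> r b U V = {}")
    case True
    then show False using cand_None_if_empty[OF b True] assms(3) by (simp add: fake_def)
  next
    case False
    then obtain i where i: "bmism \<rho> r b U V = {i}" using sub by blast
    then have "i \<in> mism U V" by (auto simp: bmism_def)
    then have "cand \<rho> (cell \<rho> U) (cell \<rho> V) (r * \<kappa> 0 + b) = Some (i, U i, V i)" "(i, U i, V i) \<in> triples U V"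
      using UV[of i] by (auto intro!: cand_if_single[OF b i] simp: mism_def triples_def)
    then show False using assms(3) by (simp add: fake_def)
  qed
qed

lemma fake_check:
  assumes b: "b < \<kappa> 0" and "fake \<rho> b U V r" and g: "guess_at \<rho> r b U V = (x, A, B)"
  shows "(\<Sum>i\<in>bmism \<rho> r b U V. int (fp \<rho> r i) * (int (U i) - int (V i)))
    = int (fp \<rho> r x) * (int A - int B)"
proof -
  let ?y = "r * \<kappa> 0 + b"
  have y: "?y div \<kappa> 0 = r" using b by simp
  have "cell \<rho> U (3 * ?y + 2) + fp \<rho> r x * B = cell \<rho> V (3 * ?y + 2) + fp \<rho> r x * A"
    using assms(2) g by (auto simp: fake_def cand_def guess_at_def Let_def y split: if_splits)
  then have "int (cell \<rho> U (3 * ?y + 2) + fp \<rho> r x * B) = int (cell \<rho> V (3 * ?y + 2) + fp \<rho> r x * A)"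
    by (simp only:)
  then have "int (cell \<rho> U (3 * ?y + 2)) - int (cell \<rho> V (3 * ?y + 2)) = int (fp \<rho> r x) * (int A - int B)"
    by (simp add: algebra_simps)
  then show ?thesis
    using int_cell_diff[OF b, of 2 \<rho> U r V] by (simp add: wt_def algebra_simps)
qed

lemma dvd_word_64N: "64 * N dvd 2 ^ W"
proof -
  have "64 * N \<le> Q * Q" using p_ge_256 N_le_p by (intro mult_mono) auto
  also have "\<dots> = Q ^ 2" by (simp add: power2_eq_square)
  also have "\<dots> \<le> Q ^ 8" using p_ge_256 by (intro power_increasing) auto
  finally have "2 ^ (6 + clog N) \<le> Q ^ 8" using N_pow by (simp add: power_add)
  then have "2 ^ (6 + clog N) dvd (2::nat) ^ W" by (rule pow2_dvd_word)
  then show ?thesis using N_pow by (simp add: power_add)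
qed

lemma card_le_1_lin:
  fixes e c :: int
  assumes "e \<noteq> 0"
  shows "finite {w. int w * e = c} \<and> card {w. int w * e = c} \<le> 1"
proof -
  have "{w. int w * e = c} \<subseteq> {nat (c div e)}" using assms by auto
  then show ?thesis using card_mono[of "{nat (c div e)}" "{w. int w * e = c}"]
    by (auto intro: finite_subset)
qed

text \<open>Passing the check is a linear equation over the integers in the coefficient of a
  mismatch different from the guessed leaf. Its factor is the nonzero symbol difference, so at most
  one of \<open>64 * N\<close> coefficient values solves it.\<close>

lemma card_fake_le:
  assumes b: "b < \<kappa> 0" and UV: "\<And>i. i < N \<Longrightarrow> U i < p \<and> V i < p" and r: "r < nrep" "indep r E"
  shows "real (card {\<rho>\<in>Om. E \<rho> \<and> fake \<rho> b U V r})
    \<le> 1 / (64 * real N) * real (card {\<rho>\<in>Om. E \<rho>})"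
proof -
  define P where "P \<rho> i \<longleftrightarrow> i \<in> bmism \<rho> r b U V \<and> i \<noteq> fst (guess_at \<rho> r b U V)" for \<rho> i
  \<comment> \<open>The default 0 is a valid leaf rank, so \<open>X \<rho>\<close> is a legal
    address even when no other mismatch exists.\<close>
  define oth where "oth \<rho> = (if \<exists>i. P \<rho> i then SOME i. P \<rho> i else 0)" for \<rho>
  define X where "X \<rho> = addr r 0 (oth \<rho>) 0" for \<rho>
  have oth_P: "P \<rho> (oth \<rho>)" if "\<exists>i. P \<rho> i" for \<rho>
    using someI_ex[OF that] that by (simp add: oth_def)
  have oth: "oth \<rho> < N" for \<rho>
  proof (cases "\<exists>i. P \<rho> i")
    case True
    from oth_P[OF True] show ?thesis by (auto simp: P_def bmism_def mism_def)
  qed (use N_pos in \<open>simp add: oth_def\<close>)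
  have bucket_X: "bucket (\<rho>(X \<rho> := v)) r i = bucket \<rho> r i" if "i < N" for \<rho> v i
    unfolding X_def using oth N_pos that by (intro bucket_upd_other) auto
  have guess_X: "guess_at (\<rho>(X \<rho> := v)) r b U V = guess_at \<rho> r b U V" for \<rho> v
    using cell_cong[OF bucket_X, where f = 0 and b = b] cell_cong[OF bucket_X, where f = 1 and b = b] b
    by (simp add: guess_at_def Let_def del: fun_upd_apply)
  have bmism_X: "bmism (\<rho>(X \<rho> := v)) r b U V = bmism \<rho> r b U V" for \<rho> v
    using bucket_X by (auto simp: bmism_def mism_def simp del: fun_upd_apply)
  \<comment> \<open>Buckets and guess ignore fingerprint words, so the selected leaf, and with it
    the resampled position, survives the update.\<close>
  have P_X: "P (\<rho>(X \<rho> := v)) = P \<rho>" for \<rho> v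
    unfolding P_def guess_X bmism_X ..
  show ?thesis
  proof (rule resample[OF r, where X = X and j = "\<lambda>_. 0" and k = oth and b = "\<lambda>_. 0"])
    fix \<rho> assume \<rho>: "\<rho> \<in> Om"
    show "0 \<le> d \<and> oth \<rho> < N \<and> 0 < N \<and> X \<rho> = addr r 0 (oth \<rho>) 0"
      using oth N_pos by (simp add: X_def)
    show "X (\<rho>(X \<rho> := v)) = X \<rho>" for v
    proof -
      have "oth (\<rho>(X \<rho> := v)) = oth \<rho>" unfolding oth_def P_X ..
      then show ?thesis by (simp add: X_def)
    qed
    let ?F = "{v\<in>{..<2 ^ W}. fake (\<rho>(X \<rho> := v)) b U V r}"
    show "real (card ?F) \<le> 1 / (64 * real N) * 2 ^ W"
    proof (cases "\<exists>i. P \<rho> i")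
      case False
      have "\<not> fake (\<rho>(X \<rho> := v)) b U V r" for v
        using fake_imp_other[where U = U and V = V and \<rho> = "\<rho>(X \<rho> := v)" and r = r, OF b UV] False
        unfolding bmism_X guess_X P_def by blast
      then have "?F = {}" by blast
      then show ?thesis by (simp only: card.empty) simp
    next
      case True
      let ?i = "oth \<rho>"
      obtain x A B where g: "guess_at \<rho> r b U V = (x, A, B)" by (cases "guess_at \<rho> r b U V")
      have i: "?i \<in> bmism \<rho> r b U V" "?i \<noteq> x" using oth_P[OF True] g by (auto simp: P_def)
      have x: "x < N" using g guess_less unfolding guess_at_def Let_def by blast
      define e where "e = int (U ?i) - int (V ?i)"
      \<comment> \<open>Everything in the check equation that does not involve the resampled
        coefficient.\<close>
      define c where "c = int (fp \<rho> r x) * (int A - int B)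
        - (\<Sum>i\<in>bmism \<rho> r b U V - {?i}. int (fp \<rho> r i) * (int (U i) - int (V i)))"
      have e: "e \<noteq> 0" using i(1) by (auto simp: e_def bmism_def mism_def)
      have fp_X: "fp (\<rho>(X \<rho> := v)) r i = fp \<rho> r i" if "i \<noteq> ?i" "i < N" for i v
      proof -
        have "addr r 0 i 0 \<noteq> X \<rho>"
          using addr_inj[of r 0 i 0 r 0 ?i 0] that oth N_pos unfolding X_def by blast
        then show ?thesis by (simp add: fp_def)
      qed
      have fin: "finite (bmism \<rho> r b U V)"
        by (rule finite_subset[of _ "{..<N}"]) (auto simp: bmism_def mism_def)
      have "v mod (64 * N) \<in> {w. int w * e = c}" if "v \<in> ?F" for v
      proof -
        let ?\<rho> = "\<rho>(X \<rho> := v)"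
        have "(\<Sum>i\<in>bmism \<rho> r b U V. int (fp ?\<rho> r i) * (int (U i) - int (V i)))
            = int (fp ?\<rho> r x) * (int A - int B)"
          using fake_check[OF b, of ?\<rho> U V r x A B] that unfolding guess_X bmism_X g by blast
        also have "fp ?\<rho> r x = fp \<rho> r x" using fp_X[OF _ x] i(2) by blast
        also have "(\<Sum>i\<in>bmism \<rho> r b U V. int (fp ?\<rho> r i) * (int (U i) - int (V i)))
          = int (fp ?\<rho> r ?i) * e
            + (\<Sum>i\<in>bmism \<rho> r b U V - {?i}. int (fp ?\<rho> r i) * (int (U i) - int (V i)))"
          unfolding e_def by (rule sum.remove[OF fin i(1)])
        also have "(\<Sum>i\<in>bmism \<rho> r b U V - {?i}. int (fp ?\<rho> r i) * (int (U i) - int (V i)))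
          = (\<Sum>i\<in>bmism \<rho> r b U V - {?i}. int (fp \<rho> r i) * (int (U i) - int (V i)))"
          by (intro sum.cong refl) (use fp_X in \<open>auto simp: bmism_def mism_def simp del: fun_upd_apply\<close>)
        finally have "int (fp ?\<rho> r ?i) * e = c" by (simp add: c_def del: fun_upd_apply)
        moreover have "fp ?\<rho> r ?i = v mod (64 * N)" by (simp add: fp_def X_def)
        ultimately show ?thesis by (simp del: fun_upd_apply)
      qed
      then have "?F \<subseteq> {v\<in>{..<2 ^ W}. v mod (64 * N) \<in> {w. int w * e = c}}" by blast
      then have "card ?F \<le> card {v\<in>{..<2 ^ W}. v mod (64 * N) \<in> {w. int w * e = c}}"
        by (intro card_mono) auto
      also have "\<dots> \<le> card {w. int w * e = c} * (2 ^ W div (64 * N))"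
        using card_le_1_lin[OF e] N_pos by (intro card_mod_in_le dvd_word_64N) auto
      also have "\<dots> \<le> 1 * (2 ^ W div (64 * N))"
        using card_le_1_lin[OF e, of c] by (intro mult_right_mono) auto
      finally have "64 * N * card ?F \<le> 64 * N * (2 ^ W div (64 * N))" by simp
      also have "\<dots> \<le> 2 ^ W" by simp
      finally have "real (64 * N * card ?F) \<le> real (2 ^ W)" by (rule of_nat_mono)
      then show ?thesis using N_pos by (simp add: field_simps del: fun_upd_apply)
    qed
  qed
qed

section \<open>Whole repetitions and tail bounds over them\<close>

definition fake_rep :: "(nat \<Rightarrow> nat) \<Rightarrow> (nat \<Rightarrow> nat) \<Rightarrow> (nat \<Rightarrow> nat) \<Rightarrow> nat \<Rightarrow> bool" where
  "fake_rep \<rho> U V r \<longleftrightarrow> (\<exists>b<\<kappa> 0. fake \<rho> b U V r)"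

lemma card_fake_rep_le:
  assumes UV: "\<And>i. i < N \<Longrightarrow> U i < p \<and> V i < p" and r: "r < nrep" "indep r E"
  shows "real (card {\<rho>\<in>Om. E \<rho> \<and> fake_rep \<rho> U V r}) \<le> 1 / 64 * real (card {\<rho>\<in>Om. E \<rho>})"
proof -
  let ?F = "\<lambda>b. {\<rho>\<in>Om. E \<rho> \<and> fake \<rho> b U V r}" and ?E = "real (card {\<rho>\<in>Om. E \<rho>})"
  have "{\<rho>\<in>Om. E \<rho> \<and> fake_rep \<rho> U V r} = (\<Union>b<\<kappa> 0. ?F b)"
    by (auto simp: fake_rep_def)
  then have "card {\<rho>\<in>Om. E \<rho> \<and> fake_rep \<rho> U V r} \<le> (\<Sum>b<\<kappa> 0. card (?F b))"
    using card_UN_le[of "{..<\<kappa> 0}" ?F] by simp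
  from of_nat_mono[OF this, where 'a = real]
  have "real (card {\<rho>\<in>Om. E \<rho> \<and> fake_rep \<rho> U V r}) \<le> (\<Sum>b<\<kappa> 0. real (card (?F b)))"
    by (simp only: of_nat_sum)
  also have "\<dots> \<le> (\<Sum>b<\<kappa> 0. 1 / (64 * real N) * ?E)"
    by (intro sum_mono card_fake_le[OF _ UV r]) auto
  also have "\<dots> = real (\<kappa> 0) * (1 / (64 * real N) * ?E)" by simp
  also have "\<dots> \<le> real N * (1 / (64 * real N) * ?E)"
    using kap0_le by (intro mult_right_mono) auto
  also have "\<dots> = 1 / 64 * ?E" using N_pos by simp
  finally show ?thesis .
qed

text \<open>An event about repetition \<open>r'\<close> that is a function of its buckets and
  coefficients reads only block \<open>r'\<close>, and \<open>addr\<close> keeps the blocks of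
  different repetitions disjoint.\<close>

lemma indep_other_rep:
  assumes "\<And>\<rho> \<rho>' r'. r' \<noteq> r \<Longrightarrow> (\<And>i. i < N \<Longrightarrow> bucket \<rho>' r' i = bucket \<rho> r' i) \<Longrightarrow>
      (\<And>i. i < N \<Longrightarrow> fp \<rho>' r' i = fp \<rho> r' i) \<Longrightarrow> B \<rho>' r' = B \<rho> r'"
    and "r \<notin> S"
  shows "indep r (\<lambda>\<rho>. \<forall>r'\<in>S. B \<rho> r')"
  unfolding indep_def
proof (intro ballI allI impI)
  fix \<rho> :: "nat \<Rightarrow> nat" and j k b v :: nat
  assume a: "j \<le> d" "k < N" "b < N"
  let ?\<rho> = "\<rho>(addr r j k b := v)"
  have "B ?\<rho> r' = B \<rho> r'" if "r' \<in> S" for r'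
  proof (rule assms(1))
    show ne: "r' \<noteq> r" using that assms(2) by blast
    show "bucket ?\<rho> r' i = bucket \<rho> r' i" if "i < N" for i
      using a ne that by (intro bucket_upd_other) auto
    show "fp ?\<rho> r' i = fp \<rho> r' i" if "i < N" for i
      using addr_inj[of r j k b r' 0 i 0] a ne that N_pos by (auto simp: fp_def)
  qed
  then show "(\<forall>r'\<in>S. B ?\<rho> r') = (\<forall>r'\<in>S. B \<rho> r')" by blast
qed

text \<open>The factor 4 in \<open>nrep\<close> balances both kinds of error: 16/64 and 16/4^3 are
  both 1/4.\<close>

lemma pow_thr: "(2::real) ^ nrep * (1 / 64) ^ thr = (1 / 4) ^ thr"
  "(2::real) ^ nrep * (1 / 4) ^ (3 * thr) = (1 / 4) ^ thr"
proof -
  have "(2::real) ^ nrep * (1 / 64) ^ thr = (2 ^ 4) ^ thr * (1 / 64) ^ thr"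
    by (simp only: nrep_def power_mult)
  also have "\<dots> = (2 ^ 4 * (1 / 64)) ^ thr" by (simp only: power_mult_distrib)
  finally show "(2::real) ^ nrep * (1 / 64) ^ thr = (1 / 4) ^ thr" by simp
  have "(2::real) ^ nrep * (1 / 4) ^ (3 * thr) = (2 ^ 4) ^ thr * ((1 / 4) ^ 3) ^ thr"
    by (simp only: nrep_def power_mult)
  also have "\<dots> = (2 ^ 4 * (1 / 4) ^ 3) ^ thr" by (simp only: power_mult_distrib)
  also have "(2::real) ^ 4 * (1 / 4) ^ 3 = 1 / 4" by (simp add: power3_eq_cube)
  finally show "(2::real) ^ nrep * (1 / 4) ^ (3 * thr) = (1 / 4) ^ thr" .
qed

lemma card_many_fake_le:
  assumes UV: "\<And>i. i < N \<Longrightarrow> U i < p \<and> V i < p"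
  shows "real (card {\<rho>\<in>Om. thr \<le> card {r. r < nrep \<and> fake_rep \<rho> U V r}})
    \<le> (1 / 4) ^ thr * real (card Om)"
proof -
  have "real (card {\<rho>\<in>Om. thr \<le> card {r. r < nrep \<and> fake_rep \<rho> U V r}})
      \<le> 2 ^ nrep * (1 / 64) ^ thr * real (card Om)"
  proof (rule card_many_bad_le[where indep = indep and Bad = "\<lambda>r \<rho>. fake_rep \<rho> U V r"])
    show "indep r (\<lambda>\<rho>. \<forall>r'\<in>S'. fake_rep \<rho> U V r')" if "r \<notin> S'" for r S'
    proof (rule indep_other_rep[where B = "\<lambda>\<rho> r. fake_rep \<rho> U V r", OF _ that])
      fix \<rho> \<rho>' r'
      assume "\<And>i. i < N \<Longrightarrow> bucket \<rho>' r' i = bucket \<rho> r' i"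
        "\<And>i. i < N \<Longrightarrow> fp \<rho>' r' i = fp \<rho> r' i"
      then have "fake \<rho>' b U V r' = fake \<rho> b U V r'" if "b < \<kappa> 0" for b
        using that by (rule fake_cong)
      then show "fake_rep \<rho>' U V r' = fake_rep \<rho> U V r'"
        by (auto simp: fake_rep_def)
    qed
    show "real (card {\<rho>\<in>Om. E \<rho> \<and> fake_rep \<rho> U V r}) \<le> 1 / 64 * real (card {\<rho>\<in>Om. E \<rho>})"
      if "r < nrep" "indep r E" for r E
      using UV that by (rule card_fake_rep_le)
  qed (use finite_Om in auto)
  then show ?thesis by (simp only: pow_thr)
qed

lemma isolates_cong:
  assumes "\<And>i. i < N \<Longrightarrow> bucket \<rho>' r i = bucket \<rho> r i" "D \<subseteq> {..<N}" "i0 < N"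
  shows "isolates \<rho>' D i0 r = isolates \<rho> D i0 r"
  unfolding isolates_def using assms by (intro ball_cong) auto

lemma card_many_not_isolates_le:
  assumes l: "l \<in> target d L \<kappa> R u w" "4 * d \<le> R"
  defines "D \<equiv> mism (by_index u) (by_index w)" and "i0 \<equiv> leaf_index L l"
  shows "real (card {\<rho>\<in>Om. 3 * thr \<le> card {r. r < nrep \<and> \<not> isolates \<rho> D i0 r}})
    \<le> (1 / 4) ^ thr * real (card Om)"
proof -
  have D: "D \<subseteq> {..<N}" "i0 < N"
    using l leaf_index_less by (auto simp: D_def i0_def mism_def target_def)
  have "real (card {\<rho>\<in>Om. 3 * thr \<le> card {r. r < nrep \<and> \<not> isolates \<rho> D i0 r}})
      \<le> 2 ^ nrep * (1 / 4) ^ (3 * thr) * real (card Om)"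
  proof (rule card_many_bad_le[where indep = indep and Bad = "\<lambda>r \<rho>. \<not> isolates \<rho> D i0 r"])
    show "indep r (\<lambda>\<rho>. \<forall>r'\<in>S'. \<not> isolates \<rho> D i0 r')" if "r \<notin> S'" for r S'
    proof (rule indep_other_rep[where B = "\<lambda>\<rho> r. \<not> isolates \<rho> D i0 r", OF _ that])
      fix \<rho> \<rho>' r'
      assume "\<And>i. i < N \<Longrightarrow> bucket \<rho>' r' i = bucket \<rho> r' i"
      from isolates_cong[OF this D]
      show "(\<not> isolates \<rho>' D i0 r') = (\<not> isolates \<rho> D i0 r')" by simp
    qed
    show "real (card {\<rho>\<in>Om. E \<rho> \<and> \<not> isolates \<rho> D i0 r}) \<le> 1 / 4 * real (card {\<rho>\<in>Om. E \<rho>})"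
      if "r < nrep" "indep r E" for r E
      unfolding D_def i0_def by (rule card_not_isolates_le[OF l that])
  qed (use finite_Om in auto)
  then show ?thesis by (simp only: pow_thr)
qed

end

section \<open>Majority over the repetitions\<close>

definition seen :: "(nat \<Rightarrow> 'k option) \<Rightarrow> (nat \<Rightarrow> nat) \<Rightarrow> nat \<Rightarrow> 'k \<Rightarrow> nat set" where
  "seen c g y k = {r. \<exists>y'<y. g y' = r \<and> c y' = Some k}"

text \<open>A key is emitted exactly when its repetition number \<open>T + 1\<close> appears, which
  makes the list duplicate-free without searching it.\<close>

fun emitted :: "(nat \<Rightarrow> 'k option) \<Rightarrow> (nat \<Rightarrow> nat) \<Rightarrow> nat \<Rightarrow> nat \<Rightarrow> 'k list" where
  "emitted c g T 0 = []"
| "emitted c g T (Suc y) = emitted c g T y @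
     (case c y of None \<Rightarrow> []
      | Some k \<Rightarrow> if g y \<notin> seen c g y k \<and> card (seen c g y k) = T then [k] else [])"

lemma finite_seen: "finite (seen c g y k)"
  by (rule finite_subset[of _ "g ` {..<y}"]) (auto simp: seen_def)

lemma seen_0 [simp]: "seen c g 0 k = {}"
  by (simp add: seen_def)

lemma seen_Suc: "seen c g (Suc y) k = (if c y = Some k then insert (g y) (seen c g y k) else seen c g y k)"
  by (auto simp: seen_def less_Suc_eq)

text \<open>The number of repetitions seen for a key grows by at most one per cell, so it cannot
  skip the threshold.\<close>

lemma set_emitted: "set (emitted c g T y) = {k. T < card (seen c g y k)}"
proof (induction y)
  case (Suc y)
  show ?case
  proof (cases "c y")
    case None
    then show ?thesis by (simp add: Suc seen_Suc)
  next
    case (Some k)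
    have "card (insert (g y) (seen c g y k))
        = (if g y \<in> seen c g y k then card (seen c g y k) else Suc (card (seen c g y k)))"
      by (simp add: card_insert_if finite_seen)
    then show ?thesis using Some by (auto simp: Suc seen_Suc split: if_splits)
  qed
qed simp

lemma distinct_emitted: "distinct (emitted c g T y)"
  by (induction y) (auto simp: set_emitted split: option.split)

text \<open>Double counting: each emitted key is backed by at least \<open>T + 1\<close>
  repetitions, and each cell supports only one pair of key and repetition.\<close>

lemma length_emitted_le: "length (emitted c g T y) * Suc T \<le> card {y'. y' < y \<and> c y' \<noteq> None}"
proof -
  let ?K = "{k. T < card (seen c g y k)}" and ?Y = "{y'. y' < y \<and> c y' \<noteq> None}"
  have fin: "finite ?K" by (metis List.finite_set set_emitted)
  have "length (emitted c g T y) = card ?K"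
    using distinct_card[OF distinct_emitted, of c g T y] by (simp add: set_emitted)
  then have "length (emitted c g T y) * Suc T = (\<Sum>k\<in>?K. Suc T)" by simp
  also have "\<dots> \<le> (\<Sum>k\<in>?K. card (seen c g y k))" by (intro sum_mono) auto
  also have "\<dots> = card (Sigma ?K (seen c g y))"
    using fin finite_seen by (subst card_SigmaI) auto
  \<comment> \<open>A cell determines its candidate and its repetition, so these pairs are covered
    by the image of the cells with a candidate.\<close>
  also have "\<dots> \<le> card ((\<lambda>y'. (the (c y'), g y')) ` ?Y)"
    by (intro card_mono) (force simp: seen_def image_iff)+
  also have "\<dots> \<le> card ?Y" by (rule card_image_le) simp
  finally show ?thesis .
qed

section \<open>The recovered list and its failure probability\<close>

context hmr
begin

text \<open>The cut at \<open>\<kappa> 0\<close> makes the output bound hold for all sketches and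
  random words, not only for typical ones.\<close>

definition recovered :: "(nat \<Rightarrow> nat) \<Rightarrow> (nat \<Rightarrow> nat) \<Rightarrow> (nat \<Rightarrow> nat) \<Rightarrow> (nat \<times> nat \<times> nat) list" where
  "recovered \<rho> S Z = take (\<kappa> 0) (emitted (cand \<rho> S Z) (\<lambda>y. y div \<kappa> 0) thr ncell)"

lemma seen_ncell: "seen c (\<lambda>y. y div \<kappa> 0) ncell k = {r. r < nrep \<and> (\<exists>b<\<kappa> 0. c (r * \<kappa> 0 + b) = Some k)}"
proof (intro equalityI subsetI)
  fix r assume "r \<in> seen c (\<lambda>y. y div \<kappa> 0) ncell k"
  then obtain y where y: "y < ncell" "y div \<kappa> 0 = r" "c y = Some k" by (auto simp: seen_def)
  have "r < nrep" using y(1,2) kap0_pos by (auto simp: ncell_def div_less_iff_less_mult)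
  moreover have "y mod \<kappa> 0 < \<kappa> 0" "r * \<kappa> 0 + y mod \<kappa> 0 = y" using kap0_pos y(2) by auto
  ultimately show "r \<in> {r. r < nrep \<and> (\<exists>b<\<kappa> 0. c (r * \<kappa> 0 + b) = Some k)}"
    using y(3) by auto
next
  fix r assume "r \<in> {r. r < nrep \<and> (\<exists>b<\<kappa> 0. c (r * \<kappa> 0 + b) = Some k)}"
  then obtain b where "r < nrep" "b < \<kappa> 0" "c (r * \<kappa> 0 + b) = Some k" by auto
  then show "r \<in> seen c (\<lambda>y. y div \<kappa> 0) ncell k"
    using mixed_radix_less[of r nrep b "\<kappa> 0"]
    by (auto simp: seen_def ncell_def intro!: exI[of _ "r * \<kappa> 0 + b"])
qed

text \<open>A false triple above the threshold would be a false candidate in more than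
  \<open>thr\<close> repetitions.\<close>

lemma recovered_sound:
  assumes "card {r. r < nrep \<and> fake_rep \<rho> U V r} < thr"
  shows "set (recovered \<rho> (cell \<rho> U) (cell \<rho> V)) \<subseteq> triples U V"
proof (rule subsetI, rule ccontr)
  let ?c = "cand \<rho> (cell \<rho> U) (cell \<rho> V)"
  fix k assume k: "k \<in> set (recovered \<rho> (cell \<rho> U) (cell \<rho> V))" "k \<notin> triples U V"
  then have "k \<in> set (emitted ?c (\<lambda>y. y div \<kappa> 0) thr ncell)"
    unfolding recovered_def by (meson in_set_takeD)
  then have "thr < card (seen ?c (\<lambda>y. y div \<kappa> 0) ncell k)" by (simp add: set_emitted)
  also have "\<dots> \<le> card {r. r < nrep \<and> fake_rep \<rho> U V r}"
  proof (rule card_mono)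
    show "seen ?c (\<lambda>y. y div \<kappa> 0) ncell k \<subseteq> {r. r < nrep \<and> fake_rep \<rho> U V r}"
      unfolding seen_ncell fake_rep_def fake_def using k(2) by blast
  qed simp
  finally show False using assms by simp
qed

text \<open>Two things are needed: the triple passes the threshold, and the cut to
  \<open>\<kappa> 0\<close> triples removes nothing. The latter holds because an accessible leaf
  forces an underloaded root.\<close>

lemma recovered_complete:
  fixes u w :: "nat list \<Rightarrow> nat" and l :: "nat list"
  defines "U \<equiv> by_index u" and "V \<equiv> by_index w" and "i0 \<equiv> leaf_index L l"
  assumes l: "l \<in> target d L \<kappa> R u w" "4 * d \<le> R"
    and good: "card {r. r < nrep \<and> \<not> isolates \<rho> (mism U V) i0 r} < 3 * thr"
    and UV: "\<And>i. i < N \<Longrightarrow> U i < p \<and> V i < p"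
  shows "(i0, U i0, V i0) \<in> set (recovered \<rho> (cell \<rho> U) (cell \<rho> V))"
proof -
  let ?c = "cand \<rho> (cell \<rho> U) (cell \<rho> V)" and ?D = "mism U V"
  let ?g = "\<lambda>y. y div \<kappa> 0"
  have i0: "i0 \<in> ?D"
    using l(1) by (auto simp: i0_def U_def V_def mism_by_index target_def)
  then have i0N: "i0 < N" by (simp add: mism_def)
  have fin: "finite ?D" by (simp add: mism_def)
  \<comment> \<open>The root lies on the path of \<open>l\<close>, so its load, and with it the
    number of occupied root buckets, is at most a quarter of \<open>\<kappa> 0\<close>.\<close>
  have "4 * d * load d L \<kappa> u w [] < \<kappa> 0"
    using accessible_load_less[OF l, of 0] d_pos by simp
  moreover have "4 * load d L \<kappa> u w [] \<le> 4 * d * load d L \<kappa> u w []"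
    using d_pos by (intro mult_right_mono) auto
  ultimately have small: "4 * card (bucket \<rho> r ` ?D) \<le> \<kappa> 0" for r
    using card_buckets_le_load[of \<rho> r u w] unfolding U_def V_def by linarith
  let ?Y = "{y. y < ncell \<and> ?c y \<noteq> None}"
  let ?B = "SIGMA r:{..<nrep}. bucket \<rho> r ` ?D"
  have "?Y \<subseteq> (\<lambda>(r, b). r * \<kappa> 0 + b) ` ?B"
  proof
    fix y assume y: "y \<in> ?Y"
    let ?r = "y div \<kappa> 0" and ?b = "y mod \<kappa> 0"
    have r: "?r < nrep" using y kap0_pos by (auto simp: ncell_def div_less_iff_less_mult)
    have "bmism \<rho> ?r ?b U V \<noteq> {}"
      using cand_None_if_empty[of ?b \<rho> ?r U V] y kap0_pos by auto
    then obtain i where "i \<in> ?D" "bucket \<rho> ?r i = ?b" unfolding bmism_def by blast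
    then have "?b \<in> bucket \<rho> ?r ` ?D" by (metis image_eqI)
    then show "y \<in> (\<lambda>(r, b). r * \<kappa> 0 + b) ` ?B"
      using r by (intro image_eqI[of _ _ "(?r, ?b)"]) auto
  qed
  then have "card ?Y \<le> card ?B"
    using fin by (intro surj_card_le) auto
  also have "\<dots> = (\<Sum>r<nrep. card (bucket \<rho> r ` ?D))"
    using fin by (intro card_SigmaI) auto
  finally have "4 * card ?Y \<le> (\<Sum>r<nrep. 4 * card (bucket \<rho> r ` ?D))"
    by (simp add: sum_distrib_left[symmetric])
  also have "\<dots> \<le> (\<Sum>r<nrep. \<kappa> 0)" by (intro sum_mono small)
  \<comment> \<open>As \<open>nrep = 4 * thr\<close>, at most \<open>thr * \<kappa> 0\<close> cells
    have a candidate, while every emitted triple consumes \<open>thr + 1\<close> of them.\<close>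
  finally have "card ?Y \<le> thr * \<kappa> 0" by (simp add: nrep_def)
  then have "length (emitted ?c ?g thr ncell) * Suc thr \<le> \<kappa> 0 * Suc thr"
    using length_emitted_le[of ?c ?g thr ncell] by (simp add: mult.commute)
  then have len: "length (emitted ?c ?g thr ncell) \<le> \<kappa> 0"
    by (rule mult_right_le_imp_le) simp
  have "{r. r < nrep \<and> isolates \<rho> ?D i0 r} \<subseteq> seen ?c ?g ncell (i0, U i0, V i0)"
  proof
    fix r assume r: "r \<in> {r. r < nrep \<and> isolates \<rho> ?D i0 r}"
    then have "bmism \<rho> r (bucket \<rho> r i0) U V = {i0}"
      using i0 by (auto simp: bmism_def isolates_def)
    then have "?c (r * \<kappa> 0 + bucket \<rho> r i0) = Some (i0, U i0, V i0)"
      using UV[OF i0N] bucket_less by (intro cand_if_single) auto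
    then show "r \<in> seen ?c ?g ncell (i0, U i0, V i0)"
      using r bucket_less by (auto simp: seen_ncell)
  qed
  then have 1: "card {r. r < nrep \<and> isolates \<rho> ?D i0 r} \<le> card (seen ?c ?g ncell (i0, U i0, V i0))"
    by (intro card_mono finite_seen)
  \<comment> \<open>Fewer than \<open>3 * thr\<close> of the \<open>4 * thr\<close> repetitions fail
    to isolate the leaf, which leaves more than \<open>thr\<close>.\<close>
  have "card {..<nrep} = card ({r. r < nrep \<and> isolates \<rho> ?D i0 r} \<union> {r. r < nrep \<and> \<not> isolates \<rho> ?D i0 r})"
    by (rule arg_cong[where f = card]) auto
  also have "\<dots> \<le> card {r. r < nrep \<and> isolates \<rho> ?D i0 r} + card {r. r < nrep \<and> \<not> isolates \<rho> ?D i0 r}"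
    by (rule card_Un_le)
  finally have "thr < card (seen ?c ?g ncell (i0, U i0, V i0))"
    using good 1 by (simp add: nrep_def)
  then show ?thesis using len by (simp add: recovered_def set_emitted)
qed

lemma triples_by_index: "triples (by_index u) (by_index w) = encode_triple L ` MIS d L u w"
  unfolding triples_def mism_by_index MIS_def image_image encode_triple_def
  by (intro image_cong refl) (auto simp: by_index_leaf)

lemma by_index_less:
  assumes "u \<in> seqs d L p" "i < N"
  shows "by_index u i < p"
proof -
  obtain l where "l \<in> leaves d L" "leaf_index L l = i" using leaf_of_index[OF assms(2)] by blast
  then show ?thesis using assms(1) by (auto simp: seqs_def by_index_leaf)
qed

lemma card_fail_le:
  assumes u: "u \<in> seqs d L p" and w: "w \<in> seqs d L p" and R: "4 * d \<le> R"
  defines "xs \<equiv> \<lambda>\<rho>. recovered \<rho> (cell \<rho> (by_index u)) (cell \<rho> (by_index w))"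
  shows "real (card {\<rho>\<in>Om. \<not> (hmr_sound d L u w (xs \<rho>) \<and> hmr_complete d L \<kappa> R u w (xs \<rho>))})
    \<le> (1 / 2) ^ t * real (card Om)"
proof -
  let ?U = "by_index u" and ?V = "by_index w" and ?T = "target d L \<kappa> R u w"
  have UV: "?U i < p \<and> ?V i < p" if "i < N" for i
    using by_index_less u w that by auto
  let ?A = "{\<rho>\<in>Om. thr \<le> card {r. r < nrep \<and> fake_rep \<rho> ?U ?V r}}"
  let ?B = "\<lambda>l. {\<rho>\<in>Om. 3 * thr \<le> card {r. r < nrep \<and> \<not> isolates \<rho> (mism ?U ?V) (leaf_index L l) r}}"
  let ?F = "{\<rho>\<in>Om. \<not> (hmr_sound d L u w (xs \<rho>) \<and> hmr_complete d L \<kappa> R u w (xs \<rho>))}"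
  have Tsub: "?T \<subseteq> leaves d L" by (auto simp: target_def)
  then have finT: "finite ?T" using finite_leaves by (rule finite_subset)
  have "card (leaves d L) = N"
    using bij_betw_same_card[OF bij_betw_leaf_index[of L d]] by (simp add: N_def)
  then have cardT: "card ?T \<le> N" using card_mono[OF finite_leaves Tsub] by simp
  have "?F \<subseteq> ?A \<union> (\<Union>l\<in>?T. ?B l)"
  proof (rule subsetI, rule ccontr)
    fix \<rho> assume \<rho>: "\<rho> \<in> ?F" "\<rho> \<notin> ?A \<union> (\<Union>l\<in>?T. ?B l)"
    then have "set (xs \<rho>) \<subseteq> triples ?U ?V"
      unfolding xs_def by (intro recovered_sound) auto
    then have "hmr_sound d L u w (xs \<rho>)" by (simp add: hmr_sound_def triples_by_index)
    moreover have "hmr_complete d L \<kappa> R u w (xs \<rho>)"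
      unfolding hmr_complete_def MIS_target_def image_image
    proof (rule image_subsetI)
      fix l assume l: "l \<in> ?T"
      then have "(leaf_index L l, ?U (leaf_index L l), ?V (leaf_index L l)) \<in> set (xs \<rho>)"
        unfolding xs_def using \<rho> by (intro recovered_complete[OF l R _ UV]) auto
      then show "encode_triple L (l, u l, w l) \<in> set (xs \<rho>)"
        using l by (simp add: encode_triple_def by_index_leaf target_def)
    qed
    ultimately show False using \<rho>(1) by simp
  qed
  then have "card ?F \<le> card (?A \<union> (\<Union>l\<in>?T. ?B l))"
    using finite_Om finT by (intro card_mono) auto
  also have "\<dots> \<le> card ?A + card (\<Union>l\<in>?T. ?B l)" by (rule card_Un_le)
  also have "\<dots> \<le> card ?A + (\<Sum>l\<in>?T. card (?B l))"
    by (intro add_left_mono card_UN_le finT)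
  finally have "card ?F \<le> card ?A + (\<Sum>l\<in>?T. card (?B l))" .
  from of_nat_mono[OF this, where 'a = real]
  have "real (card ?F) \<le> real (card ?A) + (\<Sum>l\<in>?T. real (card (?B l)))"
    by (simp only: of_nat_sum of_nat_add)
  also have "\<dots> \<le> (1 / 4) ^ thr * real (card Om) + (\<Sum>l\<in>?T. (1 / 4) ^ thr * real (card Om))"
    using card_many_not_isolates_le[OF _ R] by (intro add_mono card_many_fake_le UV sum_mono) auto
  also have "\<dots> = (1 + real (card ?T)) * ((1 / 4) ^ thr * real (card Om))"
    by (simp add: algebra_simps)
  \<comment> \<open>One soundness event and at most \<open>N\<close> completeness events make at
    most \<open>2 * N\<close>.\<close>
  also have "\<dots> \<le> (2 * real N) * ((1 / 4) ^ thr * real (card Om))"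
    using cardT N_pos by (intro mult_right_mono) auto
  also have "\<dots> = (2 * real N * (1 / 4) ^ thr) * real (card Om)" by simp
  also have "\<dots> \<le> (1 / 2) ^ t * real (card Om)"
  proof (rule mult_right_mono)
    have N: "real N = 2 ^ clog N" using arg_cong[OF N_pow, of real] by simp
    \<comment> \<open>\<open>(1/4) ^ thr\<close> contains \<open>(1/2) ^ thr\<close> twice: one copy
      cancels \<open>2 * N\<close> and leaves \<open>(1/2) ^ t\<close>, the other is at most
      1.\<close>
    have "2 * real N * (1 / 4) ^ thr = 2 ^ (clog N + 1) * ((1 / 2) ^ thr * (1 / 2) ^ thr)"
      by (simp add: N flip: power_mult_distrib)
    also have "(1 / 2 :: real) ^ thr = (1 / 2) ^ t * (1 / 2) ^ (clog N + 1)"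
      by (simp add: thr_def power_add)
    also have "2 ^ (clog N + 1) * ((1 / 2) ^ t * (1 / 2) ^ (clog N + 1) * ((1 / 2) ^ t * (1 / 2) ^ (clog N + 1)))
        = (2 * (1 / 2)) ^ (clog N + 1) * ((1 / 2 :: real) ^ t * ((1 / 2) ^ t * (1 / 2) ^ (clog N + 1)))"
      by (simp only: power_mult_distrib mult_ac)
    also have "\<dots> = (1 / 2) ^ t * ((1 / 2) ^ t * (1 / 2) ^ (clog N + 1))" by simp
    also have "\<dots> \<le> (1 / 2) ^ t * (1 * 1)"
      by (intro mult_left_mono mult_mono power_le_one) auto
    finally show "2 * real N * (1 / 4) ^ thr \<le> (1 / 2) ^ t" by simp
  qed simp
  finally show ?thesis .
qed

lemma length_recovered: "length (recovered \<rho> S Z) \<le> \<kappa> 0"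
  by (simp add: recovered_def)

end

section \<open>Program logic\<close>

text \<open>The step bound is a natural number so that costs compose by plain arithmetic; real
  bounds enter only through \<open>runs_within_mono\<close>. Budgets are rounded up generously
  throughout.\<close>

definition runs :: "nat \<Rightarrow> (nat \<Rightarrow> nat) \<Rightarrow> com \<Rightarrow> state \<Rightarrow> nat \<Rightarrow> (state \<Rightarrow> bool) \<Rightarrow> bool" where
  "runs W \<rho> c s B Q \<longleftrightarrow> (\<exists>T s'. exec W \<rho> c s T s' \<and> T \<le> B \<and> Q s')"

primrec straight :: "com \<Rightarrow> bool" where
  "straight Skip = True"
| "straight (Assign x e) = True"
| "straight (Store a e1 e2) = True"
| "straight (Seq c1 c2) = (straight c1 \<and> straight c2)"
| "straight (Cond e c1 c2) = (straight c1 \<and> straight c2)"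
| "straight (Loop e c) = False"

text \<open>A functional semantics for loop-free programs, by which the final state can be computed
  by rewriting; loops are handled by \<open>runs_Loop\<close>.\<close>

primrec sem :: "nat \<Rightarrow> (nat \<Rightarrow> nat) \<Rightarrow> com \<Rightarrow> state \<Rightarrow> state" where
  "sem W \<rho> Skip s = s"
| "sem W \<rho> (Assign x e) s = s\<lparr>reg := (reg s)(x := aval W \<rho> s e)\<rparr>"
| "sem W \<rho> (Store a e1 e2) s =
     s\<lparr>arr := (arr s)(a := (arr s a)(aval W \<rho> s e1 := aval W \<rho> s e2))\<rparr>"
| "sem W \<rho> (Seq c1 c2) s = sem W \<rho> c2 (sem W \<rho> c1 s)"
| "sem W \<rho> (Cond e c1 c2) s = (if aval W \<rho> s e \<noteq> 0 then sem W \<rho> c1 s else sem W \<rho> c2 s)"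
| "sem W \<rho> (Loop e c) s = s"

text \<open>Charging both branches of a conditional keeps the bound independent of the
  state.\<close>

primrec ctime :: "com \<Rightarrow> nat" where
  "ctime Skip = 1"
| "ctime (Assign x e) = 1 + ecost e"
| "ctime (Store a e1 e2) = 1 + ecost e1 + ecost e2"
| "ctime (Seq c1 c2) = ctime c1 + ctime c2"
| "ctime (Cond e c1 c2) = 1 + ecost e + ctime c1 + ctime c2"
| "ctime (Loop e c) = 0"

primrec block :: "com list \<Rightarrow> com" where
  "block [] = Skip"
| "block (c # cs) = Seq c (block cs)"

lemma exec_straight:
  "straight c \<Longrightarrow> \<exists>T\<le>ctime c. exec W \<rho> c s T (sem W \<rho> c s)"
proof (induction c arbitrary: s)
  case (Seq c1 c2)
  then obtain T1 T2 where "T1 \<le> ctime c1" "exec W \<rho> c1 s T1 (sem W \<rho> c1 s)"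
    "T2 \<le> ctime c2" "exec W \<rho> c2 (sem W \<rho> c1 s) T2 (sem W \<rho> c2 (sem W \<rho> c1 s))"
    by (metis straight.simps(4))
  then show ?case by (intro exI[of _ "T1 + T2"]) (auto intro: exec.Seq)
next
  case (Cond e c1 c2)
  then obtain T1 T2 where "T1 \<le> ctime c1" "exec W \<rho> c1 s T1 (sem W \<rho> c1 s)"
    "T2 \<le> ctime c2" "exec W \<rho> c2 s T2 (sem W \<rho> c2 s)"
    by (metis straight.simps(5))
  note 1 = this
  show ?case
  proof (cases "aval W \<rho> s e = 0")
    case True
    then show ?thesis using exec.CondFalse[OF True 1(4)] 1(3)
      by (intro exI[of _ "1 + ecost e + T2"]) auto
  next
    case False
    then show ?thesis using exec.CondTrue[OF False 1(2)] 1(1)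
      by (intro exI[of _ "1 + ecost e + T1"]) auto
  qed
next
  case (Assign x e)
  have "exec W \<rho> (Assign x e) s (1 + ecost e) (sem W \<rho> (Assign x e) s)"
    unfolding sem.simps by (rule exec.Assign)
  then show ?case by (metis ctime.simps(2) order_refl)
next
  case (Store a e1 e2)
  have "exec W \<rho> (Store a e1 e2) s (1 + ecost e1 + ecost e2) (sem W \<rho> (Store a e1 e2) s)"
    unfolding sem.simps by (rule exec.Store)
  then show ?case by (metis ctime.simps(3) order_refl)
next
  case Skip
  have "exec W \<rho> Skip s 1 (sem W \<rho> Skip s)" unfolding sem.simps by (rule exec.Skip)
  then show ?case by (metis ctime.simps(1) order_refl)
qed simp

lemma runs_straight: "straight c \<Longrightarrow> ctime c \<le> B \<Longrightarrow> Q (sem W \<rho> c s) \<Longrightarrow> runs W \<rho> c s B Q"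
  using exec_straight[of c W \<rho> s] unfolding runs_def by (meson le_trans)

lemma runs_Seq:
  assumes "runs W \<rho> c1 s B1 P" "\<And>s'. P s' \<Longrightarrow> runs W \<rho> c2 s' B2 Q" "B1 + B2 \<le> B"
  shows "runs W \<rho> (Seq c1 c2) s B Q"
proof -
  obtain T1 s1 where 1: "exec W \<rho> c1 s T1 s1" "T1 \<le> B1" "P s1" using assms(1) by (auto simp: runs_def)
  obtain T2 s2 where 2: "exec W \<rho> c2 s1 T2 s2" "T2 \<le> B2" "Q s2"
    using assms(2)[OF 1(3)] by (auto simp: runs_def)
  then show ?thesis using 1 assms(3) exec.Seq[OF 1(1) 2(1)] unfolding runs_def
    by (intro exI[of _ "T1 + T2"] exI[of _ s2]) auto
qed

lemma runs_Skip: "1 \<le> B \<Longrightarrow> Q s \<Longrightarrow> runs W \<rho> Skip s B Q"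
  by (rule runs_straight) auto

lemma runs_Cond:
  assumes "aval W \<rho> s e \<noteq> 0 \<Longrightarrow> runs W \<rho> c1 s B1 Q" "aval W \<rho> s e = 0 \<Longrightarrow> runs W \<rho> c2 s B1 Q"
    and "1 + ecost e + B1 \<le> B"
  shows "runs W \<rho> (Cond e c1 c2) s B Q"
proof (cases "aval W \<rho> s e = 0")
  case True
  then obtain T s' where "exec W \<rho> c2 s T s'" "T \<le> B1" "Q s'" using assms(2) by (auto simp: runs_def)
  then show ?thesis using exec.CondFalse[OF True] assms(3) unfolding runs_def
    by (intro exI[of _ "1 + ecost e + T"] exI[of _ s']) auto
next
  case False
  then obtain T s' where "exec W \<rho> c1 s T s'" "T \<le> B1" "Q s'" using assms(1) by (auto simp: runs_def)
  then show ?thesis using exec.CondTrue[OF False] assms(3) unfolding runs_def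
    by (intro exI[of _ "1 + ecost e + T"] exI[of _ s']) auto
qed

text \<open>The invariant is indexed by the number of completed rounds and \<open>n\<close> is the
  exact number of rounds, so termination and cost come from the same induction.\<close>

lemma runs_Loop:
  assumes init: "I 0 s"
    and guard: "\<And>k s. k < n \<Longrightarrow> I k s \<Longrightarrow> aval W \<rho> s e \<noteq> 0"
    and body: "\<And>k s. k < n \<Longrightarrow> I k s \<Longrightarrow> runs W \<rho> c s B1 (I (Suc k))"
    and exit: "\<And>s. I n s \<Longrightarrow> aval W \<rho> s e = 0"
    and Q: "\<And>s. I n s \<Longrightarrow> Q s"
    and B: "n * (1 + ecost e + B1) + (1 + ecost e) \<le> B"
  shows "runs W \<rho> (Loop e c) s B Q"
proof -
  have "\<exists>T s'. exec W \<rho> (Loop e c) s T s' \<and> T \<le> (n - k) * (1 + ecost e + B1) + (1 + ecost e) \<and> I n s'"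
    if "k \<le> n" "I k s" for k s
    using that
  proof (induction k arbitrary: s rule: inc_induct)
    case base
    then show ?case using exec.LoopFalse[OF exit, of s] by auto
  next
    case (step k)
    obtain T1 s1 where 1: "exec W \<rho> c s T1 s1" "T1 \<le> B1" "I (Suc k) s1"
      using body[OF step.hyps(2) step.prems] by (auto simp: runs_def)
    obtain T2 s2 where 2: "exec W \<rho> (Loop e c) s1 T2 s2"
      "T2 \<le> (n - Suc k) * (1 + ecost e + B1) + (1 + ecost e)" "I n s2"
      using step.IH[OF 1(3)] by auto
    have "n - k = Suc (n - Suc k)" using step.hyps by simp
    then have "1 + ecost e + T1 + T2 \<le> (n - k) * (1 + ecost e + B1) + (1 + ecost e)"
      using 1(2) 2(2) by simp
    then show ?case
      using exec.LoopTrue[OF guard[OF step.hyps(2) step.prems] 1(1) 2(1)] 2(3) by blast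
  qed
  from this[of 0 s] init show ?thesis
    using B Q unfolding runs_def by (auto intro: le_trans)
qed

text \<open>The frame condition: everything outside \<open>X\<close> and \<open>A\<close> is
  unchanged. It speaks of the register and array functions instead of states so that
  \<open>agree_upd\<close> applies to plain function updates.\<close>

definition agree :: "name set \<Rightarrow> name set \<Rightarrow> (name \<Rightarrow> nat) \<Rightarrow> (name \<Rightarrow> nat \<Rightarrow> nat) \<Rightarrow>
    (name \<Rightarrow> nat) \<Rightarrow> (name \<Rightarrow> nat \<Rightarrow> nat) \<Rightarrow> bool" where
  "agree X A f g f' g' \<longleftrightarrow> (\<forall>x. x \<notin> X \<longrightarrow> f' x = f x) \<and> (\<forall>a. a \<notin> A \<longrightarrow> g' a = g a)"

abbreviation same :: "name set \<Rightarrow> name set \<Rightarrow> state \<Rightarrow> state \<Rightarrow> bool" where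
  "same X A s s' \<equiv> agree X A (reg s) (arr s) (reg s') (arr s')"

lemma agree_refl [simp]: "agree X A f g f g"
  by (simp add: agree_def)

lemma agree_upd [simp]:
  "x \<in> X \<Longrightarrow> agree X A f g (f'(x := v)) g' = agree X A f g f' g'"
  "a \<in> A \<Longrightarrow> agree X A f g f' (g'(a := h)) = agree X A f g f' g'"
  by (auto simp: agree_def)

lemma agree_regD: "agree X A f g f' g' \<Longrightarrow> x \<notin> X \<Longrightarrow> f' x = f x"
  by (simp add: agree_def)

lemma agree_arrD: "agree X A f g f' g' \<Longrightarrow> a \<notin> A \<Longrightarrow> g' a = g a"
  by (simp add: agree_def)

lemma agree_trans:
  "agree X A f g f' g' \<Longrightarrow> agree X' A' f' g' f'' g'' \<Longrightarrow> X \<subseteq> Y \<Longrightarrow> X' \<subseteq> Y \<Longrightarrow> A \<subseteq> B \<Longrightarrow> A' \<subseteq> B \<Longrightarrow>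
    agree Y B f g f'' g''"
  unfolding agree_def by (metis subsetD)

section \<open>The programs\<close>

definition levels_guard :: exp where
  "levels_guard = Bin Less (Reg ''j'') (Bin Add (Reg ''d'') (Const 1))"

text \<open>The only pass over all \<open>d\<close> levels. It lists in \<open>E\<close> the depths
  with more than one child; the hashing of a leaf later visits just these.\<close>

definition levels_body :: com where
  "levels_body = block
     [Cond (Bin Less (Const 1) (Elem ''L'' (Reg ''j'')))
        (block [Store ''E'' (Reg ''l'') (Reg ''j''),
                Assign ''N'' (Bin Mul (Reg ''N'') (Elem ''L'' (Reg ''j''))),
                Assign ''l'' (Bin Add (Reg ''l'') (Const 1))])
        Skip,
      Assign ''j'' (Bin Add (Reg ''j'') (Const 1))]"

definition clog_guard :: "name \<Rightarrow> exp \<Rightarrow> exp" where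
  "clog_guard x e = Bin Less (Bin Shl (Const 1) (Reg x)) e"

definition clog_loop :: "name \<Rightarrow> exp \<Rightarrow> com" where
  "clog_loop x e = Loop (clog_guard x e) (Assign x (Bin Add (Reg x) (Const 1)))"

definition sizes :: com where
  "sizes = block
     [Assign ''m'' (Bin Mul (Const 3) (Reg ''m'')),
      Assign ''z'' (Bin Add (Bin Add (Reg ''t'') (Reg ''g'')) (Const 1)),
      Assign ''q'' (Bin Mul (Const 4) (Reg ''z'')),
      Assign ''Y'' (Bin Mul (Reg ''q'') (Elem ''kappa'' (Const 0))),
      Assign ''H'' (Bin Mul (Bin Mul (Const 3) (Reg ''Y'')) (Reg ''m''))]"

definition prepare :: com where
  "prepare =
     Seq (block [Assign ''N'' (Const 1), Assign ''l'' (Const 0), Assign ''j'' (Const 1)])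
    (Seq (Loop levels_guard levels_body)
    (Seq (block [Assign ''g'' (Const 0), Assign ''m'' (Const 0)])
    (Seq (clog_loop ''g'' (Reg ''N''))
    (Seq (clog_loop ''m'' (Bin Add (Reg ''p'') (Const 1)))
    sizes))))"

definition addr_exp :: exp where
  "addr_exp = Bin Add (Bin Mul (Bin Add (Bin Mul (Bin Add (Bin Mul (Reg ''r'')
     (Bin Add (Reg ''d'') (Const 1))) (Elem ''E'' (Reg ''j''))) (Reg ''N'')) (Reg ''k'')) (Reg ''N'')) (Reg ''b'')"

text \<open>The address is \<open>addr r 0 x 0\<close> with the vanishing summands left out.\<close>

definition fp_exp :: exp where
  "fp_exp = Bin Mod (Rnd (Bin Mul (Bin Add (Bin Mul (Bin Mul (Reg ''r'')
     (Bin Add (Reg ''d'') (Const 1))) (Reg ''N'')) (Reg ''x'')) (Reg ''N''))) (Bin Mul (Const 64) (Reg ''N''))"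

text \<open>The bucket is updated before the node rank because the address refers to the node that
  is being left. The counter \<open>j\<close> runs downwards, from the deepest listed level to the
  root.\<close>

definition hash_body :: com where
  "hash_body = block
     [Assign ''j'' (Bin Sub (Reg ''j'') (Const 1)),
      Assign ''b'' (Bin Mod (Rnd addr_exp) (Elem ''kappa'' (Bin Sub (Elem ''E'' (Reg ''j'')) (Const 1)))),
      Assign ''k'' (Bin Div (Reg ''k'') (Elem ''L'' (Elem ''E'' (Reg ''j''))))]"

definition bump :: com where
  "bump = block
     [Assign ''y'' (Bin Mul (Const 3) (Bin Add (Bin Mul (Reg ''r'') (Elem ''kappa'' (Const 0))) (Reg ''b''))),
      Store ''S'' (Reg ''y'') (Bin Add (Elem ''S'' (Reg ''y'')) (Reg ''v'')),
      Assign ''y'' (Bin Add (Reg ''y'') (Const 1)),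
      Store ''S'' (Reg ''y'') (Bin Add (Elem ''S'' (Reg ''y''))
        (Bin Mul (Bin Add (Bin Mul (Reg ''x'') (Bin Mul (Const 2) (Reg ''p''))) (Reg ''v'')) (Reg ''v''))),
      Assign ''y'' (Bin Add (Reg ''y'') (Const 1)),
      Store ''S'' (Reg ''y'') (Bin Add (Elem ''S'' (Reg ''y'')) (Bin Mul fp_exp (Reg ''v''))),
      Assign ''r'' (Bin Add (Reg ''r'') (Const 1))]"

definition element_body :: com where
  "element_body =
     Seq (block [Assign ''k'' (Reg ''x''), Assign ''b'' (Const 0), Assign ''j'' (Reg ''l'')])
    (Seq (Loop (Reg ''j'') hash_body) bump)"

definition element_loop :: com where
  "element_loop = Seq (Assign ''r'' (Const 0)) (Loop (Bin Less (Reg ''r'') (Reg ''q'')) element_body)"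

section \<open>Correctness of the preparation phase\<close>

context hmr
begin

lemma less_word: "x \<le> Q ^ 8 \<Longrightarrow> x < 2 ^ W"
  using word by simp

lemma Q_pow_le: "k \<le> 8 \<Longrightarrow> Q ^ k \<le> Q ^ 8"
  using p_ge_256 by (intro power_increasing) auto

lemma le_Q_less_word: "x \<le> Q \<Longrightarrow> x < 2 ^ W"
  using Q_pow_le[of 1] by (intro less_word) simp

lemma W_pos: "0 < W"
  using le_Q_less_word[of 1] p_ge_256 by (cases W) auto

lemma const_mod: "1 mod 2 ^ W = (1::nat)" "Suc 0 mod 2 ^ W = 1" "2 mod 2 ^ W = (2::nat)" "3 mod 2 ^ W = (3::nat)"
  "4 mod 2 ^ W = (4::nat)" "64 mod 2 ^ W = (64::nat)"
  using p_ge_256 W_pos by (auto intro!: mod_less le_Q_less_word)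

definition levels :: "nat list" where
  "levels = filter (\<lambda>j. 1 < L j) [1..<Suc d]"

text \<open>The part of the environment that is given as input; \<open>env\<close> adds the
  quantities computed by \<open>prepare\<close>. Both are preserved by any frame that avoids their
  names.\<close>

definition penv :: "(name \<Rightarrow> nat) \<Rightarrow> (name \<Rightarrow> nat \<Rightarrow> nat) \<Rightarrow> bool" where
  "penv f g \<longleftrightarrow> f ''d'' = d \<and> f ''p'' = p \<and> f ''t'' = t \<and>
     (\<forall>j. 1 \<le> j \<and> j \<le> d \<longrightarrow> g ''L'' j = L j) \<and> (\<forall>j\<le>d. g ''kappa'' j = \<kappa> j)"

definition env :: "(name \<Rightarrow> nat) \<Rightarrow> (name \<Rightarrow> nat \<Rightarrow> nat) \<Rightarrow> bool" where
  "env f g \<longleftrightarrow> penv f g \<and> f ''N'' = N \<and> f ''l'' = length levels \<and> f ''m'' = width \<and>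
     f ''z'' = thr \<and> f ''q'' = nrep \<and> f ''Y'' = ncell \<and> f ''H'' = nbit \<and>
     (\<forall>j<length levels. g ''E'' j = levels ! j)"

abbreviation penv_of :: "state \<Rightarrow> bool" where
  "penv_of s \<equiv> penv (reg s) (arr s)"

abbreviation env_of :: "state \<Rightarrow> bool" where
  "env_of s \<equiv> env (reg s) (arr s)"

lemma penv_agree:
  assumes "agree X A f g f' g'" "penv f g" "\<forall>x\<in>{''d'', ''p'', ''t''}. x \<notin> X" "\<forall>a\<in>{''L'', ''kappa''}. a \<notin> A"
  shows "penv f' g'"
  using assms(2-4) agree_regD[OF assms(1)] agree_arrD[OF assms(1)] by (simp add: penv_def)

lemma env_agree:
  assumes "agree X A f g f' g'" "env f g"
    "\<forall>x\<in>{''d'', ''p'', ''t'', ''N'', ''l'', ''m'', ''z'', ''q'', ''Y'', ''H''}. x \<notin> X"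
    "\<forall>a\<in>{''L'', ''kappa'', ''E''}. a \<notin> A"
  shows "env f' g'"
  using assms(2-4) agree_regD[OF assms(1)] agree_arrD[OF assms(1)] by (simp add: env_def penv_def)

text \<open>Each level with more than one child contributes a factor of at least 2 to the number of
  leaves.\<close>

lemma length_levels_le: "length levels \<le> clog N"
proof -
  have "2 ^ length (filter (\<lambda>j. 1 < L j) [1..<Suc k]) \<le> (\<Prod>j=1..k. L j)" if "k \<le> d" for k
    using that
  proof (induction k)
    case (Suc k)
    have "0 < L (Suc k)" using L_pos Suc.prems by simp
    show ?case
    proof (cases "1 < L (Suc k)")
      case True
      have "2 ^ length (filter (\<lambda>j. 1 < L j) [1..<Suc k]) * 2 \<le> (\<Prod>j=1..k. L j) * L (Suc k)"
        using Suc True by (intro mult_mono) auto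
      then show ?thesis using True by (simp add: mult.commute)
    next
      case False
      then have "L (Suc k) = 1" using \<open>0 < L (Suc k)\<close> by simp
      then show ?thesis using Suc by simp
    qed
  qed simp
  from this[of d] have "2 ^ length levels \<le> N" by (simp add: levels_def N_def num_leaves_def)
  also have "N = 2 ^ clog N" by (rule N_pow)
  finally show ?thesis by (rule power_le_imp_le_exp[rotated]) simp
qed

lemma levels_mem: "j < length levels \<Longrightarrow> 1 \<le> levels ! j \<and> levels ! j \<le> d \<and> 1 < L (levels ! j)"
  using nth_mem[of j levels] by (auto simp: levels_def simp del: upt_Suc)

text \<open>Single-child levels act as the identity: they copy the bucket, and division by 1 keeps
  the rank.\<close>

lemma st_levels:
  "st \<rho> r i d = fold (step \<rho> r) (rev levels) (i, 0)"
proof -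
  have "st \<rho> r i s = fold (step \<rho> r) (rev (filter (\<lambda>j. 1 < L j) [Suc (d - s)..<Suc d])) (i, 0)"
    if "s \<le> d" for s
    using that
  proof (induction s)
    case (Suc s)
    have "Suc (d - Suc s) = d - s" using Suc.prems by simp
    then have "[Suc (d - Suc s)..<Suc d] = (d - s) # [Suc (d - s)..<Suc d]"
      using Suc.prems upt_conv_Cons[of "d - s" "Suc d"] by (simp del: upt_Suc)
    moreover have "step \<rho> r (d - s) x = x" if "\<not> 1 < L (d - s)" for x
    proof -
      have "0 < L (d - s)" using Suc.prems by (intro L_pos) auto
      then have "L (d - s) = 1" using that by simp
      then show ?thesis by (simp add: step_def)
    qed
    ultimately show ?case using Suc by (simp del: upt_Suc)
  qed simp
  from this[of d] show ?thesis by (simp add: levels_def del: upt_Suc)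
qed


text \<open>The bound on \<open>2 ^ clog n\<close> ensures that no shifted power wraps around before
  the loop stops.\<close>

lemma runs_clog_loop:
  assumes x: "reg s x = 0" and n: "2 ^ clog n < (2::nat) ^ W"
    and e: "\<And>s'. same {x} {} s s' \<Longrightarrow> aval W \<rho> s' e = n"
    and post: "\<And>s'. same {x} {} s s' \<Longrightarrow> reg s' x = clog n \<Longrightarrow> Post s'"
    and B: "(clog n + 1) * (ecost e + 20) \<le> B"
  shows "runs W \<rho> (clog_loop x e) s B Post"
  unfolding clog_loop_def
proof (rule runs_Loop[where n = "clog n" and ?B1.0 = 10 and
      I = "\<lambda>k s'. same {x} {} s s' \<and> reg s' x = k"])
  have guard: "aval W \<rho> s' (clog_guard x e) = (if 2 ^ k < n then 1 else 0)"
    if "same {x} {} s s' \<and> reg s' x = k" "k \<le> clog n" for k s'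
  proof -
    have "(2::nat) ^ k \<le> 2 ^ clog n" using that(2) by (intro power_increasing) auto
    then have "(2::nat) ^ k mod 2 ^ W = 2 ^ k" using n by simp
    then show ?thesis using that e[of s'] W_pos
      by (simp add: clog_guard_def push_bit_eq_mult const_mod)
  qed
  show "aval W \<rho> s' (clog_guard x e) \<noteq> 0"
    if "k < clog n" "same {x} {} s s' \<and> reg s' x = k" for k s'
    using guard[OF that(2)] that(1) clog_le_iff[of n k] by simp
  show "aval W \<rho> s' (clog_guard x e) = 0"
    if "same {x} {} s s' \<and> reg s' x = clog n" for s'
    using guard[OF that] clog_le_iff[of n "clog n"] by simp
  show "runs W \<rho> (Assign x (Bin Add (Reg x) (Const 1))) s' 10
      (\<lambda>s'. same {x} {} s s' \<and> reg s' x = Suc k)"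
    if "k < clog n" "same {x} {} s s' \<and> reg s' x = k" for k s'
  proof (rule runs_straight)
    have "Suc k < 2 ^ W" using that(1) n less_exp[of "clog n"] by linarith
    then show "agree {x} {} (reg s) (arr s) (reg (sem W \<rho> (Assign x (Bin Add (Reg x) (Const 1))) s'))
        (arr (sem W \<rho> (Assign x (Bin Add (Reg x) (Const 1))) s')) \<and>
        reg (sem W \<rho> (Assign x (Bin Add (Reg x) (Const 1))) s') x = Suc k"
      using that W_pos by (simp add: const_mod)
  qed auto
  have "clog n * (1 + ecost (clog_guard x e) + 10) + (1 + ecost (clog_guard x e))
      = clog n * (ecost e + 15) + (ecost e + 5)" by (simp add: clog_guard_def)
  also have "\<dots> \<le> clog n * (ecost e + 20) + (ecost e + 20)" by (intro add_mono mult_left_mono) auto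
  also have "\<dots> = (clog n + 1) * (ecost e + 20)" by simp
  finally show "clog n * (1 + ecost (clog_guard x e) + 10) + (1 + ecost (clog_guard x e)) \<le> B"
    using B by simp
qed (use x post in auto)

lemma prod_L_le: "k \<le> d \<Longrightarrow> (\<Prod>j=1..k. L j) \<le> N"
proof -
  assume k: "k \<le> d"
  have "{1..d} = {1..k} \<union> {Suc k..d}" using k by auto
  then have "N = (\<Prod>j=1..k. L j) * (\<Prod>j=Suc k..d. L j)"
    unfolding N_def num_leaves_def by (simp add: prod.union_disjoint)
  moreover have "1 \<le> (\<Prod>j=Suc k..d. L j)"
    using L_pos by (intro prod_ge_1) (simp add: Suc_leI)
  ultimately show ?thesis by simp
qed

lemma runs_levels:
  assumes s: "penv_of s" "reg s ''N'' = 1" "reg s ''l'' = 0" "reg s ''j'' = 1"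
    and post: "\<And>s'. same {''N'', ''l'', ''j''} {''E''} s s' \<Longrightarrow>
        reg s' ''N'' = N \<Longrightarrow> reg s' ''l'' = length levels \<Longrightarrow>
        (\<forall>i<length levels. arr s' ''E'' i = levels ! i) \<Longrightarrow> Post s'"
    and B: "(d + 1) * 50 \<le> B"
  shows "runs W \<rho> (Loop levels_guard levels_body) s B Post"
proof -
  let ?P = "\<lambda>k. filter (\<lambda>j. 1 < L j) [1..<Suc k]"
  define I where "I k s' \<longleftrightarrow> same {''N'', ''l'', ''j''} {''E''} s s' \<and>
    reg s' ''j'' = Suc k \<and> reg s' ''N'' = (\<Prod>j=1..k. L j) \<and> reg s' ''l'' = length (?P k) \<and>
    (\<forall>i<length (?P k). arr s' ''E'' i = ?P k ! i)" for k and s' :: state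
  have env: "penv_of s'" if "I k s'" for k s'
  proof (rule penv_agree[OF _ s(1)])
    show "same {''N'', ''l'', ''j''} {''E''} s s'"
      using that unfolding I_def by (rule conjunct1)
  qed simp_all
  have d2: "Suc d < 2 ^ W" using d_less_N N_le_p by (intro le_Q_less_word) simp
  have guard: "aval W \<rho> s' levels_guard = (if k < d then 1 else 0)" if "I k s'" "k \<le> d" for k s'
    using env[OF that(1)] that d2 W_pos by (simp add: I_def levels_guard_def penv_def const_mod)
  show ?thesis
  proof (rule runs_Loop[where I = I and n = d and ?B1.0 = 40])
    show "I 0 s" using s by (simp add: I_def)
    fix k s' assume k: "k < d" "I k s'"
    show "aval W \<rho> s' levels_guard \<noteq> 0" using guard[OF k(2)] k(1) by simp
    show "runs W \<rho> levels_body s' 40 (I (Suc k))"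
    proof (rule runs_straight)
      have Lk: "arr s' ''L'' (Suc k) = L (Suc k)" using env[OF k(2)] k(1) by (simp add: penv_def)
      have pos: "0 < L (Suc k)" using k(1) L_pos by simp
      have 1: "(\<Prod>j=1..k. L j) * L (Suc k) < 2 ^ W"
        using prod_L_le[of "Suc k"] k(1) N_le_p by (intro le_Q_less_word) simp
      have "length (?P k) \<le> k" using length_filter_le[of "\<lambda>j. 1 < L j" "[1..<Suc k]"] by (simp del: upt_Suc)
      then have 2: "Suc (length (?P k)) < 2 ^ W" "Suc (Suc k) < 2 ^ W" using d2 k(1) by (auto simp del: upt_Suc)
      have P: "?P (Suc k) = (if 1 < L (Suc k) then ?P k @ [Suc k] else ?P k)"
        by simp
      have I: "same {''N'', ''l'', ''j''} {''E''} s s'" "reg s' ''j'' = Suc k"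
        "reg s' ''N'' = (\<Prod>j=1..k. L j)" "reg s' ''l'' = length (?P k)"
        "\<forall>i<length (?P k). arr s' ''E'' i = ?P k ! i"
        using k(2) unfolding I_def by blast+
      show "I (Suc k) (sem W \<rho> levels_body s')"
      proof (cases "1 < L (Suc k)")
        case True
        then show ?thesis
          unfolding I_def P levels_body_def using I Lk 1 2 W_pos
          by (simp add: const_mod nth_append less_Suc_eq del: upt_Suc)
      next
        case False
        then have "L (Suc k) = 1" using pos by simp
        then show ?thesis
          unfolding I_def P levels_body_def using I Lk 1 2 W_pos
          by (simp add: const_mod del: upt_Suc)
      qed
    qed (simp_all add: levels_body_def)
  next
    fix s' assume I: "I d s'"
    show "aval W \<rho> s' levels_guard = 0" using guard[OF I] by simp
    show "Post s'"
      using I unfolding I_def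
      by (intro post) (auto simp: N_def num_leaves_def levels_def simp del: upt_Suc)
  qed (use B in \<open>simp add: levels_guard_def\<close>)
qed

text \<open>Minimality of \<open>clog\<close> gives \<open>2 ^ k \<le> p\<close> one step
  earlier.\<close>

lemma clog_p_le: "2 ^ clog (p + 1) \<le> 2 * p"
proof -
  obtain k where k: "clog (p + 1) = Suc k"
    using clog_le_iff[of "p + 1" 0] p_ge_256 by (cases "clog (p + 1)") auto
  have "\<not> clog (p + 1) \<le> k" using k by simp
  then have "2 ^ k < p + 1" by (simp add: clog_le_iff)
  then show ?thesis unfolding k by simp
qed

lemma clog_p_le_p: "clog (p + 1) \<le> p"
proof -
  have "p < 2 ^ p" by (rule less_exp)
  then show ?thesis unfolding clog_le_iff by linarith
qed

lemma sizes_less: "width < 2 ^ W" "thr < 2 ^ W" "nrep < 2 ^ W" "ncell < 2 ^ W" "nbit < 2 ^ W"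
proof -
  have Q: "256 \<le> Q" using p_ge_256 by simp
  have c: "ncell \<le> 4 * Q * Q"
    unfolding ncell_def using nrep_le kap0_le N_le_p by (intro mult_mono) auto
  have w: "width \<le> 3 * Q" using clog_p_le_p by (simp add: width_def)
  have "nbit \<le> 3 * (4 * Q * Q) * (3 * Q)"
    unfolding nbit_def using c w by (intro mult_mono) auto
  also have "\<dots> = 36 * (Q * Q * Q)" by (simp only: mult_ac)
  also have "\<dots> \<le> Q * (Q * Q * Q)"
    using Q by (intro mult_right_mono) auto
  also have "\<dots> = Q ^ 4" by (simp add: numeral_eq_Suc)
  finally show "nbit < 2 ^ W" using Q_pow_le[of 4] by (intro less_word) simp
  have "4 * Q * Q \<le> Q * Q * Q" using Q by (intro mult_right_mono) auto
  then have "ncell \<le> Q ^ 3" unfolding power3_eq_cube by (rule le_trans[OF c])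
  then show "ncell < 2 ^ W" using Q_pow_le[of 3] by (intro less_word) simp
  have Q2: "4 * Q \<le> Q ^ 2" unfolding power2_eq_square using Q by (intro mult_right_mono) auto
  then show "nrep < 2 ^ W" using nrep_le Q_pow_le[of 2] by (intro less_word) simp
  show "width < 2 ^ W" using w Q2 Q_pow_le[of 2] by (intro less_word) simp
  show "thr < 2 ^ W" using thr_le by (rule le_Q_less_word)
qed

lemma runs_prepare:
  fixes s :: state
  assumes s: "penv_of s"
    and post: "\<And>s'. same {''N'', ''l'', ''j'', ''g'', ''m'', ''z'', ''q'', ''Y'', ''H''} {''E''} s s' \<Longrightarrow> env_of s' \<Longrightarrow> Post s'"
    and B: "50 * (d + clog N + clog (p + 1)) + 200 \<le> B"
  shows "runs W \<rho> prepare s B Post"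
  unfolding prepare_def
proof (rule runs_Seq[where ?B1.0 = 10 and P = "\<lambda>s'. same {''N'', ''l'', ''j''} {''E''} s s' \<and>
    reg s' ''N'' = 1 \<and> reg s' ''l'' = 0 \<and> reg s' ''j'' = 1"])
  show "runs W \<rho> (block [Assign ''N'' (Const 1), Assign ''l'' (Const 0), Assign ''j'' (Const 1)]) s 10
     (\<lambda>s'. same {''N'', ''l'', ''j''} {''E''} s s' \<and>
        reg s' ''N'' = 1 \<and> reg s' ''l'' = 0 \<and> reg s' ''j'' = 1)"
    using W_pos by (intro runs_straight) (simp_all add: const_mod)
next
  fix s1 :: state assume 1: "same {''N'', ''l'', ''j''} {''E''} s s1 \<and>
     reg s1 ''N'' = 1 \<and> reg s1 ''l'' = 0 \<and> reg s1 ''j'' = 1"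
  have p1: "penv_of s1" by (rule penv_agree[OF conjunct1[OF 1] s]) auto
  show "runs W \<rho> (Seq (Loop levels_guard levels_body)
    (Seq (block [Assign ''g'' (Const 0), Assign ''m'' (Const 0)])
    (Seq (clog_loop ''g'' (Reg ''N''))
    (Seq (clog_loop ''m'' (Bin Add (Reg ''p'') (Const 1)))
    sizes)))) s1 (50 * (d + clog N + clog (p + 1)) + 190) Post"
  proof (rule runs_Seq[where P = "\<lambda>s2. same {''N'', ''l'', ''j''} {''E''} s1 s2 \<and>
      reg s2 ''N'' = N \<and> reg s2 ''l'' = length levels \<and> (\<forall>i<length levels. arr s2 ''E'' i = levels ! i)"
      and ?B1.0 = "(d + 1) * 50" and ?B2.0 = "50 * (clog N + clog (p + 1)) + 140"], rule runs_levels)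
    fix s2 :: state
    assume 2: "same {''N'', ''l'', ''j''} {''E''} s1 s2 \<and>
      reg s2 ''N'' = N \<and> reg s2 ''l'' = length levels \<and> (\<forall>i<length levels. arr s2 ''E'' i = levels ! i)"
    have a2: "same {''N'', ''l'', ''j'', ''g'', ''m'', ''z'', ''q'', ''Y'', ''H''} {''E''} s s2"
      by (rule agree_trans[OF conjunct1[OF 1] conjunct1[OF 2]]) auto
    have p2: "penv_of s2" by (rule penv_agree[OF conjunct1[OF 2] p1]) auto
    let ?R = "\<lambda>s3. same {''g'', ''m''} {} s2 s3 \<and> reg s3 ''g'' = 0 \<and> reg s3 ''m'' = 0"
    show "runs W \<rho> (Seq (block [Assign ''g'' (Const 0), Assign ''m'' (Const 0)])
      (Seq (clog_loop ''g'' (Reg ''N'')) (Seq (clog_loop ''m'' (Bin Add (Reg ''p'') (Const 1))) sizes))) s2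
        (50 * (clog N + clog (p + 1)) + 140) Post"
    proof (rule runs_Seq[where P = ?R and ?B1.0 = 10 and ?B2.0 = "50 * (clog N + clog (p + 1)) + 130"])
      show "runs W \<rho> (block [Assign ''g'' (Const 0), Assign ''m'' (Const 0)]) s2 10 ?R"
        by (rule runs_straight) simp_all
    next
      fix s3 :: state assume 3: "?R s3"
      show "runs W \<rho> (Seq (clog_loop ''g'' (Reg ''N'')) (Seq (clog_loop ''m'' (Bin Add (Reg ''p'') (Const 1))) sizes)) s3
        (50 * (clog N + clog (p + 1)) + 130) Post"
      proof (rule runs_Seq[where P = "\<lambda>s4. same {''g''} {} s3 s4 \<and> reg s4 ''g'' = clog N"
            and ?B1.0 = "(clog N + 1) * 30" and ?B2.0 = "50 * clog (p + 1) + 100"], rule runs_clog_loop[where n = N])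
        show "reg s3 ''g'' = 0" using 3 by simp
        show "2 ^ clog N < (2::nat) ^ W" using N_pow N_le_p le_Q_less_word[of N] by simp
        show "aval W \<rho> s' (Reg ''N'') = N" if "same {''g''} {} s3 s'" for s'
          using agree_regD[OF that, of "''N''"] agree_regD[OF conjunct1[OF 3], of "''N''"] 2 by simp
      next
        fix s4 :: state assume 4: "same {''g''} {} s3 s4 \<and> reg s4 ''g'' = clog N"
        have a4: "same {''g'', ''m''} {} s2 s4"
          by (rule agree_trans[OF conjunct1[OF 3] conjunct1[OF 4]]) auto
        have m4: "reg s4 ''m'' = 0" using agree_regD[OF conjunct1[OF 4], of "''m''"] 3 by simp
        show "runs W \<rho> (Seq (clog_loop ''m'' (Bin Add (Reg ''p'') (Const 1))) sizes) s4
          (50 * clog (p + 1) + 100) Post"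
        proof (rule runs_Seq[where P = "\<lambda>s5. same {''m''} {} s4 s5 \<and> reg s5 ''m'' = clog (p + 1)"
            and ?B1.0 = "(clog (p + 1) + 1) * 30" and ?B2.0 = 50], rule runs_clog_loop[where n = "p + 1"])
          show "reg s4 ''m'' = 0" by fact
          have "2 * p \<le> Q * Q" using p_ge_256 by (intro mult_mono) auto
          then have "2 ^ clog (p + 1) \<le> Q ^ 2" unfolding power2_eq_square using clog_p_le by (rule le_trans[rotated])
          from less_word[OF le_trans[OF this Q_pow_le]] show "2 ^ clog (p + 1) < (2::nat) ^ W" by simp
          have pw: "p + 1 < 2 ^ W" using d_pos by (intro le_Q_less_word) simp
          show "aval W \<rho> s' (Bin Add (Reg ''p'') (Const 1)) = p + 1"
            if "same {''m''} {} s4 s'" for s'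
            using agree_regD[OF that, of "''p''"] agree_regD[OF a4, of "''p''"] p2 pw W_pos
            by (simp add: penv_def const_mod)
        next
          fix s5 :: state assume 5: "same {''m''} {} s4 s5 \<and> reg s5 ''m'' = clog (p + 1)"
          have a5: "same {''g'', ''m''} {} s2 s5"
            by (rule agree_trans[OF a4 conjunct1[OF 5]]) auto
          have a5': "same {''N'', ''l'', ''j'', ''g'', ''m'', ''z'', ''q'', ''Y'', ''H''} {''E''} s s5"
            by (rule agree_trans[OF a2 a5]) auto
          have p5: "penv_of s5" by (rule penv_agree[OF a5 p2]) auto
          have g5: "reg s5 ''g'' = clog N" "reg s5 ''N'' = N" "reg s5 ''l'' = length levels"
            "arr s5 ''E'' = arr s2 ''E''"
            using agree_regD[OF conjunct1[OF 5], of "''g''"] 4 agree_regD[OF a5, of "''N''"] agree_regD[OF a5, of "''l''"] 2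
              agree_arrD[OF a5, of "''E''"] by auto
          show "runs W \<rho> sizes s5 50 Post"
          proof (rule runs_straight)
            let ?s6 = "sem W \<rho> sizes s5"
            have z: "3 * clog (Suc p) mod 2 ^ W = width" "Suc (t + clog N) mod 2 ^ W = thr"
              "4 * thr mod 2 ^ W = nrep" "nrep * \<kappa> 0 mod 2 ^ W = ncell" "3 * ncell * width mod 2 ^ W = nbit"
              using sizes_less by (simp_all add: thr_def nrep_def ncell_def width_def nbit_def)
            have f5: "reg s5 ''t'' = t" "arr s5 ''kappa'' 0 = \<kappa> 0" "reg s5 ''m'' = clog (Suc p)"
              using p5 5 by (simp_all add: penv_def)
            have r6: "reg ?s6 ''m'' = width" "reg ?s6 ''z'' = thr" "reg ?s6 ''q'' = nrep" "reg ?s6 ''Y'' = ncell"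
              "reg ?s6 ''H'' = nbit"
              using W_pos by (simp_all add: sizes_def const_mod mod_simps f5 g5 z)
            have a6: "same {''m'', ''z'', ''q'', ''Y'', ''H''} {} s5 ?s6"
              by (simp add: sizes_def)
            have p6: "penv_of ?s6" by (rule penv_agree[OF a6 p5]) auto
            have "env_of ?s6"
              using p6 r6 g5 2 agree_regD[OF a6, of "''N''"] agree_regD[OF a6, of "''l''"]
                agree_arrD[OF a6, of "''E''"] by (simp add: env_def)
            moreover have "same {''N'', ''l'', ''j'', ''g'', ''m'', ''z'', ''q'', ''Y'', ''H''} {''E''} s ?s6"
              by (rule agree_trans[OF a5' a6]) auto
            ultimately show "Post ?s6" by (intro post)
          qed (simp_all add: sizes_def)
        qed simp_all
      qed simp_all
    qed simp
  qed (use p1 1 in simp_all)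
qed (use B in simp)

end

section \<open>Sketching\<close>

definition items_loop :: "name \<Rightarrow> exp \<Rightarrow> exp \<Rightarrow> com" where
  "items_loop cnt xe ve = Loop (Bin Less (Reg ''i'') (Reg cnt))
     (Seq (block [Assign ''x'' xe, Assign ''v'' ve])
     (Seq element_loop (Assign ''i'' (Bin Add (Reg ''i'') (Const 1)))))"

definition put_body :: com where
  "put_body = block
     [Store ''out'' (Reg ''x'') (Bin BAnd (Bin Shr (Elem ''S'' (Bin Div (Reg ''x'') (Reg ''m'')))
        (Bin Mod (Reg ''x'') (Reg ''m''))) (Const 1)),
      Assign ''x'' (Bin Add (Reg ''x'') (Const 1))]"

definition put_bits :: com where
  "put_bits = Seq (Assign ''x'' (Const 0))
    (Seq (Loop (Bin Less (Reg ''x'') (Reg ''H'')) put_body) (Assign ''n'' (Reg ''H'')))"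

definition sketch_with :: "name \<Rightarrow> exp \<Rightarrow> exp \<Rightarrow> com" where
  "sketch_with cnt xe ve =
     Cond (Bin Less (Bin Mul (Const 4) (Reg ''d'')) (Elem ''kappa'' (Const 0)))
       (Seq prepare (Seq (Assign ''i'' (Const 0)) (Seq (items_loop cnt xe ve) put_bits)))
       (Assign ''n'' (Const 0))"

context hmr
begin

text \<open>An equality rather than an implication, as undoing the update obeys the same frame
  condition.\<close>

lemma env_upd [simp]:
  "x \<notin> {''d'', ''p'', ''t'', ''N'', ''l'', ''m'', ''z'', ''q'', ''Y'', ''H''} \<Longrightarrow> env (f(x := v)) g = env f g"
  "a \<notin> {''L'', ''kappa'', ''E''} \<Longrightarrow> env f (g(a := h)) = env f g"
proof -
  assume x: "x \<notin> {''d'', ''p'', ''t'', ''N'', ''l'', ''m'', ''z'', ''q'', ''Y'', ''H''}"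
  have 1: "agree {x} {} f g (f(x := v)) g" and 2: "agree {x} {} (f(x := v)) g f g"
    by (auto simp: agree_def)
  have "y \<notin> {x}" if "x \<notin> X" "y \<in> X" for y and X :: "name set"
    using that by blast
  from this[OF x]
  have 3: "\<forall>y\<in>{''d'', ''p'', ''t'', ''N'', ''l'', ''m'', ''z'', ''q'', ''Y'', ''H''}. y \<notin> {x}"
    by (rule ballI)
  show "env (f(x := v)) g = env f g"
    using env_agree[OF 1 _ 3] env_agree[OF 2 _ 3] by (simp only: ball_simps empty_iff not_False_eq_True) blast
next
  assume a: "a \<notin> {''L'', ''kappa'', ''E''}"
  have 1: "agree {} {a} f g f (g(a := h))" and 2: "agree {} {a} f (g(a := h)) f g"
    by (auto simp: agree_def)
  have "b \<notin> {a}" if "a \<notin> X" "b \<in> X" for b and X :: "name set"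
    using that by blast
  from this[OF a]
  have 3: "\<forall>b\<in>{''L'', ''kappa'', ''E''}. b \<notin> {a}"
    by (rule ballI)
  show "env f (g(a := h)) = env f g"
    using env_agree[OF 1 _ _ 3] env_agree[OF 2 _ _ 3] by (simp only: ball_simps empty_iff not_False_eq_True) blast
qed

lemma envD:
  assumes "env f g"
  shows "f ''d'' = d" "f ''p'' = p" "f ''N'' = N" "f ''l'' = length levels" "f ''m'' = width" "f ''z'' = thr"
    "f ''q'' = nrep" "f ''Y'' = ncell" "f ''H'' = nbit"
    "g ''kappa'' 0 = \<kappa> 0" "j \<le> d \<Longrightarrow> g ''kappa'' j = \<kappa> j" "1 \<le> j \<Longrightarrow> j \<le> d \<Longrightarrow> g ''L'' j = L j"
    "i < length levels \<Longrightarrow> g ''E'' i = levels ! i"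
  using assms by (simp_all add: env_def penv_def)

lemma N_less_word: "N < 2 ^ W" using N_le_p by (intro le_Q_less_word) simp

lemma less_N_word: "x \<le> N \<Longrightarrow> x < 2 ^ W" using N_less_word by simp

text \<open>Sums and products commute with reduction modulo \<open>2 ^ W\<close>, so wrapping in
  between is harmless as soon as the final address fits in a word.\<close>

lemma aval_addr_exp:
  assumes "env_of s" "reg s ''r'' < nrep" "arr s ''E'' (reg s ''j'') \<le> d"
    "reg s ''k'' < N" "reg s ''b'' < N"
  shows "aval W \<rho> s addr_exp = addr (reg s ''r'') (arr s ''E'' (reg s ''j'')) (reg s ''k'') (reg s ''b'')"
proof -
  have "aval W \<rho> s addr_exp
      = addr (reg s ''r'') (arr s ''E'' (reg s ''j'')) (reg s ''k'') (reg s ''b'') mod 2 ^ W"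
    using W_pos by (simp add: addr_exp_def addr_def envD[OF assms(1)] const_mod mod_simps)
  then show ?thesis using addr_less[OF assms(2-5)] by simp
qed

lemma aval_fp_exp:
  assumes "env_of s" "reg s ''r'' < nrep" "reg s ''x'' < N"
  shows "aval W \<rho> s fp_exp = fp \<rho> (reg s ''r'') (reg s ''x'')"
proof -
  let ?a = "Bin Mul (Bin Add (Bin Mul (Bin Mul (Reg ''r'') (Bin Add (Reg ''d'') (Const 1))) (Reg ''N''))
    (Reg ''x'')) (Reg ''N'')"
  have "aval W \<rho> s ?a = addr (reg s ''r'') 0 (reg s ''x'') 0 mod 2 ^ W"
    using W_pos by (simp add: addr_def envD[OF assms(1)] const_mod mod_simps)
  then have a: "aval W \<rho> s ?a = addr (reg s ''r'') 0 (reg s ''x'') 0"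
    using addr_less[of "reg s ''r''" 0 "reg s ''x''" 0] assms N_pos by simp
  have "64 * N \<le> Q * Q" using p_ge_256 N_le_p by (intro mult_mono) auto
  then have "64 * N \<le> Q ^ 2" by (simp only: power2_eq_square)
  from less_word[OF le_trans[OF this Q_pow_le]] have m: "64 * N < 2 ^ W" by simp
  have "fp \<rho> (reg s ''r'') (reg s ''x'') < 64 * N" unfolding fp_def using N_pos by simp
  then have f: "fp \<rho> (reg s ''r'') (reg s ''x'') < 2 ^ W" using m by simp
  have n: "aval W \<rho> s (Bin Mul (Const 64) (Reg ''N'')) = 64 * N"
    using m envD(3)[OF assms(1)] by (simp add: const_mod)
  have "aval W \<rho> s fp_exp = \<rho> (aval W \<rho> s ?a) mod aval W \<rho> s (Bin Mul (Const 64) (Reg ''N'')) mod 2 ^ W"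
    unfolding fp_exp_def aval.simps bop_val.simps ..
  also have "\<dots> = fp \<rho> (reg s ''r'') (reg s ''x'') mod 2 ^ W" unfolding a n fp_def ..
  finally show ?thesis using f by simp
qed

lemma hash_step:
  fixes s :: state and \<rho> :: "nat \<Rightarrow> nat"
  assumes e: "env_of s" and j: "reg s ''j'' = Suc j" "j < length levels"
    and r: "reg s ''r'' < nrep" and kb: "reg s ''k'' < N" "reg s ''b'' < N"
  defines "s' \<equiv> sem W \<rho> hash_body s"
  shows "same {''j'', ''b'', ''k''} {} s s'" "reg s' ''j'' = j"
    "(reg s' ''k'', reg s' ''b'') = step \<rho> (reg s ''r'') (levels ! j) (reg s ''k'', reg s ''b'')"
    "reg s' ''k'' < N" "reg s' ''b'' < N"
proof -
  let ?e = "levels ! j"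
  have l: "1 \<le> ?e" "?e \<le> d" "1 < L ?e" using levels_mem[OF j(2)] by auto
  have jw: "j mod 2 ^ W = j"
    using j(2) length_levels_le clog_le_self[of N] by (intro mod_less less_N_word) simp
  have ew: "(?e - 1) mod 2 ^ W = ?e - 1" "(?e - Suc 0) mod 2 ^ W = ?e - Suc 0"
    using l d_less_N by (auto intro!: mod_less less_N_word)
  define s1 where "s1 = s\<lparr>reg := (reg s)(''j'' := j)\<rparr>"
  have s1: "sem W \<rho> (Assign ''j'' (Bin Sub (Reg ''j'') (Const 1))) s = s1"
    using W_pos j jw by (simp add: s1_def const_mod)
  have env1: "env_of s1" using e by (simp add: s1_def)
  have E1: "arr s1 ''E'' (reg s1 ''j'') = ?e" using envD(13)[OF env1 j(2)] by (simp add: s1_def)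
  define b' where "b' = \<rho> (addr (reg s ''r'') ?e (reg s ''k'') (reg s ''b'')) mod \<kappa> (?e - 1)"
  have "b' < \<kappa> (?e - 1)" unfolding b'_def using kap_pos[of "?e - 1"] l by simp
  also have "\<dots> \<le> N" using l by (intro kap_le) simp
  finally have b': "b' < N" .
  have a1: "aval W \<rho> s1 addr_exp = addr (reg s ''r'') ?e (reg s ''k'') (reg s ''b'')"
    using aval_addr_exp[OF env1] E1 r kb l by (simp add: s1_def)
  have k1: "arr s1 ''kappa'' (?e - Suc 0) = \<kappa> (?e - Suc 0)" using envD(11)[OF env1, of "?e - Suc 0"] l by simp
  define s2 where "s2 = s1\<lparr>reg := (reg s1)(''b'' := b')\<rparr>"
  have s2: "sem W \<rho> (Assign ''b'' (Bin Mod (Rnd addr_exp) (Elem ''kappa'' (Bin Sub (Elem ''E'' (Reg ''j'')) (Const 1))))) s1 = s2"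
    using W_pos b' less_N_word[of b'] E1 k1 by (simp add: s2_def a1 const_mod ew b'_def)
  define k' where "k' = reg s ''k'' div L ?e"
  have k': "k' < N" unfolding k'_def using kb(1) by (meson div_le_dividend le_less_trans)
  have L2: "arr s2 ''L'' ?e = L ?e" "arr s2 ''E'' (reg s2 ''j'') = ?e" "reg s2 ''k'' = reg s ''k''"
    using envD(12)[OF env1 l(1,2)] E1 by (simp_all add: s2_def s1_def)
  have s3: "s' = s2\<lparr>reg := (reg s2)(''k'' := k')\<rparr>"
    unfolding s'_def hash_body_def block.simps sem.simps(4) s1 s2
    using k' less_N_word[of k'] L2 by (simp add: k'_def)
  show "same {''j'', ''b'', ''k''} {} s s'" "reg s' ''j'' = j"
    "reg s' ''k'' < N" "reg s' ''b'' < N"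
    "(reg s' ''k'', reg s' ''b'') = step \<rho> (reg s ''r'') (levels ! j) (reg s ''k'', reg s ''b'')"
    using k' b' l by (simp_all add: s3 s2_def s1_def step_def k'_def b'_def)
qed

lemma contrib_at:
  assumes "b < \<kappa> 0" "f < 3"
  shows "contrib \<rho> (3 * (r * \<kappa> 0 + b) + f) x v = (if bucket \<rho> r x = b then wt \<rho> f r x v else 0)"
proof -
  let ?c = "3 * (r * \<kappa> 0 + b) + f"
  have c: "?c div 3 = r * \<kappa> 0 + b" "?c mod 3 = f" using div_mod_3[OF assms(2)] by blast+
  have y: "(r * \<kappa> 0 + b) div \<kappa> 0 = r" "(r * \<kappa> 0 + b) mod \<kappa> 0 = b" using assms(1) by auto
  show ?thesis unfolding contrib_def c y Let_def by simp
qed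

text \<open>Within repetition \<open>r\<close> the leaf contributes only to the three cells of its
  bucket. Updating them therefore adds its contribution to the whole row, which lets the rows of the
  repetitions accumulate.\<close>

lemma contrib_row:
  fixes S :: "nat \<Rightarrow> nat"
  assumes "\<And>f. f < 3 \<Longrightarrow> S' (3 * (r * \<kappa> 0 + bucket \<rho> r x) + f) = S (3 * (r * \<kappa> 0 + bucket \<rho> r x) + f) + wt \<rho> f r x v"
    and "\<And>z. z div 3 \<noteq> r * \<kappa> 0 + bucket \<rho> r x \<Longrightarrow> S' z = S z"
  shows "S' z = S z + (if z div 3 div \<kappa> 0 = r then contrib \<rho> z x v else 0)"
proof (cases "z div 3 = r * \<kappa> 0 + bucket \<rho> r x")
  case True
  have z: "z = 3 * (r * \<kappa> 0 + bucket \<rho> r x) + z mod 3" using True by (metis mult_div_mod_eq)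
  have "z div 3 div \<kappa> 0 = r" using True bucket_less[of \<rho> r x] by simp
  moreover have "contrib \<rho> z x v = wt \<rho> (z mod 3) r x v"
    by (subst z, subst contrib_at) (use bucket_less in auto)
  moreover have "S' z = S z + wt \<rho> (z mod 3) r x v"
    using assms(1)[of "z mod 3"] z[symmetric] by simp
  ultimately show ?thesis by simp
next
  case False
  have "contrib \<rho> z x v = 0" if "z div 3 div \<kappa> 0 = r"
  proof -
    have "bucket \<rho> r x \<noteq> z div 3 mod \<kappa> 0" using False that by (metis div_mult_mod_eq)
    then show ?thesis using that by (simp add: contrib_def Let_def)
  qed
  then show ?thesis using assms(2)[OF False] by simp
qed

lemma bump_step:
  fixes s :: state and \<rho> :: "nat \<Rightarrow> nat"
  assumes e: "env_of s" and r: "reg s ''r'' < nrep" and x: "reg s ''x'' < N"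
    and b: "reg s ''b'' = bucket \<rho> (reg s ''r'') (reg s ''x'')"
    and bound: "\<And>z. arr s ''S'' z + contrib \<rho> z (reg s ''x'') (reg s ''v'') < 2 ^ W"
  defines "s' \<equiv> sem W \<rho> bump s"
  shows "same {''y'', ''r''} {''S''} s s'" "reg s' ''r'' = Suc (reg s ''r'')"
    "arr s' ''S'' z = arr s ''S'' z +
       (if z div 3 div \<kappa> 0 = reg s ''r'' then contrib \<rho> z (reg s ''x'') (reg s ''v'') else 0)"
proof -
  let ?r = "reg s ''r''" and ?x = "reg s ''x''" and ?v = "reg s ''v''" and ?S = "arr s ''S''"
  define y where "y = 3 * (?r * \<kappa> 0 + reg s ''b'')"
  have bl: "reg s ''b'' < \<kappa> 0" using b bucket_less by simp
  have "?r * \<kappa> 0 + reg s ''b'' < ncell" unfolding ncell_def using r bl by (rule mixed_radix_less)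
  then have y3: "y + 3 \<le> 3 * ncell" by (simp add: y_def)
  have "3 * ncell * 1 \<le> 3 * ncell * width"
    using clog_le_iff[of "p + 1" 0] p_ge_256 by (intro mult_left_mono) (auto simp: width_def)
  then have "3 * ncell < 2 ^ W" using sizes_less(5) unfolding nbit_def by linarith
  then have yw: "y mod 2 ^ W = y" "Suc y mod 2 ^ W = Suc y" "Suc (Suc y) mod 2 ^ W = Suc (Suc y)"
    using y3 by auto
  have rw: "Suc ?r mod 2 ^ W = Suc ?r" using r sizes_less(3) by simp
  have con: "contrib \<rho> (y + f) ?x ?v = wt \<rho> f ?r ?x ?v" if "f < 3" for f
    unfolding y_def using contrib_at[OF bl that] b by simp
  have w: "(?S y + ?v) mod 2 ^ W = ?S y + ?v"
    "(?S (Suc y) + (?x * (2 * p) + ?v) * ?v) mod 2 ^ W = ?S (Suc y) + (?x * (2 * p) + ?v) * ?v"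
    "(?S (Suc (Suc y)) + fp \<rho> ?r ?x * ?v) mod 2 ^ W = ?S (Suc (Suc y)) + fp \<rho> ?r ?x * ?v"
    using bound[of y] bound[of "Suc y"] bound[of "Suc (Suc y)"] con[of 0] con[of 1] con[of 2]
    by (simp_all add: wt_def)
  have yv: "aval W \<rho> s (Bin Mul (Const 3) (Bin Add (Bin Mul (Reg ''r'') (Elem ''kappa'' (Const 0))) (Reg ''b''))) = y"
    using yw(1) by (simp add: y_def envD[OF e] const_mod mod_simps)
  define s1 where "s1 = s\<lparr>reg := (reg s)(''y'' := y)\<rparr>"
  have s1: "sem W \<rho> (Assign ''y'' (Bin Mul (Const 3) (Bin Add (Bin Mul (Reg ''r'') (Elem ''kappa'' (Const 0))) (Reg ''b'')))) s = s1"
    unfolding sem.simps yv s1_def ..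
  define s5 where "s5 = s\<lparr>reg := (reg s)(''y'' := Suc (Suc y)), arr := (arr s)(''S'' :=
    (?S)(y := ?S y + ?v, Suc y := ?S (Suc y) + (?x * (2 * p) + ?v) * ?v))\<rparr>"
  have s5: "sem W \<rho> (block [Store ''S'' (Reg ''y'') (Bin Add (Elem ''S'' (Reg ''y'')) (Reg ''v'')),
      Assign ''y'' (Bin Add (Reg ''y'') (Const 1)),
      Store ''S'' (Reg ''y'') (Bin Add (Elem ''S'' (Reg ''y''))
        (Bin Mul (Bin Add (Bin Mul (Reg ''x'') (Bin Mul (Const 2) (Reg ''p''))) (Reg ''v'')) (Reg ''v''))),
      Assign ''y'' (Bin Add (Reg ''y'') (Const 1))]) s1 = s5"
    using W_pos by (simp add: s1_def s5_def envD[OF e] const_mod mod_simps yw w)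
  have env5: "env_of s5" using e by (simp add: s5_def)
  have f5: "aval W \<rho> s5 fp_exp = fp \<rho> ?r ?x"
    using aval_fp_exp[OF env5] r x by (simp add: s5_def)
  have s': "s' = s5\<lparr>reg := (reg s)(''y'' := Suc (Suc y), ''r'' := Suc ?r), arr := (arr s5)(''S'' :=
      (arr s5 ''S'')(Suc (Suc y) := ?S (Suc (Suc y)) + fp \<rho> ?r ?x * ?v))\<rparr>"
  proof -
    have "s' = sem W \<rho> (block [Store ''S'' (Reg ''y'') (Bin Add (Elem ''S'' (Reg ''y'')) (Bin Mul fp_exp (Reg ''v''))),
      Assign ''r'' (Bin Add (Reg ''r'') (Const 1))]) s5"
      unfolding s'_def bump_def s5[symmetric] s1[symmetric] block.simps sem.simps(1,4) ..
    also have "\<dots> = s5\<lparr>reg := (reg s)(''y'' := Suc (Suc y), ''r'' := Suc ?r), arr := (arr s5)(''S'' :=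
      (arr s5 ''S'')(Suc (Suc y) := ?S (Suc (Suc y)) + fp \<rho> ?r ?x * ?v))\<rparr>"
      using W_pos f5 by (simp add: const_mod mod_simps rw w) (simp add: s5_def rw w)
    finally show ?thesis .
  qed
  show "same {''y'', ''r''} {''S''} s s'" "reg s' ''r'' = Suc (reg s ''r'')"
    by (simp_all add: s' s5_def)
  have S': "arr s' ''S'' = ?S(y := ?S y + ?v, Suc y := ?S (Suc y) + (?x * (2 * p) + ?v) * ?v,
      Suc (Suc y) := ?S (Suc (Suc y)) + fp \<rho> ?r ?x * ?v)"
    by (simp add: s' s5_def)
  show "arr s' ''S'' z = ?S z + (if z div 3 div \<kappa> 0 = ?r then contrib \<rho> z ?x ?v else 0)"
  proof (rule contrib_row)
    show "arr s' ''S'' (3 * (?r * \<kappa> 0 + bucket \<rho> ?r ?x) + f)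
        = ?S (3 * (?r * \<kappa> 0 + bucket \<rho> ?r ?x) + f) + wt \<rho> f ?r ?x ?v" if "f < 3" for f
      unfolding b[symmetric] y_def[symmetric] S' using that by (auto simp: wt_def less_Suc_eq numeral_3_eq_3)
    show "arr s' ''S'' z = ?S z" if "z div 3 \<noteq> ?r * \<kappa> 0 + bucket \<rho> ?r ?x" for z
      unfolding S' using that b y_def by (auto split: if_splits)
  qed
qed


text \<open>After \<open>k\<close> rounds the registers hold the fold over the last \<open>k\<close>
  listed levels, taken from the bottom; \<open>st_levels\<close> identifies the final fold with the
  root bucket.\<close>

lemma runs_hash_loop:
  fixes s :: state and \<rho> :: "nat \<Rightarrow> nat"
  assumes e: "env_of s" and r: "reg s ''r'' < nrep" and x: "x < N"
    and s: "reg s ''k'' = x" "reg s ''b'' = 0" "reg s ''j'' = length levels"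
    and post: "\<And>s'. same {''j'', ''b'', ''k''} {} s s' \<Longrightarrow>
      reg s' ''b'' = bucket \<rho> (reg s ''r'') x \<Longrightarrow> Post s'"
    and B: "100 * (clog N + 1) \<le> B"
  shows "runs W \<rho> (Loop (Reg ''j'') hash_body) s B Post"
proof -
  let ?h = "length levels" and ?f = "\<lambda>k. fold (step \<rho> (reg s ''r'')) (take k (rev levels)) (x, 0)"
  define I where "I k s' \<longleftrightarrow> same {''j'', ''b'', ''k''} {} s s' \<and>
    reg s' ''j'' = ?h - k \<and> (reg s' ''k'', reg s' ''b'') = ?f k \<and> reg s' ''k'' < N \<and> reg s' ''b'' < N"
    for k and s' :: state
  show ?thesis
  proof (rule runs_Loop[where I = I and n = ?h and ?B1.0 = 60])
    show "I 0 s" using s x N_pos by (simp add: I_def)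
  next
    fix k s' assume k: "k < ?h" "I k s'"
    show "aval W \<rho> s' (Reg ''j'') \<noteq> 0" using k by (simp add: I_def)
    show "runs W \<rho> hash_body s' 60 (I (Suc k))"
    proof (rule runs_straight)
      let ?j = "?h - Suc k"
      have a: "same {''j'', ''b'', ''k''} {} s s'" using k(2) by (simp add: I_def)
      have e': "env_of s'" by (rule env_agree[OF a e]) auto
      have r': "reg s' ''r'' = reg s ''r''" by (rule agree_regD[OF a]) simp
      have j: "reg s' ''j'' = Suc ?j" "?j < ?h" using k by (auto simp: I_def)
      have kb: "reg s' ''k'' < N" "reg s' ''b'' < N" using k(2) by (auto simp: I_def)
      note h = hash_step[OF e' j r[folded r'] kb, of \<rho>]
      have "levels ! ?j = rev levels ! k" using k(1) by (simp add: rev_nth)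
      then have "?f (Suc k) = step \<rho> (reg s ''r'') (levels ! ?j) (?f k)"
        using k(1) by (simp add: take_Suc_conv_app_nth)
      then have "(reg (sem W \<rho> hash_body s') ''k'', reg (sem W \<rho> hash_body s') ''b'') = ?f (Suc k)"
        using h(3) k(2) r' by (simp add: I_def)
      moreover have "agree {''j'', ''b'', ''k''} {} (reg s) (arr s)
          (reg (sem W \<rho> hash_body s')) (arr (sem W \<rho> hash_body s'))"
        by (rule agree_trans[OF a h(1)]) auto
      ultimately show "I (Suc k) (sem W \<rho> hash_body s')" using h by (simp add: I_def)
    qed (simp_all add: hash_body_def addr_exp_def)
  next
    fix s' assume I: "I ?h s'"
    show "aval W \<rho> s' (Reg ''j'') = 0" using I by (simp add: I_def)
    have "?f ?h = st \<rho> (reg s ''r'') x d" by (simp add: st_levels)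
    then have "reg s' ''b'' = bucket \<rho> (reg s ''r'') x"
      using I unfolding I_def bucket_def by (metis snd_conv)
    then show "Post s'" using I by (intro post) (simp_all add: I_def)
  next
    show "?h * (1 + ecost (Reg ''j'') + 60) + (1 + ecost (Reg ''j'')) \<le> B"
      using B length_levels_le by simp
  qed
qed

lemma runs_element_body:
  fixes s :: state and \<rho> :: "nat \<Rightarrow> nat"
  assumes e: "env_of s" and r: "reg s ''r'' < nrep" and x: "reg s ''x'' < N"
    and bound: "\<And>z. arr s ''S'' z + contrib \<rho> z (reg s ''x'') (reg s ''v'') < 2 ^ W"
    and post: "\<And>s'. same {''r'', ''k'', ''b'', ''j'', ''y''} {''S''} s s' \<Longrightarrow>
      reg s' ''r'' = Suc (reg s ''r'') \<Longrightarrow>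
      (\<And>z. arr s' ''S'' z = arr s ''S'' z +
         (if z div 3 div \<kappa> 0 = reg s ''r'' then contrib \<rho> z (reg s ''x'') (reg s ''v'') else 0)) \<Longrightarrow> Post s'"
    and B: "100 * (clog N + 1) + 110 \<le> B"
  shows "runs W \<rho> element_body s B Post"
  unfolding element_body_def
proof (rule runs_Seq)
  let ?P = "\<lambda>s1 :: state. same {''k'', ''b'', ''j''} {} s s1 \<and>
      reg s1 ''k'' = reg s ''x'' \<and> reg s1 ''b'' = 0 \<and> reg s1 ''j'' = length levels"
  show "runs W \<rho> (block [Assign ''k'' (Reg ''x''), Assign ''b'' (Const 0), Assign ''j'' (Reg ''l'')]) s 10 ?P"
    by (rule runs_straight) (simp_all add: envD[OF e])
  fix s1 :: state assume 1: "?P s1"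
  note a1 = conjunct1[OF 1]
  have e1: "env_of s1" by (rule env_agree[OF a1 e]) auto
  have r1: "reg s1 ''r'' = reg s ''r''" by (rule agree_regD[OF a1]) simp
  show "runs W \<rho> (Seq (Loop (Reg ''j'') hash_body) bump) s1 (100 * (clog N + 1) + 100) Post"
  proof (rule runs_Seq[where ?B1.0 = "100 * (clog N + 1)"], rule runs_hash_loop[OF e1 _ x])
    fix s2 :: state
    let ?P2 = "\<lambda>s2 :: state. same {''j'', ''b'', ''k''} {} s1 s2 \<and>
      reg s2 ''b'' = bucket \<rho> (reg s1 ''r'') (reg s ''x'')"
    show "same {''j'', ''b'', ''k''} {} s1 s2 \<Longrightarrow>
      reg s2 ''b'' = bucket \<rho> (reg s1 ''r'') (reg s ''x'') \<Longrightarrow> ?P2 s2" by blast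
    assume 2: "?P2 s2"
    have a2: "same {''k'', ''b'', ''j''} {} s s2"
      by (rule agree_trans[OF a1 conjunct1[OF 2]]) auto
    have e2: "env_of s2" by (rule env_agree[OF a2 e]) auto
    have s2: "reg s2 ''r'' = reg s ''r''" "reg s2 ''x'' = reg s ''x''" "reg s2 ''v'' = reg s ''v''"
      "arr s2 ''S'' = arr s ''S''"
      by (rule agree_regD[OF a2] agree_arrD[OF a2], simp)+
    have b: "reg s2 ''b'' = bucket \<rho> (reg s2 ''r'') (reg s2 ''x'')" using 2 r1 s2 by simp
    show "runs W \<rho> bump s2 100 Post"
    proof (rule runs_straight)
      have bs: "arr s2 ''S'' z + contrib \<rho> z (reg s2 ''x'') (reg s2 ''v'') < 2 ^ W" for z
        using bound s2 by simp
      have rx: "reg s2 ''r'' < nrep" "reg s2 ''x'' < N" using r x s2 by auto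
      note b3 = bump_step[OF e2 rx b bs]
      have "agree {''r'', ''k'', ''b'', ''j'', ''y''} {''S''} (reg s) (arr s) (reg (sem W \<rho> bump s2)) (arr (sem W \<rho> bump s2))"
        by (rule agree_trans[OF a2 b3(1)]) auto
      then show "Post (sem W \<rho> bump s2)" using b3(2,3) by (intro post) (simp_all add: s2)
    qed (simp_all add: bump_def fp_exp_def)
  qed (use 1 r r1 in simp_all)
qed (use B in simp)

text \<open>The factor 2 in the bound: during the loop a cell may already contain its contribution,
  while \<open>runs_element_body\<close> asks for room for one more at every cell.\<close>

lemma runs_element_loop:
  fixes s :: state and \<rho> :: "nat \<Rightarrow> nat"
  assumes e: "env_of s" and x: "reg s ''x'' < N"
    and bound: "\<And>z. arr s ''S'' z + 2 * contrib \<rho> z (reg s ''x'') (reg s ''v'') < 2 ^ W"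
    and post: "\<And>s'. same {''r'', ''k'', ''b'', ''j'', ''y''} {''S''} s s' \<Longrightarrow>
      (\<And>z. arr s' ''S'' z = arr s ''S'' z +
         (if z div 3 div \<kappa> 0 < nrep then contrib \<rho> z (reg s ''x'') (reg s ''v'') else 0)) \<Longrightarrow> Post s'"
    and B: "300 * (nrep + 1) * (clog N + 1) \<le> B"
  shows "runs W \<rho> element_loop s B Post"
  unfolding element_loop_def
proof (rule runs_Seq)
  let ?P = "\<lambda>s1 :: state. same {''r''} {} s s1 \<and> reg s1 ''r'' = 0"
  let ?c = "\<lambda>z. contrib \<rho> z (reg s ''x'') (reg s ''v'')"
  show "runs W \<rho> (Assign ''r'' (Const 0)) s 2 ?P"
    by (rule runs_straight) simp_all
  fix s1 :: state assume 1: "?P s1"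
  define I where "I k s' \<longleftrightarrow> same {''r'', ''k'', ''b'', ''j'', ''y''} {''S''} s s' \<and>
    reg s' ''r'' = k \<and> (\<forall>z. arr s' ''S'' z = arr s ''S'' z + (if z div 3 div \<kappa> 0 < k then ?c z else 0))"
    for k and s' :: state
  have I_env: "env_of s'" "reg s' ''x'' = reg s ''x''" "reg s' ''v'' = reg s ''v''" if "I k s'" for k s'
  proof -
    have a: "same {''r'', ''k'', ''b'', ''j'', ''y''} {''S''} s s'"
      using that unfolding I_def by (rule conjunct1)
    show "env_of s'" by (rule env_agree[OF a e]) auto
    show "reg s' ''x'' = reg s ''x''" "reg s' ''v'' = reg s ''v''" by (rule agree_regD[OF a], simp)+
  qed
  show "runs W \<rho> (Loop (Bin Less (Reg ''r'') (Reg ''q'')) element_body) s1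
      (nrep * (1 + 3 + (100 * (clog N + 1) + 110)) + 4) Post"
  proof (rule runs_Loop[where I = I and n = nrep and ?B1.0 = "100 * (clog N + 1) + 110"])
    show "I 0 s1" unfolding I_def
      using 1 agree_trans[OF conjunct1[OF 1] agree_refl[of "{}" "{}"], of "{''r'', ''k'', ''b'', ''j'', ''y''}" "{''S''}"]
        agree_arrD[OF conjunct1[OF 1], of "''S''"] by simp
  next
    fix k s' assume k: "k < nrep" "I k s'"
    show "aval W \<rho> s' (Bin Less (Reg ''r'') (Reg ''q'')) \<noteq> 0"
      using k envD(7)[OF I_env(1)[OF k(2)]] W_pos by (simp add: I_def const_mod)
    show "runs W \<rho> element_body s' (100 * (clog N + 1) + 110) (I (Suc k))"
    proof (rule runs_element_body)
      show "env_of s'" using I_env(1)[OF k(2)] .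
      show "reg s' ''r'' < nrep" "reg s' ''x'' < N" using k x I_env[OF k(2)] by (auto simp: I_def)
      show "arr s' ''S'' z + contrib \<rho> z (reg s' ''x'') (reg s' ''v'') < 2 ^ W" for z
      proof -
        have "arr s' ''S'' z = arr s ''S'' z + (if z div 3 div \<kappa> 0 < k then ?c z else 0)"
          using k(2) unfolding I_def by blast
        also have "\<dots> \<le> arr s ''S'' z + ?c z" by simp
        finally have "arr s' ''S'' z + ?c z \<le> arr s ''S'' z + 2 * ?c z" by linarith
        then show ?thesis unfolding I_env(2,3)[OF k(2)] using bound[of z] by (rule le_less_trans)
      qed
      fix s2 :: state
      assume 2: "same {''r'', ''k'', ''b'', ''j'', ''y''} {''S''} s' s2"
        "reg s2 ''r'' = Suc (reg s' ''r'')"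
        "\<And>z. arr s2 ''S'' z = arr s' ''S'' z +
           (if z div 3 div \<kappa> 0 = reg s' ''r'' then contrib \<rho> z (reg s' ''x'') (reg s' ''v'') else 0)"
      have "same {''r'', ''k'', ''b'', ''j'', ''y''} {''S''} s s2"
        by (rule agree_trans[OF conjunct1[OF k(2)[unfolded I_def]] 2(1)]) auto
      moreover have "reg s2 ''r'' = Suc k" using 2(2) k(2) by (simp add: I_def)
      moreover have "arr s2 ''S'' z = arr s ''S'' z + (if z div 3 div \<kappa> 0 < Suc k then ?c z else 0)" for z
      proof -
        have "arr s' ''S'' z = arr s ''S'' z + (if z div 3 div \<kappa> 0 < k then ?c z else 0)" "reg s' ''r'' = k"
          using k(2) unfolding I_def by blast+
        then show ?thesis using 2(3)[of z] unfolding I_env(2,3)[OF k(2)]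
          by (cases "z div 3 div \<kappa> 0" k rule: linorder_cases) simp_all
      qed
      ultimately show "I (Suc k) s2" unfolding I_def by blast
    qed simp
  next
    fix s' assume I: "I nrep s'"
    show "aval W \<rho> s' (Bin Less (Reg ''r'') (Reg ''q'')) = 0"
      using I envD(7)[OF I_env(1)[OF I]] by (simp add: I_def)
    show "Post s'" using I by (intro post) (simp_all add: I_def)
  qed simp
next
  have "300 * (nrep + 1) * (clog N + 1) = 300 * nrep * clog N + 300 * nrep + 300 * clog N + 300"
    by (simp add: algebra_simps)
  moreover have "nrep * (1 + 3 + (100 * (clog N + 1) + 110)) + 4 = 100 * nrep * clog N + 214 * nrep + 4"
    by (simp add: algebra_simps)
  ultimately show "2 + (nrep * (1 + 3 + (100 * (clog N + 1) + 110)) + 4) \<le> B" using B by simp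
qed

\<comment> \<open>Accumulating all items and writing the sketch\<close>
end

abbreviation item_regs :: "name set" where
  "item_regs \<equiv> {''i'', ''x'', ''v'', ''r'', ''k'', ''b'', ''j'', ''y''}"

abbreviation prepare_regs :: "name set" where
  "prepare_regs \<equiv> {''N'', ''l'', ''j'', ''g'', ''m'', ''z'', ''q'', ''Y'', ''H''}"

context hmr
begin

text \<open>The case split describes the array \<open>S\<close> at every index: cells of repetitions
  from \<open>nrep\<close> on are never touched and stay 0.\<close>

definition item :: "(nat \<Rightarrow> nat) \<Rightarrow> nat \<Rightarrow> nat \<times> nat \<Rightarrow> nat" where
  "item \<rho> z a = (if z div 3 div \<kappa> 0 < nrep then contrib \<rho> z (fst a) (snd a) else 0)"

text \<open>The second weight dominates: its factor is below \<open>2 * N * p\<close>, which also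
  exceeds the coefficient bound \<open>64 * N\<close>.\<close>

lemma contrib_le:
  assumes "x < N" "v < p"
  shows "contrib \<rho> z x v \<le> 2 * N * p * p"
proof -
  have p: "1 \<le> p" "32 \<le> p" using p_ge_256 by auto
  have "wt \<rho> f r x v \<le> 2 * N * p * p" for f r
  proof -
    have "v * 1 \<le> p * (2 * N * p)" using assms(2) N_pos p by (intro mult_mono) auto
    then have 0: "v \<le> 2 * N * p * p" by (simp add: mult_ac)
    have "x * (2 * p) + v < N * (2 * p)" using assms by (intro mixed_radix_less) auto
    then have "(x * (2 * p) + v) * v \<le> (N * (2 * p)) * p" using assms(2) by (intro mult_mono) auto
    then have 1: "(x * (2 * p) + v) * v \<le> 2 * N * p * p" by (simp add: mult_ac)
    have "fp \<rho> r x < 64 * N" unfolding fp_def using N_pos by simp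
    then have "fp \<rho> r x * v \<le> (2 * p * N) * p"
      using assms(2) p by (intro mult_mono) (auto intro: order_trans[of _ "64 * N"])
    then have 2: "fp \<rho> r x * v \<le> 2 * N * p * p" by (simp add: mult_ac)
    show ?thesis using 0 1 2 by (simp add: wt_def)
  qed
  then show ?thesis by (simp add: contrib_def Let_def)
qed

lemma contrib_0: "contrib \<rho> z x 0 = 0"
  by (simp add: contrib_def wt_def Let_def)

text \<open>\<open>N\<close> contributions plus the slack of two demanded by
  \<open>runs_element_loop\<close>. Here the hypothesis \<open>p \<ge> 4 * N\<^sup>2\<close> gives
  the cubic bound on cells.\<close>

lemma cell_max: "(N + 2) * (2 * N * p * p) \<le> p ^ 3"
proof -
  have "(N + 2) * (2 * N * p * p) \<le> (2 * N) * (2 * N * p * p)"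
    using N_ge by (intro mult_right_mono) auto
  also have "\<dots> = 4 * N\<^sup>2 * (p * p)" by (simp add: power2_eq_square)
  also have "\<dots> \<le> p * (p * p)" by (intro mult_right_mono p_ge) simp
  finally show ?thesis by (simp add: power3_eq_cube)
qed

lemma cell_max_word: "p ^ 3 < 2 ^ W"
proof -
  have "p ^ 3 \<le> Q ^ 3" by (intro power_mono) auto
  from less_word[OF le_trans[OF this Q_pow_le]] show ?thesis by simp
qed

lemma item_le: "fst a < N \<Longrightarrow> snd a < p \<Longrightarrow> item \<rho> z a \<le> 2 * N * p * p"
  using contrib_le[of "fst a" "snd a" \<rho> z] by (simp add: item_def)

lemma sum_items_le:
  assumes "k \<le> length zs" "length zs \<le> N" "\<And>k. k < length zs \<Longrightarrow> fst (zs ! k) < N \<and> snd (zs ! k) < p"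
  shows "(\<Sum>i<k. item \<rho> z (zs ! i)) \<le> N * (2 * N * p * p)"
proof -
  have "(\<Sum>i<k. item \<rho> z (zs ! i)) \<le> (\<Sum>i<k. 2 * N * p * p)"
    using assms by (intro sum_mono item_le) auto
  also have "\<dots> = k * (2 * N * p * p)" by simp
  also have "\<dots> \<le> N * (2 * N * p * p)" using assms by (intro mult_right_mono) auto
  finally show ?thesis .
qed

text \<open>One statement for both input formats: \<open>xe\<close> and \<open>ve\<close> are
  expressions that read the rank and the symbol of item \<open>i\<close> from wherever the input
  stores them.\<close>

lemma runs_items:
  fixes s :: state and zs :: "(nat \<times> nat) list" and \<rho> :: "nat \<Rightarrow> nat"
  assumes e: "env_of s" and cnt: "reg s cnt = length zs" "cnt \<notin> item_regs"
    and s: "reg s ''i'' = 0" "arr s ''S'' = (\<lambda>_. 0)"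
    and zs: "length zs \<le> N" "\<And>k. k < length zs \<Longrightarrow> fst (zs ! k) < N \<and> snd (zs ! k) < p"
    and vals: "\<And>k s'. k < length zs \<Longrightarrow> same item_regs {''S''} s s' \<Longrightarrow>
      reg s' ''i'' = k \<Longrightarrow> aval W \<rho> s' xe = fst (zs ! k) \<and> aval W \<rho> s' ve = snd (zs ! k)"
    and cost: "ecost xe + ecost ve \<le> 10"
    and post: "\<And>s'. same item_regs {''S''} s s' \<Longrightarrow>
      (\<And>z. arr s' ''S'' z = (\<Sum>i<length zs. item \<rho> z (zs ! i))) \<Longrightarrow> Post s'"
    and B: "(length zs + 1) * (400 * (nrep + 1) * (clog N + 1)) \<le> B"
  shows "runs W \<rho> (items_loop cnt xe ve) s B Post"
proof -
  define I where "I k s' \<longleftrightarrow> same item_regs {''S''} s s' \<and>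
    reg s' ''i'' = k \<and> (\<forall>z. arr s' ''S'' z = (\<Sum>i<k. item \<rho> z (zs ! i)))" for k and s' :: state
  have Ia: "same item_regs {''S''} s s'" if "I k s'" for k s'
    using that unfolding I_def by (rule conjunct1)
  have Ii: "reg s' ''i'' = k" if "I k s'" for k s'
    using that unfolding I_def by blast
  have IS: "arr s' ''S'' z = (\<Sum>i<k. item \<rho> z (zs ! i))" if "I k s'" for k s' z
    using that unfolding I_def by blast
  have Icnt: "reg s' cnt = length zs" if "I k s'" for k s'
    using agree_regD[OF Ia[OF that] cnt(2)] cnt(1) by simp
  let ?T = "300 * (nrep + 1) * (clog N + 1)"
  show ?thesis
    unfolding items_loop_def
  proof (rule runs_Loop[where I = I and n = "length zs" and ?B1.0 = "20 + ?T"])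
    show "I 0 s" using s by (simp add: I_def)
  next
    fix k s' assume k: "k < length zs" "I k s'"
    show "aval W \<rho> s' (Bin Less (Reg ''i'') (Reg cnt)) \<noteq> 0"
      using k(1) Ii[OF k(2)] Icnt[OF k(2)] W_pos by (simp add: const_mod)
    have e': "env_of s'" by (rule env_agree[OF Ia[OF k(2)] e]) auto
    let ?s1 = "s'\<lparr>reg := (reg s')(''x'' := fst (zs ! k), ''v'' := snd (zs ! k))\<rparr>"
    have a1: "agree item_regs {''S''} (reg s) (arr s) (reg (s'\<lparr>reg := (reg s')(''x'' := fst (zs ! k))\<rparr>))
        (arr (s'\<lparr>reg := (reg s')(''x'' := fst (zs ! k))\<rparr>))"
      using Ia[OF k(2)] by simp
    have i1: "reg (s'\<lparr>reg := (reg s')(''x'' := fst (zs ! k))\<rparr>) ''i'' = k" using Ii[OF k(2)] by simp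
    have x1: "aval W \<rho> s' xe = fst (zs ! k)" using vals[OF k(1) Ia[OF k(2)] Ii[OF k(2)]] by blast
    have v1: "aval W \<rho> (s'\<lparr>reg := (reg s')(''x'' := fst (zs ! k))\<rparr>) ve = snd (zs ! k)"
      using vals[OF k(1) a1 i1] by blast
    have s1: "sem W \<rho> (block [Assign ''x'' xe, Assign ''v'' ve]) s' = ?s1"
      unfolding block.simps sem.simps x1 v1 by simp
    show "runs W \<rho> (Seq (block [Assign ''x'' xe, Assign ''v'' ve])
       (Seq element_loop (Assign ''i'' (Bin Add (Reg ''i'') (Const 1))))) s' (20 + ?T) (I (Suc k))"
    proof (rule runs_Seq[where P = "\<lambda>s. s = ?s1" and ?B1.0 = 13 and ?B2.0 = "?T + 4"])
      show "runs W \<rho> (block [Assign ''x'' xe, Assign ''v'' ve]) s' 13 (\<lambda>s. s = ?s1)"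
        using cost s1 by (intro runs_straight) simp_all
      fix s2 :: state assume s2: "s2 = ?s1"
      have S2: "arr s2 ''S'' = arr s' ''S''" by (simp add: s2)
      have r2: "reg s2 ''x'' = fst (zs ! k)" "reg s2 ''v'' = snd (zs ! k)" "reg s2 ''i'' = k"
        using Ii[OF k(2)] by (simp_all add: s2)
      have a2: "same item_regs {''S''} s s2" using a1 by (simp add: s2)
      have e2: "env_of s2" by (rule env_agree[OF a2 e]) auto
      show "runs W \<rho> (Seq element_loop (Assign ''i'' (Bin Add (Reg ''i'') (Const 1)))) s2 (?T + 4) (I (Suc k))"
      proof (rule runs_Seq[where ?B1.0 = ?T], rule runs_element_loop[OF e2])
        show "reg s2 ''x'' < N" using zs(2)[OF k(1)] r2 by simp
        show "arr s2 ''S'' z + 2 * contrib \<rho> z (reg s2 ''x'') (reg s2 ''v'') < 2 ^ W" for z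
        proof -
          have "arr s2 ''S'' z \<le> N * (2 * N * p * p)"
            unfolding S2 IS[OF k(2)] using k(1) zs by (intro sum_items_le) auto
          moreover have "contrib \<rho> z (reg s2 ''x'') (reg s2 ''v'') \<le> 2 * N * p * p"
            unfolding r2 using zs(2)[OF k(1)] by (intro contrib_le) auto
          ultimately have "arr s2 ''S'' z + 2 * contrib \<rho> z (reg s2 ''x'') (reg s2 ''v'') \<le> (N + 2) * (2 * N * p * p)"
            unfolding distrib_right by linarith
          then show ?thesis using cell_max cell_max_word by linarith
        qed
        fix s3 :: state
        let ?P = "\<lambda>s3 :: state. same {''r'', ''k'', ''b'', ''j'', ''y''} {''S''} s2 s3 \<and>
           (\<forall>z. arr s3 ''S'' z = arr s2 ''S'' z + item \<rho> z (zs ! k))"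
        show "same {''r'', ''k'', ''b'', ''j'', ''y''} {''S''} s2 s3 \<Longrightarrow>
          (\<And>z. arr s3 ''S'' z = arr s2 ''S'' z + (if z div 3 div \<kappa> 0 < nrep
             then contrib \<rho> z (reg s2 ''x'') (reg s2 ''v'') else 0)) \<Longrightarrow> ?P s3"
          unfolding item_def r2 by blast
        assume 3: "?P s3"
        have a3: "same item_regs {''S''} s s3"
          by (rule agree_trans[OF a2 conjunct1[OF 3]]) auto
        have i3: "reg s3 ''i'' = k" using agree_regD[OF conjunct1[OF 3], of "''i''"] r2(3) by simp
        have kw: "Suc k < 2 ^ W" using k(1) zs(1) by (intro less_N_word) simp
        show "runs W \<rho> (Assign ''i'' (Bin Add (Reg ''i'') (Const 1))) s3 4 (I (Suc k))"
        proof (rule runs_straight)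
          have "sem W \<rho> (Assign ''i'' (Bin Add (Reg ''i'') (Const 1))) s3 = s3\<lparr>reg := (reg s3)(''i'' := Suc k)\<rparr>"
            using i3 kw W_pos by (simp add: const_mod)
          moreover have "arr s3 ''S'' z = (\<Sum>i<Suc k. item \<rho> z (zs ! i))" for z
            using 3 S2 IS[OF k(2), of z] by simp
          ultimately show "I (Suc k) (sem W \<rho> (Assign ''i'' (Bin Add (Reg ''i'') (Const 1))) s3)"
            unfolding I_def using a3 by simp
        qed simp_all
      qed simp_all
    qed simp
  next
    fix s' assume I: "I (length zs) s'"
    show "aval W \<rho> s' (Bin Less (Reg ''i'') (Reg cnt)) = 0"
      using Ii[OF I] Icnt[OF I] by simp
    show "Post s'" by (intro post Ia[OF I] IS[OF I])
  next
    let ?T' = "(nrep + 1) * (clog N + 1)"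
    have "length zs * 24 \<le> length zs * (24 * ?T')" by (intro mult_left_mono) auto
    moreover have "(length zs + 1) * (400 * ?T') = length zs * (300 * ?T') + length zs * (24 * ?T') + length zs * (76 * ?T') + 400 * ?T'"
      by (simp add: algebra_simps)
    moreover have "1 \<le> ?T'" by simp
    ultimately have "length zs * 24 + length zs * (300 * ?T') + 4 \<le> (length zs + 1) * (400 * ?T')" by linarith
    moreover have "length zs * (1 + ecost (Bin Less (Reg ''i'') (Reg cnt)) + (20 + ?T)) + (1 + ecost (Bin Less (Reg ''i'') (Reg cnt)))
      = length zs * 24 + length zs * (300 * ?T') + 4" by (simp add: algebra_simps)
    ultimately show "length zs * (1 + ecost (Bin Less (Reg ''i'') (Reg cnt)) + (20 + ?T)) + (1 + ecost (Bin Less (Reg ''i'') (Reg cnt))) \<le> B"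
      using B by (simp only: mult.assoc)
  qed
qed

text \<open>Positions with symbol 0 contribute nothing to any of the three sums, so a list covering
  the support yields the full cell. Hence dense and sparse input give the same sketch.\<close>

lemma cell_eq_sum_items:
  assumes dist: "distinct (map fst zs)" and zs: "\<And>a. a \<in> set zs \<Longrightarrow> fst a < N \<and> snd a = U (fst a)"
    and supp: "\<And>x. x < N \<Longrightarrow> U x \<noteq> 0 \<Longrightarrow> x \<in> fst ` set zs" and z: "z < 3 * ncell"
  shows "(\<Sum>i<length zs. item \<rho> z (zs ! i)) = cell \<rho> U z"
proof -
  have "z div 3 div \<kappa> 0 < nrep"
    using z kap0_pos by (simp add: ncell_def div_less_iff_less_mult mult.commute)
  then have it: "item \<rho> z a = contrib \<rho> z (fst a) (U (fst a))" if "a \<in> set zs" for a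
    using zs[OF that] by (simp add: item_def)
  have "(\<Sum>i<length zs. item \<rho> z (zs ! i)) = sum_list (map (item \<rho> z) zs)"
    by (simp add: sum_list_sum_nth atLeast0LessThan)
  also have "\<dots> = (\<Sum>a\<in>set zs. item \<rho> z a)"
    using dist by (intro sum_list_distinct_conv_sum_set) (auto simp: distinct_map)
  also have "\<dots> = (\<Sum>a\<in>set zs. contrib \<rho> z (fst a) (U (fst a)))" using it by (intro sum.cong) auto
  also have "\<dots> = (\<Sum>x\<in>fst ` set zs. contrib \<rho> z x (U x))"
    using dist by (subst sum.reindex) (auto simp: distinct_map)
  also have "\<dots> = cell \<rho> U z"
    unfolding cell_def using zs supp by (intro sum.mono_neutral_left) (force simp: contrib_0)+
  finally show ?thesis .
qed

lemma cell_le: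
  assumes "\<And>x. x < N \<Longrightarrow> U x < p"
  shows "cell \<rho> U z < p ^ 3"
proof -
  have "cell \<rho> U z \<le> (\<Sum>x<N. 2 * N * p * p)"
    unfolding cell_def using assms by (intro sum_mono contrib_le) auto
  also have "\<dots> = N * (2 * N * p * p)" by simp
  also have "\<dots> < (N + 2) * (2 * N * p * p)" using N_pos p_ge_256 by (intro mult_strict_right_mono) auto
  finally show ?thesis using cell_max by linarith
qed

lemma cell_less_width:
  assumes "\<And>x. x < N \<Longrightarrow> U x < p"
  shows "cell \<rho> U z < 2 ^ width"
proof -
  have "p \<le> 2 ^ clog (p + 1)" using clog_le_iff[of "p + 1" "clog (p + 1)"] by simp
  then have "p ^ 3 \<le> (2 ^ clog (p + 1)) ^ 3" by (intro power_mono) auto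
  also have "\<dots> = 2 ^ width" by (simp add: width_def mult.commute flip: power_mult)
  finally show ?thesis using cell_le[where U = U and \<rho> = \<rho> and z = z, OF assms] by simp
qed

text \<open>All cells in binary, each in a field of \<open>width\<close> bits, low bits
  first.\<close>

definition sketch :: "(nat \<Rightarrow> nat) \<Rightarrow> (nat \<Rightarrow> nat) \<Rightarrow> bool list" where
  "sketch \<rho> U = map (\<lambda>k. bit (cell \<rho> U (k div width)) (k mod width)) [0..<nbit]"

lemma width_pos: "0 < width"
  using clog_le_iff[of "p + 1" 0] p_ge_256 by (simp add: width_def)

lemma nbit_div: "k < nbit \<Longrightarrow> k div width < 3 * ncell"
  using width_pos by (simp add: nbit_def div_less_iff_less_mult)

lemma runs_put_bits:
  fixes s :: state and \<rho> :: "nat \<Rightarrow> nat"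
  assumes e: "env_of s" and S: "\<And>z. z < 3 * ncell \<Longrightarrow> arr s ''S'' z < 2 ^ W"
    and post: "\<And>s'. reg s' ''n'' = nbit \<Longrightarrow>
      (\<And>k. k < nbit \<Longrightarrow> arr s' ''out'' k = of_bool (bit (arr s ''S'' (k div width)) (k mod width))) \<Longrightarrow> Post s'"
    and B: "(nbit + 1) * 40 \<le> B"
  shows "runs W \<rho> put_bits s B Post"
  unfolding put_bits_def
proof (rule runs_Seq)
  let ?P = "\<lambda>s1 :: state. same {''x''} {''out''} s s1 \<and> reg s1 ''x'' = 0"
  let ?o = "\<lambda>k. of_bool (bit (arr s ''S'' (k div width)) (k mod width)) :: nat"
  show "runs W \<rho> (Assign ''x'' (Const 0)) s 2 ?P"
    by (rule runs_straight) simp_all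
  fix s1 :: state assume 1: "?P s1"
  define I where "I k s' \<longleftrightarrow> same {''x''} {''out''} s s' \<and> reg s' ''x'' = k \<and>
    (\<forall>i<k. arr s' ''out'' i = ?o i)" for k and s' :: state
  have Ia: "same {''x''} {''out''} s s'" and Ix: "reg s' ''x'' = k"
    and Io: "i < k \<Longrightarrow> arr s' ''out'' i = ?o i" if "I k s'" for k s' i
    using that unfolding I_def by blast+
  have e': "env_of s'" if "I k s'" for k s' by (rule env_agree[OF Ia[OF that] e]) auto
  show "runs W \<rho> (Seq (Loop (Bin Less (Reg ''x'') (Reg ''H'')) put_body) (Assign ''n'' (Reg ''H''))) s1
      (nbit * 34 + 10) Post"
  proof (rule runs_Seq)
    show "runs W \<rho> (Loop (Bin Less (Reg ''x'') (Reg ''H'')) put_body) s1 (nbit * 34 + 4) (I nbit)"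
    proof (rule runs_Loop[where I = I and n = nbit and ?B1.0 = 30])
      show "I 0 s1" using 1 by (simp add: I_def)
    next
      fix k s' assume k: "k < nbit" "I k s'"
      show "aval W \<rho> s' (Bin Less (Reg ''x'') (Reg ''H'')) \<noteq> 0"
        using k(1) Ix[OF k(2)] envD(9)[OF e'[OF k(2)]] W_pos by (simp add: const_mod)
      show "runs W \<rho> put_body s' 30 (I (Suc k))"
      proof (rule runs_straight)
        let ?v = "arr s ''S'' (k div width)"
        have v: "?v < 2 ^ W" by (intro S nbit_div k(1))
        then have dv: "drop_bit (k mod width) ?v < 2 ^ W"
          unfolding drop_bit_eq_div by (rule le_less_trans[OF div_le_dividend])
        have kw: "k < 2 ^ W" "Suc k < 2 ^ W" using k(1) sizes_less(5) by auto
        have dm: "k div width < 2 ^ W" "k mod width < 2 ^ W"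
          using kw(1) by (meson div_le_dividend le_less_trans, meson mod_less_eq_dividend le_less_trans)
        have m: "reg s' ''m'' = width" using envD(5)[OF e'[OF k(2)]] .
        have Sv: "arr s' ''S'' (k div width) = ?v" using agree_arrD[OF Ia[OF k(2)], of "''S''"] by simp
        have an: "and (drop_bit (k mod width) ?v) (Suc 0) mod 2 ^ W = ?o k"
          using W_pos by (simp add: and_Suc_0_eq bit_iff_odd_drop_bit mod_2_eq_odd)
        have "sem W \<rho> put_body s' = s'\<lparr>reg := (reg s')(''x'' := Suc k),
            arr := (arr s')(''out'' := (arr s' ''out'')(k := ?o k))\<rparr>"
          using W_pos Ix[OF k(2)] m Sv dm dv kw an by (simp add: put_body_def const_mod)
        then show "I (Suc k) (sem W \<rho> put_body s')"
          using Ia[OF k(2)] Io[OF k(2)] by (simp add: I_def less_Suc_eq)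
      qed (simp_all add: put_body_def)
    next
      fix s' assume I: "I nbit s'"
      show "aval W \<rho> s' (Bin Less (Reg ''x'') (Reg ''H'')) = 0"
        using Ix[OF I] envD(9)[OF e'[OF I]] by simp
      show "I nbit s'" by fact
    qed simp
    fix s2 :: state assume 2: "I nbit s2"
    show "runs W \<rho> (Assign ''n'' (Reg ''H'')) s2 2 Post"
      using envD(9)[OF e'[OF 2]] Io[OF 2] by (intro runs_straight post) simp_all
  qed simp
qed (use B in simp)

text \<open>The contract shared by the dense and the sparse program; the list \<open>zs\<close> of
  items may be any duplicate-free list of ranks containing the support of \<open>U\<close>.\<close>

lemma runs_sketch_with:
  fixes s :: state and zs :: "(nat \<times> nat) list" and \<rho> :: "nat \<Rightarrow> nat"
  assumes s: "penv_of s" and S: "arr s ''S'' = (\<lambda>_. 0)"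
    and cnt: "\<And>s' :: state. same (prepare_regs \<union> item_regs) {''E'', ''S''} s s' \<Longrightarrow>
      env_of s' \<Longrightarrow> reg s' cnt = length zs" "cnt \<notin> item_regs"
    and vals: "\<And>k s'. k < length zs \<Longrightarrow>
      same (prepare_regs \<union> item_regs) {''E'', ''S''} s s' \<Longrightarrow>
      reg s' ''i'' = k \<Longrightarrow> aval W \<rho> s' xe = fst (zs ! k) \<and> aval W \<rho> s' ve = snd (zs ! k)"
    and cost: "ecost xe + ecost ve \<le> 10"
    and dist: "distinct (map fst zs)" and zs: "\<And>a. a \<in> set zs \<Longrightarrow> fst a < N \<and> snd a = U (fst a)"
    and supp: "\<And>x. x < N \<Longrightarrow> U x \<noteq> 0 \<Longrightarrow> x \<in> fst ` set zs" and U: "\<And>x. x < N \<Longrightarrow> U x < p"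
    and B: "50 * (d + clog N + clog (p + 1)) + (length zs + 1) * (400 * (nrep + 1) * (clog N + 1))
      + (nbit + 1) * 40 + 250 \<le> B"
  shows "runs W \<rho> (sketch_with cnt xe ve) s B (sketch_output (sketch \<rho> U))"
  unfolding sketch_with_def
proof (rule runs_Cond)
  have k0: "\<kappa> 0 < 2 ^ W" using kap0_le by (rule less_N_word)
  then have guard: "aval W \<rho> s (Bin Less (Bin Mul (Const 4) (Reg ''d'')) (Elem ''kappa'' (Const 0))) = 1"
    using s big W_pos by (simp add: penv_def const_mod mod_simps)
  let ?T = "(length zs + 1) * (400 * (nrep + 1) * (clog N + 1))"
  let ?B1 = "50 * (d + clog N + clog (p + 1)) + 200"
  let ?B = "?B1 + (2 + (?T + (nbit + 1) * 40))"
  show "runs W \<rho> (Assign ''n'' (Const 0)) s ?B (sketch_output (sketch \<rho> U))"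
    if "aval W \<rho> s (Bin Less (Bin Mul (Const 4) (Reg ''d'')) (Elem ''kappa'' (Const 0))) = 0"
    using that guard by simp
  have len: "length zs \<le> N"
  proof -
    have "length zs = card (fst ` set zs)" using distinct_card[OF dist] by simp
    also have "\<dots> \<le> card {..<N}" using zs by (intro card_mono) auto
    finally show ?thesis by simp
  qed
  have nth: "fst (zs ! k) < N \<and> snd (zs ! k) < p" if "k < length zs" for k
    using zs[of "zs ! k"] U that by simp
  show "runs W \<rho> (Seq prepare (Seq (Assign ''i'' (Const 0)) (Seq (items_loop cnt xe ve) put_bits))) s ?B
      (sketch_output (sketch \<rho> U))"
  proof (rule runs_Seq[where ?B1.0 = ?B1], rule runs_prepare[OF s])
    fix s1 :: state
    let ?P1 = "\<lambda>s1 :: state. same prepare_regs {''E''} s s1 \<and> env_of s1"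
    show "same prepare_regs {''E''} s s1 \<Longrightarrow> env_of s1 \<Longrightarrow> ?P1 s1"
      by (rule conjI)
    assume 1: "?P1 s1"
    show "runs W \<rho> (Seq (Assign ''i'' (Const 0)) (Seq (items_loop cnt xe ve) put_bits)) s1
        (2 + (?T + (nbit + 1) * 40)) (sketch_output (sketch \<rho> U))"
    proof (rule runs_Seq)
      let ?P2 = "\<lambda>s2 :: state. same {''i''} {} s1 s2 \<and> reg s2 ''i'' = 0"
      show "runs W \<rho> (Assign ''i'' (Const 0)) s1 2 ?P2" by (rule runs_straight) simp_all
      fix s2 :: state assume 2: "?P2 s2"
      have a2: "same (prepare_regs \<union> item_regs) {''E'', ''S''} s s2"
        by (rule agree_trans[OF conjunct1[OF 1] conjunct1[OF 2]]) auto
      have e2: "env_of s2" by (rule env_agree[OF conjunct1[OF 2] conjunct2[OF 1]]) auto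
      have S2: "arr s2 ''S'' = (\<lambda>_. 0)"
        using agree_arrD[OF conjunct1[OF 1], of "''S''"] agree_arrD[OF conjunct1[OF 2], of "''S''"] S by simp
      show "runs W \<rho> (Seq (items_loop cnt xe ve) put_bits) s2 (?T + (nbit + 1) * 40) (sketch_output (sketch \<rho> U))"
      proof (rule runs_Seq[where ?B1.0 = ?T], rule runs_items[OF e2 cnt(1)[OF a2 e2] cnt(2) conjunct2[OF 2] S2 len nth])
        show "k < length zs" if "k < length zs" for k using that .
        show "aval W \<rho> s' xe = fst (zs ! k) \<and> aval W \<rho> s' ve = snd (zs ! k)"
          if "k < length zs" "same item_regs {''S''} s2 s'" "reg s' ''i'' = k" for k s'
          by (rule vals[OF that(1) agree_trans[OF a2 that(2)] that(3)]) auto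
        fix s3 :: state
        let ?P3 = "\<lambda>s3 :: state. same item_regs {''S''} s2 s3 \<and>
          (\<forall>z. arr s3 ''S'' z = (\<Sum>i<length zs. item \<rho> z (zs ! i)))"
        show "same item_regs {''S''} s2 s3 \<Longrightarrow>
          (\<And>z. arr s3 ''S'' z = (\<Sum>i<length zs. item \<rho> z (zs ! i))) \<Longrightarrow> ?P3 s3" by blast
        assume 3: "?P3 s3"
        have e3: "env_of s3" by (rule env_agree[OF conjunct1[OF 3] e2]) auto
        have S3: "arr s3 ''S'' z = cell \<rho> U z" if "z < 3 * ncell" for z
          using cell_eq_sum_items[OF dist zs supp that, of \<rho>] 3 by simp
        show "runs W \<rho> put_bits s3 ((nbit + 1) * 40) (sketch_output (sketch \<rho> U))"
        proof (rule runs_put_bits[OF e3])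
          show "arr s3 ''S'' z < 2 ^ W" if "z < 3 * ncell" for z
            using S3[OF that] cell_le[where U = U and \<rho> = \<rho> and z = z, OF U] cell_max_word by simp
          show "sketch_output (sketch \<rho> U) s'" if "reg s' ''n'' = nbit"
            "\<And>k. k < nbit \<Longrightarrow> arr s' ''out'' k = of_bool (bit (arr s3 ''S'' (k div width)) (k mod width))" for s'
            using that S3 nbit_div by (simp add: sketch_output_def sketch_def)
        qed simp
      qed (use cost in simp_all)
    qed simp
  qed simp_all
qed (use B in simp)

end

section \<open>Recovery\<close>

definition get_body :: com where
  "get_body = block
     [Assign ''k'' (Bin Div (Reg ''x'') (Reg ''m'')),
      Assign ''j'' (Bin Mod (Reg ''x'') (Reg ''m'')),
      Store ''S'' (Reg ''k'') (Bin Add (Elem ''S'' (Reg ''k'')) (Bin Shl (Elem ''s1'' (Reg ''x'')) (Reg ''j''))),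
      Store ''Z'' (Reg ''k'') (Bin Add (Elem ''Z'' (Reg ''k'')) (Bin Shl (Elem ''s2'' (Reg ''x'')) (Reg ''j''))),
      Assign ''x'' (Bin Add (Reg ''x'') (Const 1))]"

definition dist_exp :: "exp \<Rightarrow> exp" where
  "dist_exp k = Bin Add (Bin Sub (Elem ''S'' k) (Elem ''Z'' k)) (Bin Sub (Elem ''Z'' k) (Elem ''S'' k))"

definition half_exp :: "name \<Rightarrow> name \<Rightarrow> exp" where
  "half_exp A B = Bin Mod (Bin Div (Bin Sub (Bin Add (Reg ''v'') (Elem A (Reg ''k''))) (Elem B (Reg ''k''))) (Const 2)) (Reg ''p'')"

definition guess_cmds :: com where
  "guess_cmds = block
     [Assign ''e'' (dist_exp (Reg ''k'')),
      Assign ''c'' (Bin Div (dist_exp (Bin Add (Reg ''k'') (Const 1))) (Reg ''e'')),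
      Assign ''x'' (Bin Mod (Bin Div (Reg ''c'') (Bin Mul (Const 2) (Reg ''p''))) (Reg ''N'')),
      Assign ''v'' (Bin Mod (Reg ''c'') (Bin Mul (Const 2) (Reg ''p''))),
      Assign ''a'' (half_exp ''S'' ''Z''),
      Assign ''b'' (half_exp ''Z'' ''S''),
      Assign ''f'' fp_exp]"

text \<open>\<open>last\<close> and \<open>cnt\<close> are direct-address tables indexed by the
  packed triple. The packed triple is below \<open>p ^ 3\<close> and thus a word, and arrays start
  at 0, so counting costs constant time without initialisation.\<close>

definition record_cmds :: com where
  "record_cmds = block
     [Assign ''k'' (Bin Add (Bin Mul (Bin Add (Bin Mul (Reg ''x'') (Reg ''p'')) (Reg ''a'')) (Reg ''p'')) (Reg ''b'')),
      Cond (Bin Equal (Elem ''last'' (Reg ''k'')) (Bin Add (Reg ''r'') (Const 1))) Skip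
        (block
          [Store ''last'' (Reg ''k'') (Bin Add (Reg ''r'') (Const 1)),
           Store ''cnt'' (Reg ''k'') (Bin Add (Elem ''cnt'' (Reg ''k'')) (Const 1)),
           Cond (Bin Equal (Elem ''cnt'' (Reg ''k'')) (Bin Add (Reg ''z'') (Const 1)))
             (Cond (Bin Less (Reg ''n'') (Elem ''kappa'' (Const 0)))
               (block
                 [Store ''i'' (Reg ''n'') (Reg ''x''),
                  Store ''a'' (Reg ''n'') (Reg ''a''),
                  Store ''b'' (Reg ''n'') (Reg ''b''),
                  Assign ''n'' (Bin Add (Reg ''n'') (Const 1))])
               Skip)
             Skip])]"

definition check_exp :: exp where
  "check_exp = Bin Equal
     (Bin Add (Elem ''S'' (Bin Add (Reg ''k'') (Const 2))) (Bin Mul (Reg ''f'') (Reg ''b'')))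
     (Bin Add (Elem ''Z'' (Bin Add (Reg ''k'') (Const 2))) (Bin Mul (Reg ''f'') (Reg ''a'')))"

definition pre_cmds :: com where
  "pre_cmds = block
     [Assign ''r'' (Bin Div (Reg ''y'') (Elem ''kappa'' (Const 0))),
      Assign ''k'' (Bin Mul (Const 3) (Reg ''y''))]"

definition decode_body :: com where
  "decode_body =
     Seq pre_cmds
    (Seq (Cond (Bin Equal (Elem ''S'' (Reg ''k'')) (Elem ''Z'' (Reg ''k''))) Skip
           (Seq guess_cmds (Cond check_exp record_cmds Skip)))
     (Assign ''y'' (Bin Add (Reg ''y'') (Const 1))))"

definition recover_prog :: com where
  "recover_prog =
     Cond (Bin Less (Bin Mul (Const 4) (Reg ''d'')) (Elem ''kappa'' (Const 0)))
       (Seq prepare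
       (Seq (Assign ''x'' (Const 0))
       (Seq (Loop (Bin Less (Reg ''x'') (Reg ''H'')) get_body)
       (Seq (Assign ''y'' (Const 0))
            (Loop (Bin Less (Reg ''y'') (Reg ''Y'')) decode_body)))))
       Skip"

text \<open>After \<open>x\<close> bits of the stream, field \<open>z\<close> has received its
  lowest \<open>x - z * w\<close> bits. Truncated subtraction covers fields not yet begun, and
  \<open>c < 2 ^ w\<close> covers completed ones.\<close>

lemma take_bit_add_bit:
  fixes c w x z :: nat
  assumes "c < 2 ^ w" "0 < w"
  shows "take_bit (Suc x - z * w) c = take_bit (x - z * w) c +
    (if z = x div w then push_bit (x mod w) (of_bool (bit c (x mod w))) else 0)"
proof (cases "x div w" z rule: linorder_cases)
  case less
  then have "Suc (x div w) * w \<le> z * w" by (intro mult_right_mono) auto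
  moreover have "x < Suc (x div w) * w" using dividend_less_div_times[OF assms(2), of x] by simp
  ultimately have "Suc x - z * w = 0" "x - z * w = 0" by auto
  then show ?thesis using less by simp
next
  case equal
  have x: "x = z * w + x mod w" using equal by (metis div_mult_mod_eq)
  have "x - z * w = x mod w" "Suc x - z * w = Suc (x mod w)" using x by linarith+
  then show ?thesis using equal by (simp add: take_bit_Suc_from_most push_bit_eq_mult)
next
  case greater
  then have "Suc z * w \<le> x div w * w" by (intro mult_right_mono) auto
  also have "\<dots> \<le> x" by simp
  finally have "w \<le> x - z * w" "w \<le> Suc x - z * w" by auto
  then have "(2::nat) ^ w \<le> 2 ^ (x - z * w)" "(2::nat) ^ w \<le> 2 ^ (Suc x - z * w)"
    by (auto intro: power_increasing simp del: power_increasing_iff)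
  then have "c < 2 ^ (x - z * w)" "c < 2 ^ (Suc x - z * w)" by (auto intro: less_le_trans[OF assms(1)])
  then have "take_bit (x - z * w) c = c" "take_bit (Suc x - z * w) c = c"
    by (simp_all add: take_bit_nat_eq_self_iff)
  then show ?thesis using greater by simp
qed

section \<open>Reading the sketches back into cells\<close>

context hmr
begin

definition cell_of :: "bool list \<Rightarrow> nat \<Rightarrow> nat" where
  "cell_of X z = (\<Sum>k = 0..<width. push_bit k (of_bool (X ! (z * width + k))))"

lemma cell_of_sketch:
  assumes "\<And>x. x < N \<Longrightarrow> U x < p" "z < 3 * ncell"
  shows "cell_of (sketch \<rho> U) z = cell \<rho> U z"
proof -
  have nth: "sketch \<rho> U ! (z * width + k) = bit (cell \<rho> U z) k" if "k < width" for k
  proof -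
    have "z * width + k < nbit" unfolding nbit_def using assms(2) that by (rule mixed_radix_less)
    then show ?thesis using that by (simp add: sketch_def)
  qed
  have "cell_of (sketch \<rho> U) z = take_bit width (cell \<rho> U z)"
    unfolding cell_of_def take_bit_sum by (intro sum.cong refl) (simp add: nth)
  also have "\<dots> = cell \<rho> U z"
    using cell_less_width[where U = U, OF assms(1), of \<rho> z] by (simp add: take_bit_nat_eq_self_iff)
  finally show ?thesis .
qed

lemma emitted_cong:
  assumes "\<And>y'. y' < y \<Longrightarrow> c y' = c' y'"
  shows "emitted c g T y = emitted c' g T y"
  using assms
proof (induction y)
  case (Suc y)
  have "seen c g y = seen c' g y" using Suc.prems by (auto simp: seen_def fun_eq_iff)
  moreover have "emitted c g T y = emitted c' g T y" using Suc by simp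
  moreover have "c y = c' y" using Suc.prems by simp
  ultimately show ?case unfolding emitted.simps by (simp only:)
qed simp

lemma recovered_cong:
  assumes "\<And>z. z < 3 * ncell \<Longrightarrow> S z = S' z" "\<And>z. z < 3 * ncell \<Longrightarrow> Z z = Z' z"
  shows "recovered \<rho> S Z = recovered \<rho> S' Z'"
proof -
  have "emitted (cand \<rho> S Z) (\<lambda>y. y div \<kappa> 0) thr ncell = emitted (cand \<rho> S' Z') (\<lambda>y. y div \<kappa> 0) thr ncell"
  proof (rule emitted_cong)
    fix y assume "y < ncell"
    then show "cand \<rho> S Z y = cand \<rho> S' Z' y"
      unfolding cand_def using assms(1)[of "3 * y"] assms(1)[of "3 * y + 1"] assms(1)[of "3 * y + 2"]
        assms(2)[of "3 * y"] assms(2)[of "3 * y + 1"] assms(2)[of "3 * y + 2"] by simp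
  qed
  then show ?thesis by (simp add: recovered_def)
qed

definition recover :: "(nat \<Rightarrow> nat) \<Rightarrow> bool list \<Rightarrow> bool list \<Rightarrow> (nat \<times> nat \<times> nat) list" where
  "recover \<rho> X Y = recovered \<rho> (cell_of X) (cell_of Y)"

lemma recover_sketch:
  assumes "\<And>x. x < N \<Longrightarrow> U x < p" "\<And>x. x < N \<Longrightarrow> V x < p"
  shows "recover \<rho> (sketch \<rho> U) (sketch \<rho> V) = recovered \<rho> (cell \<rho> U) (cell \<rho> V)"
  unfolding recover_def using cell_of_sketch assms by (intro recovered_cong) auto

lemma width_word: "2 ^ width < (2::nat) ^ W"
proof -
  have "(2::nat) ^ width = (2 ^ clog (p + 1)) ^ 3" by (simp add: width_def mult.commute flip: power_mult)
  also have "\<dots> \<le> (2 * p) ^ 3" by (intro power_mono clog_p_le) simp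
  also have "\<dots> = 8 * p ^ 3" by (simp add: power_mult_distrib)
  also have "\<dots> \<le> p * p ^ 3" using p_ge_256 by (intro mult_right_mono) auto
  also have "\<dots> = p ^ 4" by (simp add: numeral_eq_Suc)
  also have "\<dots> \<le> Q ^ 4" by (intro power_mono) auto
  finally have "2 ^ width \<le> Q ^ 4" .
  from less_word[OF le_trans[OF this Q_pow_le]] show ?thesis by simp
qed

lemma runs_get:
  fixes s :: state and \<rho> :: "nat \<Rightarrow> nat"
  assumes e: "env_of s" and s: "reg s ''x'' = 0" "arr s ''S'' = (\<lambda>_. 0)" "arr s ''Z'' = (\<lambda>_. 0)"
    and s12: "\<And>k. k < nbit \<Longrightarrow> arr s ''s1'' k = of_bool (sketch \<rho> U ! k) \<and> arr s ''s2'' k = of_bool (sketch \<rho> V ! k)"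
    and UV: "\<And>x. x < N \<Longrightarrow> U x < p" "\<And>x. x < N \<Longrightarrow> V x < p"
    and post: "\<And>s'. same {''k'', ''j'', ''x''} {''S'', ''Z''} s s' \<Longrightarrow>
      (\<And>z. z < 3 * ncell \<Longrightarrow> arr s' ''S'' z = cell \<rho> U z \<and> arr s' ''Z'' z = cell \<rho> V z) \<Longrightarrow> Post s'"
    and B: "(nbit + 1) * 60 \<le> B"
  shows "runs W \<rho> (Loop (Bin Less (Reg ''x'') (Reg ''H'')) get_body) s B Post"
proof -
  let ?t = "\<lambda>U x z. take_bit (x - z * width) (cell \<rho> U z)"
  have tless: "?t U x z < 2 ^ W" if "\<And>x. x < N \<Longrightarrow> U x < p" for U x z
    using cell_le[where U = U and \<rho> = \<rho> and z = z, OF that] cell_max_word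
    by (meson le_less_trans less_trans take_bit_nat_less_eq_self)
  have tstep: "?t U (Suc x) z = ?t U x z + (if z = x div width
      then push_bit (x mod width) (of_bool (bit (cell \<rho> U z) (x mod width))) else 0)"
    if "\<And>x. x < N \<Longrightarrow> U x < p" for U x z
    by (rule take_bit_add_bit[OF cell_less_width[where U = U, OF that] width_pos])
  \<comment> \<open>The invariant holds at all indices \<open>z\<close> at once, since the truncated
    bit counts also describe fields before and after the current one.\<close>
  define I where "I x s' \<longleftrightarrow> same {''k'', ''j'', ''x''} {''S'', ''Z''} s s' \<and>
    reg s' ''x'' = x \<and> (\<forall>z. arr s' ''S'' z = ?t U x z) \<and> (\<forall>z. arr s' ''Z'' z = ?t V x z)"
    for x and s' :: state
  have Ia: "same {''k'', ''j'', ''x''} {''S'', ''Z''} s s'" and Ix: "reg s' ''x'' = x"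
    and IS: "arr s' ''S'' z = ?t U x z" and IZ: "arr s' ''Z'' z = ?t V x z" if "I x s'" for x s' z
    using that unfolding I_def by blast+
  have e': "env_of s'" if "I k s'" for k s' by (rule env_agree[OF Ia[OF that] e]) auto
  show ?thesis
  proof (rule runs_Loop[where I = I and n = nbit and ?B1.0 = 50])
    show "I 0 s" using s by (simp add: I_def)
  next
    fix k s' assume k: "k < nbit" "I k s'"
    note Ik = Ia[OF k(2)]
    show "aval W \<rho> s' (Bin Less (Reg ''x'') (Reg ''H'')) \<noteq> 0"
      using k(1) Ix[OF k(2)] envD(9)[OF e'[OF k(2)]] W_pos by (simp add: const_mod)
    show "runs W \<rho> get_body s' 50 (I (Suc k))"
    proof (rule runs_straight)
      let ?z = "k div width" and ?j = "k mod width"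
      have kw: "k < 2 ^ W" "Suc k < 2 ^ W" using k(1) sizes_less(5) by auto
      have dm: "?z mod 2 ^ W = ?z" "?j mod 2 ^ W = ?j"
        using kw(1) by (auto intro!: mod_less intro: le_less_trans[OF div_le_dividend] le_less_trans[OF mod_less_eq_dividend])
      have kw': "Suc k mod 2 ^ W = Suc k" using kw by simp
      have m: "reg s' ''m'' = width" using envD(5)[OF e'[OF k(2)]] .
      have "(2::nat) ^ ?j \<le> 2 ^ width" using width_pos by (intro power_increasing) auto
      then have "push_bit ?j (of_bool b) < (2::nat) ^ W" for b
        using width_word by (cases b) (auto simp: push_bit_eq_mult)
      then have pb: "push_bit ?j (of_bool b) mod 2 ^ W = (push_bit ?j (of_bool b) :: nat)" for b by simp
      have b1: "arr s' ''s1'' k = of_bool (bit (cell \<rho> U ?z) ?j)" "arr s' ''s2'' k = of_bool (bit (cell \<rho> V ?z) ?j)"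
        using s12[OF k(1)] agree_arrD[OF Ik, of "''s1''"] agree_arrD[OF Ik, of "''s2''"] k(1)
        by (simp_all add: sketch_def)
      have u: "(?t U k ?z + push_bit ?j (of_bool (bit (cell \<rho> U ?z) ?j))) mod 2 ^ W = ?t U (Suc k) ?z"
        "(?t V k ?z + push_bit ?j (of_bool (bit (cell \<rho> V ?z) ?j))) mod 2 ^ W = ?t V (Suc k) ?z"
        using tstep[where U = U and x = k and z = ?z, OF UV(1)] tstep[where U = V and x = k and z = ?z, OF UV(2)]
          tless[where U = U and x = "Suc k" and z = ?z, OF UV(1)] tless[where U = V and x = "Suc k" and z = ?z, OF UV(2)]
        by simp_all
      have "sem W \<rho> get_body s' = s'\<lparr>reg := (reg s')(''k'' := ?z, ''j'' := ?j, ''x'' := Suc k),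
          arr := (arr s')(''S'' := (arr s' ''S'')(?z := ?t U (Suc k) ?z), ''Z'' := (arr s' ''Z'')(?z := ?t V (Suc k) ?z))\<rparr>"
        using W_pos by (simp add: get_body_def Ix[OF k(2)] m dm b1 IS[OF k(2)] IZ[OF k(2)] pb const_mod kw' u)
      moreover have "((arr s' ''S'')(?z := ?t U (Suc k) ?z)) z = ?t U (Suc k) z" for z
        using IS[OF k(2), of z] tstep[where U = U and x = k and z = z, OF UV(1)]
        by (cases "z = ?z") (simp_all only: fun_upd_same fun_upd_other if_False add_0_right not_False_eq_True)
      moreover have "((arr s' ''Z'')(?z := ?t V (Suc k) ?z)) z = ?t V (Suc k) z" for z
        using IZ[OF k(2), of z] tstep[where U = V and x = k and z = z, OF UV(2)]
        by (cases "z = ?z") (simp_all only: fun_upd_same fun_upd_other if_False add_0_right not_False_eq_True)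
      ultimately show "I (Suc k) (sem W \<rho> get_body s')"
        unfolding I_def using Ik by simp
    qed (simp_all add: get_body_def)
  next
    fix s' assume I: "I nbit s'"
    show "aval W \<rho> s' (Bin Less (Reg ''x'') (Reg ''H'')) = 0"
      using Ix[OF I] envD(9)[OF e'[OF I]] by simp
    show "Post s'"
    proof (rule post[OF Ia[OF I]])
      fix z assume z: "z < 3 * ncell"
      have "Suc z * width \<le> nbit" unfolding nbit_def using z by (intro mult_right_mono) auto
      then have "width \<le> nbit - z * width" by simp
      then have "(2::nat) ^ width \<le> 2 ^ (nbit - z * width)" by (rule power_increasing) simp
      then have "?t U nbit z = cell \<rho> U z" "?t V nbit z = cell \<rho> V z"
        using less_le_trans[OF cell_less_width[where U = U and \<rho> = \<rho> and z = z, OF UV(1)]]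
          less_le_trans[OF cell_less_width[where U = V and \<rho> = \<rho> and z = z, OF UV(2)]]
        unfolding take_bit_nat_eq_self_iff by blast+
      then show "arr s' ''S'' z = cell \<rho> U z \<and> arr s' ''Z'' z = cell \<rho> V z"
        using IS[OF I] IZ[OF I] by simp
    qed
  qed (use B in simp)
qed

end

lemma sem_block: "sem W \<rho> (block (c # cs)) s = sem W \<rho> (block cs) (sem W \<rho> c s)"
  "sem W \<rho> (block []) s = s"
  by simp_all

section \<open>Decoding one cell and counting triples\<close>

context hmr
begin

lemma less_word_mono: "y < 2 ^ W \<Longrightarrow> x \<le> y \<Longrightarrow> x mod 2 ^ W = (x :: nat)"
  by (intro mod_less) simp

text \<open>Truncated subtraction, division and remainder do not commute with reduction modulo
  \<open>2 ^ W\<close>; in decoding every intermediate value therefore has to be bounded, and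
  \<open>p ^ 4\<close> is a common bound.\<close>

lemma p4_word: "x \<le> p ^ 4 \<Longrightarrow> x mod 2 ^ W = x"
proof -
  assume "x \<le> p ^ 4"
  also have "\<dots> \<le> Q ^ 4" by (intro power_mono) auto
  finally have "x \<le> Q ^ 4" .
  from less_word[OF le_trans[OF this Q_pow_le]] show "x mod 2 ^ W = x" by simp
qed

lemma p3_le_p4: "8 * p ^ 3 \<le> p ^ 4" "8 * p \<le> p ^ 4" "64 * N * p \<le> p ^ 3"
proof -
  have "8 * p ^ 3 \<le> p * p ^ 3" using p_ge_256 by (intro mult_right_mono) auto
  then show "8 * p ^ 3 \<le> p ^ 4" by (simp add: numeral_eq_Suc)
  moreover have "p * 1 \<le> p * (p * p)" using p_ge_256 by (intro mult_left_mono) auto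
  then have "p \<le> p ^ 3" by (simp add: power3_eq_cube)
  ultimately show "8 * p \<le> p ^ 4" by linarith
  have "64 * N * p \<le> p * p * p" using p_ge_256 N_le_p by (intro mult_mono) auto
  then show "64 * N * p \<le> p ^ 3" by (simp only: power3_eq_cube)
qed

lemma guess_step:
  fixes s :: state and \<rho> :: "nat \<Rightarrow> nat"
  assumes e: "env_of s" and K: "reg s ''k'' = K" "Suc K < 2 ^ W" and r: "reg s ''r'' < nrep"
    and SZ: "\<forall>i\<le>1. arr s ''S'' (K + i) < p ^ 3 \<and> arr s ''Z'' (K + i) < p ^ 3"
    and g: "guess (arr s ''S'' K) (arr s ''Z'' K) (arr s ''S'' (Suc K)) (arr s ''Z'' (Suc K)) = (x, a, b)"
  defines "s' \<equiv> sem W \<rho> guess_cmds s"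
  shows "same {''e'', ''c'', ''x'', ''v'', ''a'', ''b'', ''f''} {} s s'"
    "reg s' ''x'' = x" "reg s' ''a'' = a" "reg s' ''b'' = b" "reg s' ''f'' = fp \<rho> (reg s ''r'') x"
proof -
  let ?S = "arr s ''S''" and ?Z = "arr s ''Z''"
  let ?p2 = "2 * p"
  define E where "E = (?S K - ?Z K) + (?Z K - ?S K)"
  define M where "M = (?S (Suc K) - ?Z (Suc K)) + (?Z (Suc K) - ?S (Suc K))"
  define C where "C = M div E"
  have K1: "(Suc K) mod 2 ^ W = Suc K" "(K + 1) mod 2 ^ W = Suc K" using K(2) by simp_all
  have b0: "?S K < p ^ 3" "?Z K < p ^ 3" "?S (Suc K) < p ^ 3" "?Z (Suc K) < p ^ 3"
    using spec[OF SZ, of 0] spec[OF SZ, of 1] by auto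
  note p4 = p3_le_p4
  have x: "x = C div ?p2 mod N" and a: "a = (C mod ?p2 + ?S K - ?Z K) div 2 mod p"
    and b: "b = (C mod ?p2 + ?Z K - ?S K) div 2 mod p"
    using g by (simp_all add: guess_def Let_def E_def M_def C_def)
  have d: "aval W \<rho> s (dist_exp (Reg ''k'')) = E"
  proof -
    have "(?S K - ?Z K) mod 2 ^ W = ?S K - ?Z K" "(?Z K - ?S K) mod 2 ^ W = ?Z K - ?S K"
      using b0 p4(1) by (intro p4_word; linarith)+
    moreover have "E mod 2 ^ W = E" unfolding E_def using b0 p4(1) by (intro p4_word) linarith
    ultimately show ?thesis by (simp add: dist_exp_def K(1) E_def)
  qed
  define s1 where "s1 = s\<lparr>reg := (reg s)(''e'' := E)\<rparr>"
  have s1: "sem W \<rho> (Assign ''e'' (dist_exp (Reg ''k''))) s = s1"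
    unfolding sem.simps d s1_def ..
  have r1: "arr s1 = arr s" "reg s1 ''k'' = K" "reg s1 ''e'' = E" "env_of s1"
    using K(1) e by (simp_all add: s1_def)
  have Mle: "M \<le> p ^ 4" unfolding M_def using b0 p4(1) by linarith
  then have Cle: "C \<le> p ^ 4" unfolding C_def using div_le_dividend[of M E] by (rule order_trans[rotated])
  have d1: "aval W \<rho> s1 (dist_exp (Bin Add (Reg ''k'') (Const 1))) = M"
  proof -
    have "(?S (Suc K) - ?Z (Suc K)) mod 2 ^ W = ?S (Suc K) - ?Z (Suc K)"
      "(?Z (Suc K) - ?S (Suc K)) mod 2 ^ W = ?Z (Suc K) - ?S (Suc K)"
      using b0 p4(1) by (intro p4_word; linarith)+
    moreover have "M mod 2 ^ W = M" using Mle by (rule p4_word)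
    ultimately show ?thesis using W_pos by (simp add: dist_exp_def r1 const_mod K1 M_def)
  qed
  define s2 where "s2 = s1\<lparr>reg := (reg s1)(''c'' := C)\<rparr>"
  have s2: "sem W \<rho> (Assign ''c'' (Bin Div (dist_exp (Bin Add (Reg ''k'') (Const 1))) (Reg ''e''))) s1 = s2"
  proof -
    have "aval W \<rho> s1 (Bin Div (dist_exp (Bin Add (Reg ''k'') (Const 1))) (Reg ''e'')) = C"
      by (simp only: aval.simps(2,5) bop_val.simps d1 r1(3) C_def[symmetric] p4_word[OF Cle])
    then show ?thesis by (simp only: sem.simps s2_def)
  qed
  have p2: "?p2 mod 2 ^ W = ?p2" using p4(2) by (intro p4_word) linarith
  have r2: "reg s2 ''c'' = C" "reg s2 ''p'' = p" "reg s2 ''N'' = N" "arr s2 = arr s" "reg s2 ''k'' = K"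
    using envD(2,3)[OF r1(4)] r1 by (simp_all add: s2_def)
  have Cx: "C div ?p2 mod 2 ^ W = C div ?p2" "C mod ?p2 mod 2 ^ W = C mod ?p2" "x mod 2 ^ W = x"
    using Cle div_le_dividend[of C ?p2] mod_less_eq_dividend[of C ?p2]
      mod_less_eq_dividend[of "C div ?p2" N] unfolding x by (intro p4_word; linarith)+
  define s4 where "s4 = s2\<lparr>reg := (reg s2)(''x'' := x, ''v'' := C mod ?p2)\<rparr>"
  have s4: "sem W \<rho> (block [Assign ''x'' (Bin Mod (Bin Div (Reg ''c'') (Bin Mul (Const 2) (Reg ''p''))) (Reg ''N'')),
      Assign ''v'' (Bin Mod (Reg ''c'') (Bin Mul (Const 2) (Reg ''p'')))]) s2 = s4"
    using Cx by (simp add: r2 s4_def const_mod p2 x)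
  have V: "C mod ?p2 < ?p2" using p_ge_256 by (intro mod_less_divisor) simp
  have hm: "(C mod ?p2 + ?S K) mod 2 ^ W = C mod ?p2 + ?S K" "(C mod ?p2 + ?Z K) mod 2 ^ W = C mod ?p2 + ?Z K"
    "(C mod ?p2 + ?S K - ?Z K) mod 2 ^ W = C mod ?p2 + ?S K - ?Z K"
    "(C mod ?p2 + ?Z K - ?S K) mod 2 ^ W = C mod ?p2 + ?Z K - ?S K"
    "((C mod ?p2 + ?S K - ?Z K) div 2) mod 2 ^ W = (C mod ?p2 + ?S K - ?Z K) div 2"
    "((C mod ?p2 + ?Z K - ?S K) div 2) mod 2 ^ W = (C mod ?p2 + ?Z K - ?S K) div 2"
    using b0 p4(1,2) V by (intro p4_word; linarith)+
  have abl: "a < p" "b < p" unfolding a b using p_ge_256 by auto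
  have ab: "a mod 2 ^ W = a" "b mod 2 ^ W = b"
    using abl p4(2) by (intro p4_word; linarith)+
  define s6 where "s6 = s4\<lparr>reg := (reg s4)(''a'' := a, ''b'' := b)\<rparr>"
  have r4: "reg s4 ''v'' = C mod ?p2" "reg s4 ''k'' = K" "reg s4 ''p'' = p" "arr s4 = arr s"
    by (simp_all add: s4_def r2)
  have s6: "sem W \<rho> (block [Assign ''a'' (half_exp ''S'' ''Z''), Assign ''b'' (half_exp ''Z'' ''S'')]) s4 = s6"
    using ab unfolding s6_def a b by (simp add: half_exp_def r4 const_mod hm)
  have e6: "env_of s6" using e by (simp add: s6_def s4_def s2_def s1_def)
  have r6: "reg s6 ''r'' = reg s ''r''" "reg s6 ''x'' = x" by (simp_all add: s6_def s4_def s2_def s1_def)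
  have xN: "x < N" using g by (rule guess_less)
  have f: "aval W \<rho> s6 fp_exp = fp \<rho> (reg s ''r'') x"
    using aval_fp_exp[OF e6] r6 r xN by simp
  have s': "s' = s6\<lparr>reg := (reg s6)(''f'' := fp \<rho> (reg s ''r'') x)\<rparr>"
    unfolding s'_def guess_cmds_def using s1 s2 s4 s6 f by (simp only: sem_block sem.simps)
  show "same {''e'', ''c'', ''x'', ''v'', ''a'', ''b'', ''f''} {} s s'"
    "reg s' ''x'' = x" "reg s' ''a'' = a" "reg s' ''b'' = b" "reg s' ''f'' = fp \<rho> (reg s ''r'') x"
    by (simp_all add: s' s6_def s4_def s2_def s1_def)
qed

lemma aval_check_exp:
  fixes s :: state
  assumes K: "reg s ''k'' = K" "K + 2 < 2 ^ W"
    and SZ: "arr s ''S'' (K + 2) < p ^ 3" "arr s ''Z'' (K + 2) < p ^ 3"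
    and ab: "reg s ''a'' < p" "reg s ''b'' < p" and f: "reg s ''f'' < 64 * N"
  shows "aval W \<rho> s check_exp = (if arr s ''S'' (K + 2) + reg s ''f'' * reg s ''b'' =
     arr s ''Z'' (K + 2) + reg s ''f'' * reg s ''a'' then 1 else 0)"
proof -
  have "reg s ''f'' * reg s ''b'' \<le> 64 * N * p" "reg s ''f'' * reg s ''a'' \<le> 64 * N * p"
    using ab f by (intro mult_mono; simp)+
  then have "arr s ''S'' (K + 2) + reg s ''f'' * reg s ''b'' \<le> p ^ 4" "arr s ''Z'' (K + 2) + reg s ''f'' * reg s ''a'' \<le> p ^ 4"
    using SZ p3_le_p4(1,3) by linarith+
  then have "(arr s ''S'' (K + 2) + reg s ''f'' * reg s ''b'') mod 2 ^ W = arr s ''S'' (K + 2) + reg s ''f'' * reg s ''b''"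
    "(arr s ''Z'' (K + 2) + reg s ''f'' * reg s ''a'') mod 2 ^ W = arr s ''Z'' (K + 2) + reg s ''f'' * reg s ''a''"
    by (blast intro: p4_word)+
  moreover have "(K + 2) mod 2 ^ W = K + 2" using K(2) by simp
  ultimately show ?thesis
    using W_pos K(1) unfolding check_exp_def aval.simps bop_val.simps const_mod mod_add_right_eq by (simp add: const_mod)
qed

text \<open>The triple read as a number with two low digits in base \<open>p\<close>; the leading
  digit needs no bound for injectivity.\<close>

definition key :: "nat \<times> nat \<times> nat \<Rightarrow> nat" where
  "key = (\<lambda>(x, a, b). (x * p + a) * p + b)"

definition in_range :: "nat \<times> nat \<times> nat \<Rightarrow> bool" where
  "in_range = (\<lambda>(x, a, b). a < p \<and> b < p)"

lemma key_inj:
  assumes "key u = key v" "in_range u" "in_range v"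
  shows "u = v"
proof -
  obtain x a b x' a' b' where u: "u = (x, a, b)" and v: "v = (x', a', b')"
    by (cases u, cases v) auto
  have eq: "(x * p + a) * p + b = (x' * p + a') * p + b'" and lt: "a < p" "b < p" "a' < p" "b' < p"
    using assms unfolding u v key_def in_range_def by auto
  note 1 = mixed_radix_eqD[OF eq lt(2,4)]
  note 2 = mixed_radix_eqD[OF 1(1) lt(1,3)]
  show ?thesis using 1(2) 2 u v by simp
qed

lemma guess_in_range:
  assumes "guess a1 a2 b1 b2 = (x, a, b)"
  shows "a < p" "b < p"
proof -
  have p: "0 < p" using p_ge_256 by simp
  have "a = fst (snd (guess a1 a2 b1 b2))" using assms by simp
  also have "\<dots> < p" unfolding guess_def Let_def fst_conv snd_conv using p by (rule mod_less_divisor)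
  finally show "a < p" .
  have "b = snd (snd (guess a1 a2 b1 b2))" using assms by simp
  also have "\<dots> < p" unfolding guess_def Let_def fst_conv snd_conv using p by (rule mod_less_divisor)
  finally show "b < p" .
qed

lemma cand_in_range: "cand \<rho> S Z y = Some k \<Longrightarrow> in_range k"
  unfolding cand_def in_range_def using guess_in_range by (auto split: prod.splits if_splits)

text \<open>The bounds on \<open>cnt\<close> and \<open>n\<close> rule out overflow of the two
  counters.\<close>

lemma record_step:
  fixes s :: state and \<rho> :: "nat \<Rightarrow> nat"
  assumes e: "env_of s" and x: "reg s ''x'' < N" "reg s ''a'' < p" "reg s ''b'' < p"
    and r: "reg s ''r'' < nrep" and n: "reg s ''n'' \<le> \<kappa> 0"
    and cnt: "arr s ''cnt'' K \<le> nrep"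
    and K: "K = key (reg s ''x'', reg s ''a'', reg s ''b'')"
  defines "s' \<equiv> sem W \<rho> record_cmds s"
  defines "new \<equiv> arr s ''last'' K \<noteq> Suc (reg s ''r'')"
  defines "out \<equiv> new \<and> arr s ''cnt'' K = thr \<and> reg s ''n'' < \<kappa> 0"
  shows "same {''k'', ''n''} {''last'', ''cnt'', ''i'', ''a'', ''b''} s s'"
    "arr s' ''last'' = (if new then (arr s ''last'')(K := Suc (reg s ''r'')) else arr s ''last'')"
    "arr s' ''cnt'' = (if new then (arr s ''cnt'')(K := Suc (arr s ''cnt'' K)) else arr s ''cnt'')"
    "reg s' ''n'' = (if out then Suc (reg s ''n'') else reg s ''n'')"
    "arr s' ''i'' = (if out then (arr s ''i'')(reg s ''n'' := reg s ''x'') else arr s ''i'')"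
    "arr s' ''a'' = (if out then (arr s ''a'')(reg s ''n'' := reg s ''a'') else arr s ''a'')"
    "arr s' ''b'' = (if out then (arr s ''b'')(reg s ''n'' := reg s ''b'') else arr s ''b'')"
proof -
  have "reg s ''x'' * p + reg s ''a'' < N * p" using x by (intro mixed_radix_less) auto
  then have "K < N * p * p" unfolding K key_def prod.case using x by (intro mixed_radix_less) auto
  also have "\<dots> \<le> p * p * p" using N_le_p by (intro mult_right_mono) auto
  also have "\<dots> = p ^ 3" by (simp add: power3_eq_cube)
  finally have "K \<le> p ^ 4" using p3_le_p4(1) by linarith
  then have Kw: "((reg s ''x'' * p + reg s ''a'') * p + reg s ''b'') mod 2 ^ W = K"
    using p4_word unfolding K key_def by simp
  define s1 where "s1 = s\<lparr>reg := (reg s)(''k'' := K)\<rparr>"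
  have s1: "sem W \<rho> (Assign ''k'' (Bin Add (Bin Mul (Bin Add (Bin Mul (Reg ''x'') (Reg ''p'')) (Reg ''a'')) (Reg ''p'')) (Reg ''b''))) s = s1"
    using Kw by (simp add: s1_def envD(2)[OF e] mod_simps)
  have w: "Suc (reg s ''r'') mod 2 ^ W = Suc (reg s ''r'')" "Suc thr mod 2 ^ W = Suc thr"
    "Suc (arr s ''cnt'' K) mod 2 ^ W = Suc (arr s ''cnt'' K)"
  proof -
    have q: "Suc nrep < 2 ^ W"
    proof -
      have "Suc nrep \<le> 5 * Q" using nrep_le p_ge_256 by simp
      also have "\<dots> \<le> Q * Q" using p_ge_256 by (intro mult_right_mono) auto
      also have "\<dots> = Q ^ 2" by (simp add: power2_eq_square)
      finally have "Suc nrep \<le> Q ^ 2" .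
      from less_word[OF le_trans[OF this Q_pow_le]] show ?thesis by simp
    qed
    show "Suc (reg s ''r'') mod 2 ^ W = Suc (reg s ''r'')" "Suc (arr s ''cnt'' K) mod 2 ^ W = Suc (arr s ''cnt'' K)"
      using r cnt by (auto intro!: less_word_mono[OF q])
    show "Suc thr mod 2 ^ W = Suc thr" by (rule less_word_mono[OF q]) (simp add: nrep_def)
  qed
  have nw: "reg s ''n'' < \<kappa> 0 \<Longrightarrow> Suc (reg s ''n'') mod 2 ^ W = Suc (reg s ''n'')"
    using kap0_le by (intro less_word_mono[OF N_less_word]) simp
  have z1: "reg s ''z'' = thr" "arr s ''kappa'' 0 = \<kappa> 0" using envD(6,10)[OF e] by auto
  have s'1: "s' = sem W \<rho> (Cond (Bin Equal (Elem ''last'' (Reg ''k'')) (Bin Add (Reg ''r'') (Const 1))) Skip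
        (block
          [Store ''last'' (Reg ''k'') (Bin Add (Reg ''r'') (Const 1)),
           Store ''cnt'' (Reg ''k'') (Bin Add (Elem ''cnt'' (Reg ''k'')) (Const 1)),
           Cond (Bin Equal (Elem ''cnt'' (Reg ''k'')) (Bin Add (Reg ''z'') (Const 1)))
             (Cond (Bin Less (Reg ''n'') (Elem ''kappa'' (Const 0)))
               (block
                 [Store ''i'' (Reg ''n'') (Reg ''x''),
                  Store ''a'' (Reg ''n'') (Reg ''a''),
                  Store ''b'' (Reg ''n'') (Reg ''b''),
                  Assign ''n'' (Bin Add (Reg ''n'') (Const 1))])
               Skip)
             Skip])) s1"
    unfolding s'_def record_cmds_def sem_block s1 ..
  have res: "s' = (if \<not> new then s1 else
     let A = (arr s)(''last'' := (arr s ''last'')(K := Suc (reg s ''r'')), ''cnt'' := (arr s ''cnt'')(K := Suc (arr s ''cnt'' K))) in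
     if out then s1\<lparr>reg := (reg s1)(''n'' := Suc (reg s ''n'')), arr := A(''i'' := (arr s ''i'')(reg s ''n'' := reg s ''x''),
         ''a'' := (arr s ''a'')(reg s ''n'' := reg s ''a''), ''b'' := (arr s ''b'')(reg s ''n'' := reg s ''b''))\<rparr>
     else s1\<lparr>arr := A\<rparr>)"
  proof (cases new)
    case False
    then show ?thesis unfolding s'1 using W_pos by (simp add: s1_def new_def const_mod w)
  next
    case True
    then have nl: "arr s ''last'' K \<noteq> Suc (reg s ''r'')" by (simp add: new_def)
    show ?thesis
    proof (cases "arr s ''cnt'' K = thr")
      case c: True
      show ?thesis
      proof (cases "reg s ''n'' < \<kappa> 0")
        case n: True
        then show ?thesis unfolding s'1 using W_pos True nl c
          by (simp add: s1_def out_def const_mod w z1 nw Let_def)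
      next
        case n: False
        then show ?thesis unfolding s'1 using W_pos True nl c
          by (simp add: s1_def out_def const_mod w z1 Let_def)
      qed
    next
      case c: False
      then show ?thesis unfolding s'1 using W_pos True nl
        by (simp add: s1_def out_def const_mod w z1 Let_def)
    qed
  qed
  have "out \<Longrightarrow> new" by (simp add: out_def)
  then show "same {''k'', ''n''} {''last'', ''cnt'', ''i'', ''a'', ''b''} s s'"
    "arr s' ''last'' = (if new then (arr s ''last'')(K := Suc (reg s ''r'')) else arr s ''last'')"
    "arr s' ''cnt'' = (if new then (arr s ''cnt'')(K := Suc (arr s ''cnt'' K)) else arr s ''cnt'')"
    "reg s' ''n'' = (if out then Suc (reg s ''n'') else reg s ''n'')"
    "arr s' ''i'' = (if out then (arr s ''i'')(reg s ''n'' := reg s ''x'') else arr s ''i'')"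
    "arr s' ''a'' = (if out then (arr s ''a'')(reg s ''n'' := reg s ''a'') else arr s ''a'')"
    "arr s' ''b'' = (if out then (arr s ''b'')(reg s ''n'' := reg s ''b'') else arr s ''b'')"
    unfolding res by (cases new; cases out; simp add: Let_def s1_def)+
qed


abbreviation grp :: "nat \<Rightarrow> nat" where "grp \<equiv> \<lambda>y. y div \<kappa> 0"

abbreviation decode_regs :: "name set" where
  "decode_regs \<equiv> {''r'', ''k'', ''e'', ''c'', ''x'', ''v'', ''a'', ''b'', ''f'', ''n'', ''y''}"

abbreviation decode_arrs :: "name set" where
  "decode_arrs \<equiv> {''last'', ''cnt'', ''i'', ''a'', ''b''}"

lemma three_ncell_word: "3 * ncell < 2 ^ W"
proof -
  have "3 * ncell * 1 \<le> 3 * ncell * width" using width_pos by (intro mult_left_mono) auto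
  then show ?thesis using sizes_less(5) unfolding nbit_def by linarith
qed

definition decode_core :: com where
  "decode_core = Cond (Bin Equal (Elem ''S'' (Reg ''k'')) (Elem ''Z'' (Reg ''k''))) Skip
     (Seq guess_cmds (Cond check_exp record_cmds Skip))"

lemma core_step:
  fixes s :: state and \<rho> :: "nat \<Rightarrow> nat"
  assumes e: "env_of s" and y: "y < ncell" "reg s ''r'' = grp y" "reg s ''k'' = 3 * y"
    and SZ: "\<forall>z<3 * ncell. arr s ''S'' z < p ^ 3 \<and> arr s ''Z'' z < p ^ 3"
    and n: "reg s ''n'' \<le> \<kappa> 0" and cnt: "\<forall>k. in_range k \<longrightarrow> arr s ''cnt'' (key k) \<le> nrep"
  defines "s' \<equiv> sem W \<rho> decode_core s" and "c \<equiv> cand \<rho> (arr s ''S'') (arr s ''Z'') y"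
  shows "same (decode_regs - {''y''}) decode_arrs s s'"
    and "c = None \<Longrightarrow> reg s' ''n'' = reg s ''n'' \<and> (\<forall>A\<in>decode_arrs. arr s' A = arr s A)"
    and "c = Some (x, a, b) \<Longrightarrow>
      (let K = key (x, a, b); new = (arr s ''last'' K \<noteq> Suc (grp y));
           out = (new \<and> arr s ''cnt'' K = thr \<and> reg s ''n'' < \<kappa> 0); n = reg s ''n'' in
       arr s' ''last'' = (if new then (arr s ''last'')(K := Suc (grp y)) else arr s ''last'') \<and>
       arr s' ''cnt'' = (if new then (arr s ''cnt'')(K := Suc (arr s ''cnt'' K)) else arr s ''cnt'') \<and>
       reg s' ''n'' = (if out then Suc n else n) \<and>
       arr s' ''i'' = (if out then (arr s ''i'')(n := x) else arr s ''i'') \<and>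
       arr s' ''a'' = (if out then (arr s ''a'')(n := a) else arr s ''a'') \<and>
       arr s' ''b'' = (if out then (arr s ''b'')(n := b) else arr s ''b''))"
proof -
  let ?S = "arr s ''S''" and ?Z = "arr s ''Z''"
  have y3: "3 * y + 2 < 3 * ncell" using y(1) by simp
  then have yw: "Suc (3 * y) < 2 ^ W" "3 * y + 2 < 2 ^ W" using three_ncell_word by auto
  have r: "reg s ''r'' < nrep"
    unfolding y(2) using y(1) kap0_pos by (simp add: ncell_def div_less_iff_less_mult)
  obtain X A B where g: "guess (?S (3 * y)) (?Z (3 * y)) (?S (Suc (3 * y))) (?Z (Suc (3 * y))) = (X, A, B)"
    by (cases "guess (?S (3 * y)) (?Z (3 * y)) (?S (Suc (3 * y))) (?Z (Suc (3 * y)))")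
  let ?chk = "?S (3 * y + 2) + fp \<rho> (grp y) X * B = ?Z (3 * y + 2) + fp \<rho> (grp y) X * A"
  have c: "c = (if ?S (3 * y) \<noteq> ?Z (3 * y) \<and> ?chk then Some (X, A, B) else None)"
    unfolding c_def cand_def using g by simp
  have eq: "aval W \<rho> s (Bin Equal (Elem ''S'' (Reg ''k'')) (Elem ''Z'' (Reg ''k''))) = (if ?S (3 * y) = ?Z (3 * y) then 1 else 0)"
    using y(3) W_pos by (simp add: const_mod)
  have SZ1: "\<forall>i\<le>1. ?S (3 * y + i) < p ^ 3 \<and> ?Z (3 * y + i) < p ^ 3"
  proof (intro allI impI)
    fix i :: nat assume "i \<le> 1"
    then have "3 * y + i < 3 * ncell" using y3 by simp
    then show "?S (3 * y + i) < p ^ 3 \<and> ?Z (3 * y + i) < p ^ 3" using SZ by blast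
  qed
  define s2 where "s2 = sem W \<rho> guess_cmds s"
  note g2 = guess_step[OF e y(3) yw(1) r SZ1 g, of \<rho>, folded s2_def]
  have S2: "arr s2 A = arr s A" for A by (rule agree_arrD[OF g2(1)]) simp
  have r2: "reg s2 ''r'' = grp y" "reg s2 ''k'' = 3 * y" "reg s2 ''n'' = reg s ''n''"
    using agree_regD[OF g2(1), of "''r''"] agree_regD[OF g2(1), of "''k''"] agree_regD[OF g2(1), of "''n''"] y(2,3)
    by auto
  have e2: "env_of s2" by (rule env_agree[OF g2(1) e]) auto
  have rg: "X < N" "A < p" "B < p" using guess_less[OF g] guess_in_range[OF g] by auto
  have chk: "aval W \<rho> s2 check_exp = (if ?chk then 1 else 0)"
  proof -
    have "fp \<rho> (grp y) X < 64 * N" unfolding fp_def using N_pos by simp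
    then show ?thesis
      using aval_check_exp[OF r2(2) yw(2), of \<rho>] SZ[rule_format, OF y3] rg g2(2-5) y(2) by (simp add: S2)
  qed
  have s': "s' = (if ?S (3 * y) = ?Z (3 * y) then s else if ?chk then sem W \<rho> record_cmds s2 else s2)"
    unfolding s'_def decode_core_def sem.simps s2_def[symmetric] eq chk by simp
  have a2: "same (decode_regs - {''y''}) decode_arrs s s2"
    by (rule agree_trans[OF g2(1) agree_refl[of "{}" "{}"]]) auto
  have kk: "key (reg s2 ''x'', reg s2 ''a'', reg s2 ''b'') = key (X, A, B)"
    using g2 by simp
  have rec: "reg s2 ''x'' < N" "reg s2 ''a'' < p" "reg s2 ''b'' < p" "reg s2 ''r'' < nrep" "reg s2 ''n'' \<le> \<kappa> 0"
    "arr s2 ''cnt'' (key (X, A, B)) \<le> nrep"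
    using g2 rg r2 r y(2) n spec[OF cnt, of "(X, A, B)"] S2 by (simp_all add: in_range_def)
  note rs = record_step[OF e2 rec kk[symmetric], of \<rho>]
  show "same (decode_regs - {''y''}) decode_arrs s s'"
  proof -
    have "agree (decode_regs - {''y''}) decode_arrs (reg s) (arr s)
        (reg (sem W \<rho> record_cmds s2)) (arr (sem W \<rho> record_cmds s2))"
      by (rule agree_trans[OF a2 rs(1)]) auto
    then show ?thesis using a2 unfolding s' by simp
  qed
  show "reg s' ''n'' = reg s ''n'' \<and> (\<forall>A\<in>decode_arrs. arr s' A = arr s A)" if "c = None"
  proof -
    have "s' = s \<or> s' = s2" using that unfolding s' c by (auto split: if_splits)
    then show ?thesis using S2 r2(3) by (elim disjE) simp_all
  qed
  assume "c = Some (x, a, b)"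
  then have "?S (3 * y) \<noteq> ?Z (3 * y)" "?chk" "x = X" "a = A" "b = B"
    unfolding c by (auto split: if_splits)
  then have st: "s' = sem W \<rho> record_cmds s2" unfolding s' by simp
  show "let K = key (x, a, b); new = (arr s ''last'' K \<noteq> Suc (grp y));
           out = (new \<and> arr s ''cnt'' K = thr \<and> reg s ''n'' < \<kappa> 0); n = reg s ''n'' in
       arr s' ''last'' = (if new then (arr s ''last'')(K := Suc (grp y)) else arr s ''last'') \<and>
       arr s' ''cnt'' = (if new then (arr s ''cnt'')(K := Suc (arr s ''cnt'' K)) else arr s ''cnt'') \<and>
       reg s' ''n'' = (if out then Suc n else n) \<and>
       arr s' ''i'' = (if out then (arr s ''i'')(n := x) else arr s ''i'') \<and>
       arr s' ''a'' = (if out then (arr s ''a'')(n := a) else arr s ''a'') \<and>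
       arr s' ''b'' = (if out then (arr s ''b'')(n := b) else arr s ''b'')"
    using rs(2-7) unfolding st Let_def \<open>x = X\<close> \<open>a = A\<close> \<open>b = B\<close> S2 r2 g2(2-4) by blast
qed

text \<open>
  Cells are visited repetition by repetition, so comparing \<open>last\<close>, one more than the last repetition
  in which a triple was seen, with the current one prevents counting a triple twice per repetition.
\<close>

definition decode_inv :: "(nat \<Rightarrow> (nat \<times> nat \<times> nat) option) \<Rightarrow> nat \<Rightarrow> nat \<Rightarrow> (name \<Rightarrow> nat \<Rightarrow> nat) \<Rightarrow> bool" where
  "decode_inv c y n g \<longleftrightarrow>
     (let xs = take (\<kappa> 0) (emitted c grp thr y) in
      n = length xs \<and> (\<forall>k<length xs. (g ''i'' k, g ''a'' k, g ''b'' k) = xs ! k) \<and>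
      (\<forall>k. in_range k \<longrightarrow> g ''cnt'' (key k) = card (seen c grp y k) \<and>
         g ''last'' (key k) = (if seen c grp y k = {} then 0 else Suc (Max (seen c grp y k)))))"

lemma seen_le: "r \<in> seen c grp y k \<Longrightarrow> r \<le> grp y"
  by (auto simp: seen_def intro: div_le_mono)

text \<open>Repetitions are visited in nondecreasing order, so the current one has been seen exactly
  if it is the maximum. The successor keeps the value 0 free for triples never seen.\<close>

lemma last_eq_iff:
  "(if seen c grp y k = {} then 0 else Suc (Max (seen c grp y k))) = Suc (grp y) \<longleftrightarrow> grp y \<in> seen c grp y k"
proof (cases "seen c grp y k = {}")
  case False
  then have "Max (seen c grp y k) \<in> seen c grp y k" using finite_seen by (rule Max_in[rotated])
  moreover have "Max (seen c grp y k) = grp y" if "grp y \<in> seen c grp y k"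
    using that finite_seen seen_le by (intro Max_eqI) auto
  ultimately show ?thesis using False by auto
qed simp

lemma card_seen_le:
  assumes "y \<le> ncell"
  shows "card (seen c grp y k) \<le> nrep"
proof -
  have "seen c grp y k \<subseteq> {..<nrep}"
    using assms kap0_pos by (auto simp: seen_def ncell_def div_less_iff_less_mult)
  then have "card (seen c grp y k) \<le> card {..<nrep}" by (intro card_mono) auto
  then show ?thesis by simp
qed

lemma decode_inv_None:
  assumes "decode_inv c y n g" "c y = None" "\<And>A. A \<in> decode_arrs \<Longrightarrow> g' A = g A"
  shows "decode_inv c (Suc y) n g'"
proof -
  have "g' ''i'' = g ''i''" "g' ''a'' = g ''a''" "g' ''b'' = g ''b''" "g' ''cnt'' = g ''cnt''" "g' ''last'' = g ''last''"
    by (rule assms(3), simp)+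
  moreover have "seen c grp (Suc y) k = seen c grp y k" for k using assms(2) by (simp add: seen_Suc)
  moreover have "emitted c grp thr (Suc y) = emitted c grp thr y" using assms(2) by simp
  ultimately show ?thesis using assms(1) unfolding decode_inv_def by simp
qed

lemma decode_inv_Some:
  assumes inv: "decode_inv c y n g" and c: "c y = Some k" "in_range k"
    and g': "let K = key k; new = (g ''last'' K \<noteq> Suc (grp y));
           out = (new \<and> g ''cnt'' K = thr \<and> n < \<kappa> 0) in
       g' ''last'' = (if new then (g ''last'')(K := Suc (grp y)) else g ''last'') \<and>
       g' ''cnt'' = (if new then (g ''cnt'')(K := Suc (g ''cnt'' K)) else g ''cnt'') \<and>
       n' = (if out then Suc n else n) \<and>
       g' ''i'' = (if out then (g ''i'')(n := fst k) else g ''i'') \<and>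
       g' ''a'' = (if out then (g ''a'')(n := fst (snd k)) else g ''a'') \<and>
       g' ''b'' = (if out then (g ''b'')(n := snd (snd k)) else g ''b'')"
  shows "decode_inv c (Suc y) n' g'"
proof -
  define K where "K = key k"
  define em where "em = emitted c grp thr y"
  define new where "new \<longleftrightarrow> g ''last'' K \<noteq> Suc (grp y)"
  define out where "out \<longleftrightarrow> new \<and> g ''cnt'' K = thr \<and> n < \<kappa> 0"
  have I: "n = length (take (\<kappa> 0) em)" "\<forall>k<length (take (\<kappa> 0) em). (g ''i'' k, g ''a'' k, g ''b'' k) = take (\<kappa> 0) em ! k"
    and J: "\<And>k. in_range k \<Longrightarrow> g ''cnt'' (key k) = card (seen c grp y k) \<and>
         g ''last'' (key k) = (if seen c grp y k = {} then 0 else Suc (Max (seen c grp y k)))"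
    using inv unfolding decode_inv_def Let_def em_def by blast+
  have G: "g' ''last'' = (if new then (g ''last'')(K := Suc (grp y)) else g ''last'')"
    "g' ''cnt'' = (if new then (g ''cnt'')(K := Suc (g ''cnt'' K)) else g ''cnt'')"
    "n' = (if out then Suc n else n)"
    "g' ''i'' = (if out then (g ''i'')(n := fst k) else g ''i'')"
    "g' ''a'' = (if out then (g ''a'')(n := fst (snd k)) else g ''a'')"
    "g' ''b'' = (if out then (g ''b'')(n := snd (snd k)) else g ''b'')"
    using g' unfolding Let_def K_def[symmetric] new_def[symmetric] out_def[symmetric] by blast+
  have new: "new \<longleftrightarrow> grp y \<notin> seen c grp y k"
    using J[OF c(2)] last_eq_iff[of c y k] unfolding new_def K_def by simp
  have cntK: "g ''cnt'' K = card (seen c grp y k)" using J[OF c(2)] by (simp add: K_def)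
  have em': "emitted c grp thr (Suc y) = em @ (if new \<and> g ''cnt'' K = thr then [k] else [])"
    unfolding emitted.simps em_def c(1) new cntK by simp
  \<comment> \<open>\<open>out\<close> includes \<open>n < \<kappa> 0\<close>: once the list is
    full, \<open>take\<close> drops a newly emitted triple just as the program does.\<close>
  have xs: "take (\<kappa> 0) (emitted c grp thr (Suc y)) = take (\<kappa> 0) em @ (if out then [k] else [])"
    unfolding em' out_def using I(1) by (auto simp: min_def)
  have seen': "seen c grp (Suc y) k' = (if k' = k then insert (grp y) (seen c grp y k) else seen c grp y k')" for k'
    using c(1) by (simp add: seen_Suc)
  have 1: "n' = length (take (\<kappa> 0) (emitted c grp thr (Suc y)))"
    unfolding xs G(3) using I(1) by simp
  have 2: "(g' ''i'' j, g' ''a'' j, g' ''b'' j) = take (\<kappa> 0) (emitted c grp thr (Suc y)) ! j"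
    if "j < length (take (\<kappa> 0) (emitted c grp thr (Suc y)))" for j
  proof (cases out)
    case True
    then show ?thesis using that I unfolding xs G(4-6)
      by (cases "j = n") (auto simp: nth_append)
  next
    case False
    then show ?thesis using that I unfolding xs G(4-6) by simp
  qed
  have 3: "g' ''cnt'' (key k') = card (seen c grp (Suc y) k') \<and>
         g' ''last'' (key k') = (if seen c grp (Suc y) k' = {} then 0 else Suc (Max (seen c grp (Suc y) k')))"
    if "in_range k'" for k'
  proof (cases "k' = k")
    case True
    show ?thesis
    proof (cases new)
      case n: True
      have "Max (insert (grp y) (seen c grp y k)) = grp y"
        using finite_seen seen_le by (intro Max_eqI) auto
      moreover have "card (insert (grp y) (seen c grp y k)) = Suc (card (seen c grp y k))"
        using n new by (simp add: card_insert_if finite_seen)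
      ultimately show ?thesis using True n cntK by (simp add: G(1,2) seen' K_def)
    next
      case n: False
      then have "insert (grp y) (seen c grp y k) = seen c grp y k" using new by auto
      then show ?thesis using True n J[OF c(2)] by (simp add: G(1,2) seen')
    qed
  next
    case False
    then have "key k' \<noteq> K" using key_inj that c(2) unfolding K_def by blast
    then show ?thesis using False J[OF that] by (simp add: G(1,2) seen')
  qed
  show ?thesis unfolding decode_inv_def Let_def using 1 2 3 by blast
qed

lemma runs_decode:
  fixes s :: state and \<rho> :: "nat \<Rightarrow> nat"
  assumes e: "env_of s" and y0: "reg s ''y'' = 0" "reg s ''n'' = 0"
    and zero: "arr s ''last'' = (\<lambda>_. 0)" "arr s ''cnt'' = (\<lambda>_. 0)"
    and SZ: "\<And>z. z < 3 * ncell \<Longrightarrow> arr s ''S'' z < p ^ 3 \<and> arr s ''Z'' z < p ^ 3"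
    and B: "(ncell + 1) * 400 \<le> B"
  shows "runs W \<rho> (Loop (Bin Less (Reg ''y'') (Reg ''Y'')) decode_body) s B
    (triples_output (recovered \<rho> (arr s ''S'') (arr s ''Z'')))"
proof -
  let ?c = "cand \<rho> (arr s ''S'') (arr s ''Z'')"
  define I where "I y s' \<longleftrightarrow> same decode_regs decode_arrs s s' \<and>
    reg s' ''y'' = y \<and> decode_inv ?c y (reg s' ''n'') (arr s')" for y and s' :: state
  have Ia: "same decode_regs decode_arrs s s'" and Iy: "reg s' ''y'' = y"
    and Iv: "decode_inv ?c y (reg s' ''n'') (arr s')" if "I y s'" for y s'
    using that unfolding I_def by blast+
  have e': "env_of s'" if "I k s'" for k s' by (rule env_agree[OF Ia[OF that] e]) auto
  show ?thesis
  proof (rule runs_Loop[where I = I and n = ncell and ?B1.0 = 390])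
    show "I 0 s" using y0 zero by (simp add: I_def decode_inv_def)
  next
    fix y s' assume y: "y < ncell" "I y s'"
    show "aval W \<rho> s' (Bin Less (Reg ''y'') (Reg ''Y'')) \<noteq> 0"
      using y(1) Iy[OF y(2)] envD(8)[OF e'[OF y(2)]] W_pos by (simp add: const_mod)
    show "runs W \<rho> decode_body s' 390 (I (Suc y))"
    proof (rule runs_straight)
      have yw: "3 * y mod 2 ^ W = 3 * y" "grp y mod 2 ^ W = grp y" "Suc y mod 2 ^ W = Suc y"
        using three_ncell_word y(1) div_le_dividend[of y "\<kappa> 0"] by (auto intro!: mod_less simp del: div_le_dividend)
      have k0: "arr s' ''kappa'' 0 = \<kappa> 0" by (rule envD(10)[OF e'[OF y(2)]])
      define s1 where "s1 = s'\<lparr>reg := (reg s')(''r'' := grp y, ''k'' := 3 * y)\<rparr>"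
      have s1: "sem W \<rho> pre_cmds s' = s1"
        using yw Iy[OF y(2)] k0 by (simp add: pre_cmds_def s1_def const_mod)
      have e1: "env_of s1" using e'[OF y(2)] by (simp add: s1_def)
      have ar1: "arr s1 = arr s'" "reg s1 ''n'' = reg s' ''n''" "reg s1 ''r'' = grp y" "reg s1 ''k'' = 3 * y"
        "reg s1 ''y'' = y"
        using Iy[OF y(2)] by (simp_all add: s1_def)
      have SZ': "arr s1 ''S'' = arr s ''S''" "arr s1 ''Z'' = arr s ''Z''"
        unfolding ar1(1) using agree_arrD[OF Ia[OF y(2)], of "''S''"] agree_arrD[OF Ia[OF y(2)], of "''Z''"] by auto
      have SZ1: "\<forall>z<3 * ncell. arr s1 ''S'' z < p ^ 3 \<and> arr s1 ''Z'' z < p ^ 3"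
        unfolding SZ' using SZ by blast
      have n1: "reg s1 ''n'' \<le> \<kappa> 0"
        using Iv[OF y(2)] unfolding ar1(2) decode_inv_def Let_def by simp
      have c1: "\<forall>k. in_range k \<longrightarrow> arr s1 ''cnt'' (key k) \<le> nrep"
      proof (intro allI impI)
        fix k assume "in_range k"
        then have "arr s' ''cnt'' (key k) = card (seen ?c grp y k)"
          using Iv[OF y(2)] unfolding decode_inv_def Let_def by blast
        then show "arr s1 ''cnt'' (key k) \<le> nrep" using card_seen_le[of y ?c k] y(1) by (simp add: ar1)
      qed
      define s2 where "s2 = sem W \<rho> decode_core s1"
      note SZ'' = SZ'[unfolded ar1(1)]
      note cs = core_step[OF e1 y(1) ar1(3,4) SZ1 n1 c1, of \<rho>, folded s2_def, unfolded ar1(1,2) SZ'']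
      have y2: "reg s2 ''y'' = y" using agree_regD[OF cs(1), of "''y''"] ar1(5) by simp
      have s3: "sem W \<rho> decode_body s' = s2\<lparr>reg := (reg s2)(''y'' := Suc y)\<rparr>"
        using yw(3) y2 W_pos
        by (simp only: decode_body_def sem.simps(4) s1 decode_core_def[symmetric] s2_def[symmetric])
          (simp add: const_mod)
      have a1: "same decode_regs decode_arrs s s1"
        using Ia[OF y(2)] by (simp add: s1_def)
      have a2: "same decode_regs decode_arrs s s2"
        by (rule agree_trans[OF a1[unfolded ar1(1)] cs(1)]) auto
      have "decode_inv ?c (Suc y) (reg s2 ''n'') (arr s2)"
      proof (cases "?c y")
        case None
        have "reg s2 ''n'' = reg s' ''n''" and "\<And>A. A \<in> decode_arrs \<Longrightarrow> arr s2 A = arr s' A"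
          using cs(2)[OF None] by blast+
        then show ?thesis using decode_inv_None[OF Iv[OF y(2)] None] by simp
      next
        case (Some k)
        obtain x a b where k: "k = (x, a, b)" by (cases k)
        show ?thesis
          using cs(3)[OF Some[unfolded k]] unfolding Let_def
          by (intro decode_inv_Some[OF Iv[OF y(2)] Some cand_in_range[OF Some]])
            (simp only: k Let_def fst_conv snd_conv)
      qed
      then show "I (Suc y) (sem W \<rho> decode_body s')"
        unfolding I_def s3 using a2 by simp
    qed (simp_all add: decode_body_def pre_cmds_def guess_cmds_def record_cmds_def check_exp_def dist_exp_def
        half_exp_def fp_exp_def)
  next
    fix s' assume I: "I ncell s'"
    show "aval W \<rho> s' (Bin Less (Reg ''y'') (Reg ''Y'')) = 0"
      using Iy[OF I] envD(8)[OF e'[OF I]] by simp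
    show "triples_output (recovered \<rho> (arr s ''S'') (arr s ''Z'')) s'"
      using Iv[OF I] unfolding triples_output_def recovered_def decode_inv_def Let_def by blast
  qed (use B in simp)
qed

lemma runs_recover:
  fixes s :: state and \<rho> :: "nat \<Rightarrow> nat"
  assumes s: "penv_of s" "reg s ''n'' = 0"
    and zero: "\<And>A. A \<in> {''S'', ''Z'', ''last'', ''cnt''} \<Longrightarrow> arr s A = (\<lambda>_. 0)"
    and s12: "\<And>k. k < nbit \<Longrightarrow> arr s ''s1'' k = of_bool (sketch \<rho> U ! k) \<and> arr s ''s2'' k = of_bool (sketch \<rho> V ! k)"
    and UV: "\<And>x. x < N \<Longrightarrow> U x < p" "\<And>x. x < N \<Longrightarrow> V x < p"
    and B: "50 * (d + clog N + clog (p + 1)) + (nbit + 1) * 60 + (ncell + 1) * 400 + 300 \<le> B"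
  shows "runs W \<rho> recover_prog s B (triples_output (recover \<rho> (sketch \<rho> U) (sketch \<rho> V)))"
proof -
  let ?Q = "triples_output (recover \<rho> (sketch \<rho> U) (sketch \<rho> V))"
  have k0: "\<kappa> 0 < 2 ^ W" using kap0_le by (rule less_N_word)
  then have guard: "aval W \<rho> s (Bin Less (Bin Mul (Const 4) (Reg ''d'')) (Elem ''kappa'' (Const 0))) = 1"
    using s big W_pos by (simp add: penv_def const_mod mod_simps)
  let ?B1 = "50 * (d + clog N + clog (p + 1)) + 200"
  let ?B2 = "(nbit + 1) * 60" and ?B3 = "(ncell + 1) * 400"
  show ?thesis
    unfolding recover_prog_def
  proof (rule runs_Cond)
    show "runs W \<rho> Skip s (?B1 + (2 + (?B2 + (2 + ?B3)))) ?Q"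
      if "aval W \<rho> s (Bin Less (Bin Mul (Const 4) (Reg ''d'')) (Elem ''kappa'' (Const 0))) = 0"
      using that guard by simp
    show "runs W \<rho> (Seq prepare (Seq (Assign ''x'' (Const 0)) (Seq (Loop (Bin Less (Reg ''x'') (Reg ''H'')) get_body)
       (Seq (Assign ''y'' (Const 0)) (Loop (Bin Less (Reg ''y'') (Reg ''Y'')) decode_body))))) s
       (?B1 + (2 + (?B2 + (2 + ?B3)))) ?Q"
    proof (rule runs_Seq[where ?B1.0 = ?B1], rule runs_prepare[OF s(1)])
      fix s1 :: state
      let ?P1 = "\<lambda>s1 :: state. same prepare_regs {''E''} s s1 \<and> env_of s1"
      show "same prepare_regs {''E''} s s1 \<Longrightarrow> env_of s1 \<Longrightarrow> ?P1 s1"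
        by (rule conjI)
      assume 1: "?P1 s1"
      note a1 = conjunct1[OF 1] and e1 = conjunct2[OF 1]
      show "runs W \<rho> (Seq (Assign ''x'' (Const 0)) (Seq (Loop (Bin Less (Reg ''x'') (Reg ''H'')) get_body)
       (Seq (Assign ''y'' (Const 0)) (Loop (Bin Less (Reg ''y'') (Reg ''Y'')) decode_body)))) s1
       (2 + (?B2 + (2 + ?B3))) ?Q"
      proof (rule runs_Seq)
        let ?P2 = "\<lambda>s2 :: state. same {''x''} {} s1 s2 \<and> reg s2 ''x'' = 0"
        show "runs W \<rho> (Assign ''x'' (Const 0)) s1 2 ?P2" by (rule runs_straight) simp_all
        fix s2 :: state assume 2: "?P2 s2"
        note a2 = conjunct1[OF 2]
        have e2: "env_of s2" by (rule env_agree[OF a2 e1]) auto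
        have A2: "arr s2 A = arr s A" if "A \<noteq> ''E''" for A
          using agree_arrD[OF a1, of A] agree_arrD[OF a2, of A] that by simp
        have n2: "reg s2 ''n'' = 0"
          using agree_regD[OF a1, of "''n''"] agree_regD[OF a2, of "''n''"] s(2) by simp
        have S2: "arr s2 ''S'' = (\<lambda>_. 0)" "arr s2 ''Z'' = (\<lambda>_. 0)" "arr s2 ''last'' = (\<lambda>_. 0)" "arr s2 ''cnt'' = (\<lambda>_. 0)"
          using zero by (simp_all add: A2)
        have s12': "arr s2 ''s1'' k = of_bool (sketch \<rho> U ! k) \<and> arr s2 ''s2'' k = of_bool (sketch \<rho> V ! k)"
          if "k < nbit" for k
          using s12[OF that] by (simp add: A2)
        show "runs W \<rho> (Seq (Loop (Bin Less (Reg ''x'') (Reg ''H'')) get_body)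
          (Seq (Assign ''y'' (Const 0)) (Loop (Bin Less (Reg ''y'') (Reg ''Y'')) decode_body))) s2
          (?B2 + (2 + ?B3)) ?Q"
        proof (rule runs_Seq[where ?B1.0 = ?B2], rule runs_get[where U = U and V = V, OF e2 conjunct2[OF 2] S2(1,2) s12' UV])
          fix s3 :: state
          let ?P3 = "\<lambda>s3 :: state. same {''k'', ''j'', ''x''} {''S'', ''Z''} s2 s3 \<and>
            (\<forall>z<3 * ncell. arr s3 ''S'' z = cell \<rho> U z \<and> arr s3 ''Z'' z = cell \<rho> V z)"
          show "same {''k'', ''j'', ''x''} {''S'', ''Z''} s2 s3 \<Longrightarrow>
            (\<And>z. z < 3 * ncell \<Longrightarrow> arr s3 ''S'' z = cell \<rho> U z \<and> arr s3 ''Z'' z = cell \<rho> V z) \<Longrightarrow> ?P3 s3"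
            by blast
          assume 3: "?P3 s3"
          note a3 = conjunct1[OF 3]
          have e3: "env_of s3" by (rule env_agree[OF a3 e2]) auto
          have n3: "reg s3 ''n'' = 0" using agree_regD[OF a3, of "''n''"] n2 by simp
          have z3: "arr s3 ''last'' = (\<lambda>_. 0)" "arr s3 ''cnt'' = (\<lambda>_. 0)"
            using agree_arrD[OF a3, of "''last''"] agree_arrD[OF a3, of "''cnt''"] S2 by simp_all
          show "runs W \<rho> (Seq (Assign ''y'' (Const 0)) (Loop (Bin Less (Reg ''y'') (Reg ''Y'')) decode_body)) s3
            (2 + ?B3) ?Q"
          proof (rule runs_Seq)
            let ?P4 = "\<lambda>s4 :: state. s4 = s3\<lparr>reg := (reg s3)(''y'' := 0)\<rparr>"
            show "runs W \<rho> (Assign ''y'' (Const 0)) s3 2 ?P4" by (rule runs_straight) simp_all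
            fix s4 :: state assume 4: "?P4 s4"
            have e4: "env_of s4" using e3 4 by simp
            have r4: "reg s4 ''y'' = 0" "reg s4 ''n'' = 0" "arr s4 = arr s3" using 4 n3 by simp_all
            have SZ4: "arr s4 ''S'' z < p ^ 3 \<and> arr s4 ''Z'' z < p ^ 3" if "z < 3 * ncell" for z
              using 3 that cell_le[where U = U and \<rho> = \<rho> and z = z, OF UV(1)]
                cell_le[where U = V and \<rho> = \<rho> and z = z, OF UV(2)] unfolding r4(3) by auto
            have "recover \<rho> (sketch \<rho> U) (sketch \<rho> V) = recovered \<rho> (cell \<rho> U) (cell \<rho> V)"
              by (rule recover_sketch) (use UV in blast)+
            also have "\<dots> = recovered \<rho> (arr s4 ''S'') (arr s4 ''Z'')"
              unfolding r4(3) by (rule recovered_cong) (use 3 in auto)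
            finally show "runs W \<rho> (Loop (Bin Less (Reg ''y'') (Reg ''Y'')) decode_body) s4 ?B3 ?Q"
              using runs_decode[OF e4 r4(1,2) z3[folded r4(3)] SZ4, of ?B3 \<rho>] by simp
          qed simp
        qed simp_all
      qed simp
    qed simp_all
  qed (use B in simp)
qed

end

section \<open>Resource bounds\<close>

text \<open>A mismatch gives its leaf load 1, and capacities are at least 1, so no minimum on the
  path can reduce the load to 0.\<close>

lemma load_pos:
  assumes par: "hmr_params d L \<kappa> p" and l: "l \<in> leaves d L" "u l \<noteq> w l" and "j \<le> d"
  shows "1 \<le> load d L \<kappa> u w (take j l)"
  using assms(4)
proof (induction j rule: inc_induct)
  case base
  have "take d l = l" "length l = d" using l(1) by (auto simp: nodes_def)
  then show ?case using l(2) by (subst load.simps) simp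
next
  case (step j)
  have len: "length (take j l) = j" using l(1) step.hyps by (simp add: nodes_def)
  have s: "take (Suc j) l = take j l @ [l ! j]" "l ! j < L (Suc j)"
    using l(1) step.hyps by (auto simp: nodes_def take_Suc_conv_app_nth)
  have "load d L \<kappa> u w (take j l @ [l ! j]) \<le> (\<Sum>a<L (Suc j). load d L \<kappa> u w (take j l @ [a]))"
    using s(2) by (intro member_le_sum) auto
  moreover have "1 \<le> \<kappa> j"
  proof -
    have "j \<in> {0..d}" using step.hyps by simp
    then obtain k where "\<kappa> j = 2 ^ k" using par unfolding hmr_params_def by blast
    then show ?thesis by simp
  qed
  moreover have "load d L \<kappa> u w (take j l) = min (\<kappa> j) (\<Sum>a<L (Suc j). load d L \<kappa> u w (take j l @ [a]))"
    using load.simps[of d L \<kappa> u w "take j l"] len step.hyps by simp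
  ultimately show ?case using step.IH s(1) by simp
qed

text \<open>Here \<open>\<kappa> 0 / R \<le> 1\<close>, so an underloaded root has load 0 and there
  is no mismatch at all.\<close>

lemma target_empty:
  assumes par: "hmr_params d L \<kappa> p" and "\<kappa> 0 \<le> 4 * d" "4 * d \<le> R"
  shows "target d L \<kappa> R u w = {}"
proof (rule equals0I)
  fix l assume l: "l \<in> target d L \<kappa> R u w"
  have d: "1 \<le> d" using par by (simp add: hmr_params_def)
  have "\<forall>j<d. \<not> node_overloaded d L \<kappa> R u w (take j l)"
    using l by (simp add: target_def accessible_def)
  then have "\<not> node_overloaded d L \<kappa> R u w (take 0 l)" using d by force
  then have "real (load d L \<kappa> u w []) < real (\<kappa> 0) / real R" by (simp add: node_overloaded_def)
  also have "\<dots> \<le> 1" using assms d by simp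
  finally have "load d L \<kappa> u w [] = 0" by simp
  moreover have "1 \<le> load d L \<kappa> u w (take 0 l)"
    using l by (intro load_pos[OF par]) (auto simp: target_def)
  ultimately show False by simp
qed

text \<open>Eight times the bit length of the parameters makes room for their eighth power; this is
  where \<open>K = 8\<close> comes from.\<close>

lemma word_length_bound:
  assumes "hmr_params d L \<kappa> p"
  shows "(p + d + delta_bits \<delta>) ^ 8 < 2 ^ word_length 8 d p \<delta>"
proof -
  let ?Q = "p + d + delta_bits \<delta>"
  have "1 \<le> d" using assms by (simp add: hmr_params_def)
  then have "?Q < 2 ^ floorlog 2 ?Q" using floorlog_bounds[of ?Q 2] by simp
  then have "?Q ^ 8 < (2 ^ floorlog 2 ?Q) ^ 8" by (rule power_strict_mono) auto
  then show ?thesis by (simp add: word_length_def mult.commute flip: power_mult)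
qed

lemma prob_rand_words:
  "measure_pmf.prob (rand W) A = real (card {\<rho> \<in> rand_words W. \<rho> \<in> A}) / real (card (rand_words W))"
proof -
  have "finite (rand_words W)" unfolding rand_words_def by (intro finite_PiE) auto
  moreover have "rand_words W \<noteq> {}"
    unfolding rand_words_def PiE_eq_empty_iff by (metis empty_iff lessThan_iff zero_less_numeral zero_less_power)
  moreover have "rand_words W \<inter> A = {\<rho> \<in> rand_words W. \<rho> \<in> A}" by auto
  ultimately show ?thesis unfolding rand_def by (simp add: measure_pmf_of_set)
qed

text \<open>Rounding up adds less than 1, and \<open>log_inv\<close> is at least 1; this gives the
  factor 2, also when \<open>\<delta>\<close> is close to or above 1.\<close>

lemma delta_bits_bounds:
  assumes "\<delta> > 0"
  shows "(1 / 2) ^ delta_bits \<delta> \<le> \<delta>" "real (delta_bits \<delta>) \<le> 2 * log_inv \<delta>"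
proof -
  have "log 2 (1 / \<delta>) \<le> real (delta_bits \<delta>)" unfolding delta_bits_def by linarith
  then have "1 / \<delta> \<le> 2 powr real (delta_bits \<delta>)" using assms by (simp add: log_le_iff)
  also have "\<dots> = 2 ^ delta_bits \<delta>" by (simp add: powr_realpow)
  finally show "(1 / 2) ^ delta_bits \<delta> \<le> \<delta>" using assms by (simp add: field_simps)
  show "real (delta_bits \<delta>) \<le> 2 * log_inv \<delta>" unfolding delta_bits_def log_inv_def by linarith
qed

lemma log_inv_ge: "1 \<le> log_inv \<delta>"
  by (simp add: log_inv_def)

definition dense_prog :: com where
  "dense_prog = sketch_with ''N'' (Reg ''i'') (Elem ''u'' (Reg ''i''))"

definition sparse_prog :: com where
  "sparse_prog = sketch_with ''n'' (Elem ''idx'' (Reg ''i'')) (Elem ''val'' (Reg ''i''))"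

lemma param_state_simps [simp]:
  "reg (param_state d L \<kappa> p \<delta>) x = (if x = ''t'' then delta_bits \<delta> else if x = ''p'' then p else if x = ''d'' then d else 0)"
  "arr (param_state d L \<kappa> p \<delta>) a = (if a = ''kappa'' then (\<lambda>j. if j \<le> d then \<kappa> j else 0)
     else if a = ''L'' then (\<lambda>j. if 1 \<le> j \<and> j \<le> d then L j else 0) else (\<lambda>_. 0))"
  by (simp_all add: param_state_def)

lemma set_reg_simps [simp]:
  "reg (set_reg x n s) y = (if y = x then n else reg s y)" "arr (set_reg x n s) = arr s"
  by (simp_all add: set_reg_def)

lemma set_arr_simps [simp]:
  "reg (set_arr a xs s) = reg s"
  "arr (set_arr a xs s) b = (if b = a then (\<lambda>k. if k < length xs then xs ! k else 0) else arr s b)"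
  by (simp_all add: set_arr_def)

lemma runs_within_mono: "runs W \<rho> c s T Q \<Longrightarrow> real T \<le> B \<Longrightarrow> runs_within W \<rho> c s B Q"
  unfolding runs_def runs_within_def using of_nat_mono by fastforce

section \<open>Sizes, running times and error probability in terms of the parameters\<close>

context hmr
begin

abbreviation "lp \<equiv> log 2 (real p)"

lemma lp_ge: "8 \<le> lp"
proof -
  have "log 2 (2 ^ 8) \<le> lp" using p_ge_256 by (intro log_mono) auto
  moreover have "log 2 (2 ^ 8) = (8::real)" by (subst log_nat_power) auto
  ultimately show ?thesis by simp
qed

lemma clog_N_le: "real (clog N) \<le> lp"
proof -
  have "real (clog N) = log 2 (2 ^ clog N)" by (subst log_nat_power) auto
  also have "(2::real) ^ clog N = real N" using arg_cong[OF N_pow, of real] by simp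
  also have "log 2 (real N) \<le> lp" using N_pos N_le_p by (intro log_mono) auto
  finally show ?thesis .
qed

lemma clog_N_eq: "(\<Sum>j=1..d. log 2 (real (L j))) = real (clog N)"
proof -
  have "real (clog N) = log 2 (2 ^ clog N)" by (subst log_nat_power) auto
  also have "(2::real) ^ clog N = real N" using arg_cong[OF N_pow, of real] by simp
  also have "real N = (\<Prod>j=1..d. real (L j))" by (simp add: N_def num_leaves_def)
  also have "log 2 \<dots> = (\<Sum>j=1..d. log 2 (real (L j)))"
  proof -
    have "ln (\<Prod>j=1..d. real (L j)) = (\<Sum>j=1..d. ln (real (L j)))"
      using L_pos by (intro ln_prod) auto
    then show ?thesis by (simp add: log_def sum_divide_distrib)
  qed
  finally show ?thesis by simp
qed

lemma clog_p_le_lp: "real (clog (p + 1)) \<le> 2 * lp"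
proof -
  have "real (clog (p + 1)) = log 2 (2 ^ clog (p + 1))" by (subst log_nat_power) auto
  also have "\<dots> \<le> log 2 (2 * real p)"
  proof (intro log_mono)
    have "real (2 ^ clog (p + 1)) \<le> real (2 * p)" by (rule of_nat_mono[OF clog_p_le])
    then show "(2::real) ^ clog (p + 1) \<le> 2 * real p" by simp
  qed auto
  also have "\<dots> = 1 + lp" using p_ge_256 by (subst log_mult) auto
  finally show ?thesis using lp_ge by simp
qed

lemma nrep_bound:
  assumes "real t \<le> 2 * li" "1 \<le> li"
  shows "real nrep \<le> 12 * (real (clog N) + li)"
  using assms by (simp add: nrep_def thr_def)

lemma nbit_bound:
  assumes "real t \<le> 2 * li" "1 \<le> li"
  shows "real nbit \<le> 216 * (real (\<kappa> 0) * lp * (real (clog N) + li))"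
proof -
  have w: "real width \<le> 6 * lp" using clog_p_le_lp by (simp add: width_def)
  have "real nbit = 3 * (real nrep * real (\<kappa> 0)) * real width" by (simp add: nbit_def ncell_def)
  also have "\<dots> \<le> 3 * (12 * (real (clog N) + li) * real (\<kappa> 0)) * (6 * lp)"
    using nrep_bound[OF assms] w assms by (intro mult_mono mult_nonneg_nonneg) auto
  finally show ?thesis by (simp add: algebra_simps)
qed

text \<open>Every ingredient of the running times is measured against \<open>u\<close> or
  \<open>\<kappa> 0 * u\<close>, so that the final estimates are linear in one unknown.\<close>

lemma time_bounds:
  assumes "real t \<le> 2 * li" "1 \<le> li"
  defines "u \<equiv> lp ^ 2 * li"
  shows "1 \<le> u" "real nrep + 1 \<le> 25 * (lp * li)" "real nbit + 1 \<le> 433 * (real (\<kappa> 0) * u)"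
    "real ncell + 1 \<le> 25 * (real (\<kappa> 0) * u)"
    "real (d + clog N + clog (p + 1)) \<le> 4 * (real (\<kappa> 0) * u)"
    "(real nrep + 1) * (real (clog N) + 1) \<le> 50 * u"
proof -
  have lp: "1 \<le> lp" using lp_ge by simp
  have k: "1 \<le> real (\<kappa> 0)" using kap0_pos by simp
  have lpu: "lp \<le> lp * lp" using mult_mono[of 1 lp lp lp] lp by simp
  have lpli: "1 \<le> lp * li" "lp \<le> lp * li" "li \<le> lp * li"
    using mult_mono[of 1 lp 1 li] mult_mono[of lp lp 1 li] mult_mono[of 1 lp li li] lp assms(2) by auto
  have uu: "lp * (lp * li) = u" by (simp add: u_def power2_eq_square)
  have lpliu: "lp * li \<le> u" using mult_mono[of 1 lp "lp * li" "lp * li"] lp lpli uu by simp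
  show u1: "1 \<le> u" using lpliu lpli by simp
  have ku: "u \<le> real (\<kappa> 0) * u" "real (\<kappa> 0) \<le> real (\<kappa> 0) * u"
    using mult_mono[of 1 "real (\<kappa> 0)" u u] mult_mono[of "real (\<kappa> 0)" "real (\<kappa> 0)" 1 u] k u1 by auto
  have gl: "real (clog N) + li \<le> 2 * (lp * li)" using clog_N_le lpli by linarith
  show n: "real nrep + 1 \<le> 25 * (lp * li)" proof -
    have "a + 1 \<le> 25 * x" if "a \<le> 12 * b" "b \<le> 2 * x" "1 \<le> x" for a b x :: real
      using that by linarith
    then show ?thesis using nrep_bound[OF assms(1,2)] gl lpli(1) by blast
  qed
  have "real (\<kappa> 0) * lp * (real (clog N) + li) \<le> real (\<kappa> 0) * lp * (2 * (lp * li))"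
    using gl lp k by (intro mult_left_mono) auto
  also have "\<dots> = 2 * (real (\<kappa> 0) * u)" by (simp add: u_def power2_eq_square)
  finally show "real nbit + 1 \<le> 433 * (real (\<kappa> 0) * u)"
    using nbit_bound[OF assms(1,2)] ku u1 by linarith
  have "real ncell = real (\<kappa> 0) * real nrep" by (simp add: ncell_def)
  also have "\<dots> \<le> real (\<kappa> 0) * (25 * (lp * li) - 1)" using n k by (intro mult_left_mono) auto
  also have "\<dots> \<le> real (\<kappa> 0) * (25 * u - 1)" using lpliu k by (intro mult_left_mono) auto
  also have "\<dots> = 25 * (real (\<kappa> 0) * u) - real (\<kappa> 0)" by (simp add: algebra_simps)
  finally show "real ncell + 1 \<le> 25 * (real (\<kappa> 0) * u)" using k by linarith
  \<comment> \<open>The assumption \<open>big\<close> pays for the pass over all levels.\<close>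
  have "real d \<le> real (\<kappa> 0)" using big by simp
  then show "real (d + clog N + clog (p + 1)) \<le> 4 * (real (\<kappa> 0) * u)"
  proof -
    have "d' + g + m \<le> 4 * x" if "d' \<le> k" "g \<le> l" "m \<le> 2 * l" "l \<le> y" "y \<le> u" "u \<le> x" "k \<le> x"
      for d' g m k l y u x :: real
      using that by linarith
    from this[OF \<open>real d \<le> real (\<kappa> 0)\<close> clog_N_le clog_p_le_lp lpli(2) lpliu ku] show ?thesis by simp
  qed
  have "(real nrep + 1) * (real (clog N) + 1) \<le> (25 * (lp * li)) * (2 * lp)"
    using n clog_N_le lp by (intro mult_mono) auto
  then show "(real nrep + 1) * (real (clog N) + 1) \<le> 50 * u"
    by (simp add: u_def power2_eq_square mult_ac)
qed

text \<open>\<open>X\<close> is \<open>N\<close> for dense input and \<open>\<kappa> 0\<close> plus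
  the support size for sparse input; the factor 2 absorbs the extra 1.\<close>

lemma sketch_time:
  assumes "real t \<le> 2 * li" "1 \<le> li" and X: "real (length zs) + 1 \<le> 2 * X" "real (\<kappa> 0) \<le> X"
  shows "real (50 * (d + clog N + clog (p + 1)) + (length zs + 1) * (400 * (nrep + 1) * (clog N + 1))
      + (nbit + 1) * 40 + 250) \<le> 100000 * (X * lp ^ 2 * li)"
proof -
  let ?u = "lp ^ 2 * li"
  note b = time_bounds[OF assms(1,2)]
  have kX: "real (\<kappa> 0) * ?u \<le> X * ?u" using X b(1) by (intro mult_right_mono) auto
  have "1 \<le> real (\<kappa> 0)" using kap0_pos by simp
  then have Xu: "1 \<le> X * ?u" using mult_mono[of 1 X 1 ?u] X b(1) by simp
  have "(real (length zs) + 1) * ((real nrep + 1) * (real (clog N) + 1)) \<le> (2 * X) * (50 * ?u)"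
    by (rule mult_mono[OF X(1) b(6)]) (use X in auto)
  then have 1: "real ((length zs + 1) * (400 * (nrep + 1) * (clog N + 1))) \<le> 40000 * (X * ?u)"
    by (simp add: algebra_simps)
  have 2: "real (50 * (d + clog N + clog (p + 1))) \<le> 200 * (X * ?u)"
    using b(5) kX by simp
  have 3: "real ((nbit + 1) * 40) \<le> 20000 * (X * ?u)" using b(3) kX Xu by simp
  have "real (50 * (d + clog N + clog (p + 1)) + (length zs + 1) * (400 * (nrep + 1) * (clog N + 1))
      + (nbit + 1) * 40 + 250) = real (50 * (d + clog N + clog (p + 1))) + real ((length zs + 1) * (400 * (nrep + 1) * (clog N + 1)))
      + real ((nbit + 1) * 40) + 250" by (simp only: of_nat_add of_nat_numeral)
  also have "\<dots> \<le> 200 * (X * ?u) + 40000 * (X * ?u) + 20000 * (X * ?u) + 250 * (X * ?u)"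
    using 1 2 3 Xu by (intro add_mono) auto
  also have "\<dots> \<le> 100000 * (X * ?u)" 
  proof -
    have "200 * x + 40000 * x + 20000 * x + 250 * x \<le> 100000 * x" if "1 \<le> x" for x :: real
      using that by linarith
    then show ?thesis using Xu by blast
  qed
  finally show ?thesis by (simp only: mult.assoc)
qed

lemma recover_time:
  assumes "real t \<le> 2 * li" "1 \<le> li"
  shows "real (50 * (d + clog N + clog (p + 1)) + (nbit + 1) * 60 + (ncell + 1) * 400 + 300)
    \<le> 100000 * (real (\<kappa> 0) * lp ^ 2 * li)"
proof -
  let ?u = "lp ^ 2 * li"
  note b = time_bounds[OF assms(1,2)]
  have "1 \<le> real (\<kappa> 0)" using kap0_pos by simp
  then have ku: "1 \<le> real (\<kappa> 0) * ?u" using mult_mono[of 1 "real (\<kappa> 0)" 1 ?u] b(1) by simp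
  have "real (50 * (d + clog N + clog (p + 1)) + (nbit + 1) * 60 + (ncell + 1) * 400 + 300)
    = 50 * real (d + clog N + clog (p + 1)) + (real nbit + 1) * 60 + (real ncell + 1) * 400 + 300"
    by (simp only: of_nat_add of_nat_mult of_nat_numeral of_nat_1)
  also have "\<dots> \<le> 100000 * (real (\<kappa> 0) * ?u)"
  proof -
    have "50 * a + b * 60 + c * 400 + 300 \<le> 100000 * x"
      if "a \<le> 4 * x" "b \<le> 433 * x" "c \<le> 25 * x" "1 \<le> x" for a b c x :: real
      using that by linarith
    then show ?thesis using b(3,4,5) ku by blast
  qed
  finally show ?thesis by (simp only: mult.assoc)
qed

lemma penv_param: "delta_bits \<delta> = t \<Longrightarrow>
  (\<forall>x\<in>{''d'', ''p'', ''t''}. reg s x = reg (param_state d L \<kappa> p \<delta>) x) \<Longrightarrow>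
  (\<forall>a\<in>{''L'', ''kappa''}. arr s a = arr (param_state d L \<kappa> p \<delta>) a) \<Longrightarrow> penv_of s"
  by (simp add: penv_def)

lemma runs_dense:
  assumes t: "delta_bits \<delta> = t" and u: "u \<in> seqs d L p" and li: "real t \<le> 2 * li" "1 \<le> li"
  shows "runs_within W \<rho> dense_prog (dense_input d L u (param_state d L \<kappa> p \<delta>))
    (100000 * (real (\<Prod>j=1..d. L j) * lp ^ 2 * li)) (sketch_output (sketch \<rho> (by_index u)))"
proof -
  let ?s = "dense_input d L u (param_state d L \<kappa> p \<delta>)"
  let ?zs = "map (\<lambda>k. (k, by_index u k)) [0..<N]"
  have pe: "penv_of ?s" by (rule penv_param[OF t]) (simp_all add: dense_input_def)
  have S: "arr ?s ''S'' = (\<lambda>_. 0)" by (simp add: dense_input_def)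
  have U: "arr ?s ''u'' k = by_index u k" if "k < N" for k
    using that by (simp add: dense_input_def by_index_def N_def)
  have "runs W \<rho> dense_prog ?s (50 * (d + clog N + clog (p + 1)) + (length ?zs + 1) * (400 * (nrep + 1) * (clog N + 1))
      + (nbit + 1) * 40 + 250) (sketch_output (sketch \<rho> (by_index u)))"
    unfolding dense_prog_def
  proof (rule runs_sketch_with[OF pe S, where zs = ?zs])
    show "reg s' ''N'' = length ?zs" if "env_of s'" for s' :: state
      using envD(3)[OF that] by simp
    show "aval W \<rho> s' (Reg ''i'') = fst (?zs ! k) \<and> aval W \<rho> s' (Elem ''u'' (Reg ''i'')) = snd (?zs ! k)"
      if "k < length ?zs" "same (prepare_regs \<union> item_regs) {''E'', ''S''} ?s s'"
        "reg s' ''i'' = k" for k s'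
      using that(1,3) agree_arrD[OF that(2), of "''u''"] U[of k] by simp
    show "distinct (map fst ?zs)" by (simp add: comp_def)
    show "fst a < N \<and> snd a = by_index u (fst a)" if "a \<in> set ?zs" for a using that by auto
    show "x \<in> fst ` set ?zs" if "x < N" for x using that by (force simp: image_iff)
    show "by_index u x < p" if "x < N" for x using u that by (rule by_index_less)
  qed simp_all
  moreover have "real (50 * (d + clog N + clog (p + 1)) + (length ?zs + 1) * (400 * (nrep + 1) * (clog N + 1))
      + (nbit + 1) * 40 + 250) \<le> 100000 * (real N * lp ^ 2 * li)"
    using N_pos kap0_le by (intro sketch_time[OF li]) simp_all
  ultimately show ?thesis unfolding N_def num_leaves_def by (rule runs_within_mono)
qed

lemma runs_sparse:
  assumes t: "delta_bits \<delta> = t" and u: "u \<in> seqs d L p" and xs: "sparse_rep d L u xs"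
    and li: "real t \<le> 2 * li" "1 \<le> li"
  shows "runs_within W \<rho> sparse_prog (sparse_input L xs (param_state d L \<kappa> p \<delta>))
    (100000 * ((real (\<kappa> 0) + real (card (supp d L u))) * lp ^ 2 * li)) (sketch_output (sketch \<rho> (by_index u)))"
proof -
  let ?s = "sparse_input L xs (param_state d L \<kappa> p \<delta>)"
  let ?zs = "map (\<lambda>x. (leaf_index L (fst x), snd x)) xs"
  have set: "set xs = (\<lambda>l. (l, u l)) ` supp d L u" and dist: "distinct xs"
    using xs by (auto simp: sparse_rep_def)
  have supp: "supp d L u \<subseteq> leaves d L" by (auto simp: supp_def)
  have inj: "inj_on (leaf_index L) (leaves d L)" using bij_betw_leaf_index by (rule bij_betw_imp_inj_on)
  have pe: "penv_of ?s" by (rule penv_param[OF t]) (simp_all add: sparse_input_def)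
  have S: "arr ?s ''S'' = (\<lambda>_. 0)" by (simp add: sparse_input_def)
  have len: "length xs = card (supp d L u)"
    using distinct_card[OF dist] unfolding set by (simp add: card_image inj_on_def)
  have n: "reg ?s ''n'' = length ?zs" by (simp add: sparse_input_def)
  have "runs W \<rho> sparse_prog ?s (50 * (d + clog N + clog (p + 1)) + (length ?zs + 1) * (400 * (nrep + 1) * (clog N + 1))
      + (nbit + 1) * 40 + 250) (sketch_output (sketch \<rho> (by_index u)))"
    unfolding sparse_prog_def
  proof (rule runs_sketch_with[OF pe S, where zs = ?zs])
    show "reg s' ''n'' = length ?zs"
      if "same (prepare_regs \<union> item_regs) {''E'', ''S''} ?s s'" for s' :: state
      using agree_regD[OF that, of "''n''"] n by simp
    show "aval W \<rho> s' (Elem ''idx'' (Reg ''i'')) = fst (?zs ! k) \<and> aval W \<rho> s' (Elem ''val'' (Reg ''i'')) = snd (?zs ! k)"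
      if "k < length ?zs" "same (prepare_regs \<union> item_regs) {''E'', ''S''} ?s s'"
        "reg s' ''i'' = k" for k s'
      using that(1,3) agree_arrD[OF that(2), of "''idx''"] agree_arrD[OF that(2), of "''val''"]
      by (simp add: sparse_input_def)
    have eq: "map fst ?zs = map (leaf_index L \<circ> fst) xs" by simp
    have "inj_on (leaf_index L \<circ> fst) (set xs)"
      unfolding set using inj supp by (auto simp: inj_on_def)
    then show "distinct (map fst ?zs)" unfolding eq distinct_map using dist by blast
    show "fst a < N \<and> snd a = by_index u (fst a)" if "a \<in> set ?zs" for a
      using that supp by (auto simp: set leaf_index_less by_index_leaf)
    show "x \<in> fst ` set ?zs" if x: "x < N" "by_index u x \<noteq> 0" for x
    proof -
      obtain l where l: "l \<in> leaves d L" "leaf_index L l = x" using leaf_of_index[OF x(1)] by blast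
      then have "l \<in> supp d L u" using x(2) by_index_leaf[OF l(1), of u] by (simp add: supp_def)
      then show ?thesis using l(2) by (auto simp: set image_iff)
    qed
    show "by_index u x < p" if "x < N" for x using u that by (rule by_index_less)
  qed simp_all
  moreover have "real (50 * (d + clog N + clog (p + 1)) + (length ?zs + 1) * (400 * (nrep + 1) * (clog N + 1))
      + (nbit + 1) * 40 + 250) \<le> 100000 * ((real (\<kappa> 0) + real (card (supp d L u))) * lp ^ 2 * li)"
    using kap0_pos len by (intro sketch_time[OF li]) simp_all
  ultimately show ?thesis by (rule runs_within_mono)
qed

lemma length_sketch: "length (sketch \<rho> U) = nbit"
  by (simp add: sketch_def)

lemma runs_recover_within:
  fixes \<rho> :: "nat \<Rightarrow> nat"
  assumes t: "delta_bits \<delta> = t" and u: "u \<in> seqs d L p" and w: "w \<in> seqs d L p"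
    and li: "real t \<le> 2 * li" "1 \<le> li"
  defines "X \<equiv> sketch \<rho> (by_index u)" and "Y \<equiv> sketch \<rho> (by_index w)"
  shows "runs_within W \<rho> recover_prog (sketch_input X Y (param_state d L \<kappa> p \<delta>))
    (100000 * (real (\<kappa> 0) * lp ^ 2 * li)) (triples_output (recover \<rho> X Y))"
proof -
  let ?s = "sketch_input X Y (param_state d L \<kappa> p \<delta>)"
  have len: "length X = nbit" "length Y = nbit" by (simp_all add: X_def Y_def length_sketch)
  have "runs W \<rho> recover_prog ?s
      (50 * (d + clog N + clog (p + 1)) + (nbit + 1) * 60 + (ncell + 1) * 400 + 300) (triples_output (recover \<rho> X Y))"
    unfolding X_def Y_def
  proof (rule runs_recover, fold X_def Y_def)
    show "penv_of ?s" by (rule penv_param[OF t]) (simp_all add: sketch_input_def)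
    show "reg ?s ''n'' = 0" by (simp add: sketch_input_def)
    show "arr ?s A = (\<lambda>_. 0)" if "A \<in> {''S'', ''Z'', ''last'', ''cnt''}" for A
      using that by (auto simp: sketch_input_def)
    show "arr ?s ''s1'' k = of_bool (X ! k) \<and> arr ?s ''s2'' k = of_bool (Y ! k)" if "k < nbit" for k
      using that len by (simp add: sketch_input_def)
    show "by_index u x < p" "by_index w x < p" if "x < N" for x
      using u w that by (auto intro: by_index_less)
  qed simp
  then show ?thesis using recover_time[OF li] by (rule runs_within_mono)
qed

lemma prob_fail_le:
  assumes u: "u \<in> seqs d L p" and w: "w \<in> seqs d L p" and R: "4 * d \<le> R"
  defines "xs \<equiv> \<lambda>\<rho>. recover \<rho> (sketch \<rho> (by_index u)) (sketch \<rho> (by_index w))"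
  shows "measure_pmf.prob (rand W)
    {\<rho>. \<not> (hmr_sound d L u w (xs \<rho>) \<and> hmr_complete d L \<kappa> R u w (xs \<rho>))} \<le> (1 / 2) ^ t"
proof -
  have xs: "xs \<rho> = recovered \<rho> (cell \<rho> (by_index u)) (cell \<rho> (by_index w))" for \<rho>
    unfolding xs_def by (rule recover_sketch) (use u w by_index_less in auto)
  have "card (rand_words W) > 0"
    unfolding rand_words_def by (simp add: card_PiE)
  then show ?thesis
    using card_fail_le[OF u w R] unfolding prob_rand_words xs Om_def by (simp add: field_simps)
qed

lemma length_sketch_le:
  assumes "real t \<le> 2 * li" "1 \<le> li"
  shows "real (length (sketch \<rho> U))
    \<le> 216 * (real (\<kappa> 0) * lp * ((\<Sum>j=1..d. log 2 (real (L j))) + li))"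
  unfolding length_sketch clog_N_eq by (rule nbit_bound[OF assms])

lemma length_recover: "length (recover \<rho> X Y) \<le> \<kappa> 0"
  unfolding recover_def by (rule length_recovered)

end

section \<open>The case of small root capacity, and the theorem\<close>

lemma p_ge_4:
  assumes par: "hmr_params d L \<kappa> p"
  shows "4 \<le> p"
proof -
  have "1 \<le> (L j)\<^sup>2" if "j \<in> {1..d}" for j
  proof -
    obtain k where "L j = 2 ^ k" using par \<open>j \<in> {1..d}\<close> unfolding hmr_params_def by blast
    then show ?thesis by simp
  qed
  then have "1 \<le> (\<Prod>j=1..d. (L j)\<^sup>2)" by (rule prod_ge_1)
  then show "4 \<le> p" using par unfolding hmr_params_def by linarith
qed

lemma sum_log_nonneg:
  assumes "hmr_params d L \<kappa> p"
  shows "0 \<le> (\<Sum>j=1..d. log 2 (real (L j)))"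
proof (rule sum_nonneg)
  fix j assume "j \<in> {1..d}"
  then obtain k where "L j = 2 ^ k" using assms unfolding hmr_params_def by blast
  then have "1 \<le> real (L j)" by simp
  then show "0 \<le> log 2 (real (L j))" by (subst zero_le_log_cancel_iff) auto
qed

text \<open>If \<open>\<kappa> 0 \<le> 4 * d\<close>, the guard fails and everything is empty. The
  product \<open>4 * d\<close> must not wrap around for this, which \<open>4 \<le> p\<close>
  guarantees.\<close>

lemma runs_trivial:
  fixes \<delta> :: real and s :: state
  assumes par: "hmr_params d L \<kappa> p" and triv: "\<not> 4 * d < \<kappa> 0"
    and s: "reg s ''d'' = d" "arr s ''kappa'' 0 = \<kappa> 0"
  defines "W \<equiv> word_length 8 d p \<delta>"
  shows "runs W \<rho> (sketch_with cnt xe ve) s 20 (sketch_output [])"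
    and "reg s ''n'' = 0 \<Longrightarrow> runs W \<rho> recover_prog s 20 (triples_output [])"
proof -
  let ?Q = "p + d + delta_bits \<delta>"
  have "4 \<le> p" using par by (rule p_ge_4)
  then have "1 \<le> ?Q" "4 * d \<le> ?Q * ?Q" by (simp, intro mult_mono) auto
  moreover have "?Q * ?Q = ?Q ^ 2" by (simp add: power2_eq_square)
  moreover have "?Q ^ 2 \<le> ?Q ^ 8" using \<open>1 \<le> ?Q\<close> by (intro power_increasing) auto
  ultimately have "4 * d < 2 ^ W" using word_length_bound[OF par, of \<delta>] unfolding W_def by linarith
  then have w: "4 * d mod 2 ^ W = 4 * d" by simp
  have guard: "aval W \<rho> s (Bin Less (Bin Mul (Const 4) (Reg ''d'')) (Elem ''kappa'' (Const 0))) = 0"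
    using triv by (simp add: s mod_simps w)
  show "runs W \<rho> (sketch_with cnt xe ve) s 20 (sketch_output [])"
    unfolding sketch_with_def
  proof (rule runs_Cond[where ?B1.0 = 2])
    show "runs W \<rho> (Assign ''n'' (Const 0)) s 2 (sketch_output [])"
      by (rule runs_straight) (simp_all add: sketch_output_def)
  qed (use guard in simp_all)
  show "runs W \<rho> recover_prog s 20 (triples_output [])" if "reg s ''n'' = 0"
    unfolding recover_prog_def
  proof (rule runs_Cond[where ?B1.0 = 2])
    show "runs W \<rho> Skip s 2 (triples_output [])"
      using that by (intro runs_Skip) (simp_all add: triples_output_def)
  qed (use guard in simp_all)
qed

theorem theorem5:
  shows "\<exists>(hmr_sketch :: com) (hmr_sketch_sparse :: com) (hmr_recover :: com) (K :: nat) (C :: real) (e :: nat).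
    K > 0 \<and>
    (\<forall>(d :: nat) (L :: nat \<Rightarrow> nat) (\<kappa> :: nat \<Rightarrow> nat) (p :: nat) (\<delta> :: real).
      hmr_params d L \<kappa> p \<and> \<delta> > 0 \<longrightarrow>
      (let W = word_length K d p \<delta>; s0 = param_state d L \<kappa> p \<delta> in
       \<exists>(sketch :: (nat \<Rightarrow> nat) \<Rightarrow> (nat list \<Rightarrow> nat) \<Rightarrow> bool list)
        (recover :: (nat \<Rightarrow> nat) \<Rightarrow> bool list \<Rightarrow> bool list \<Rightarrow> (nat \<times> nat \<times> nat) list).
         (\<forall>R \<ge> 4 * d. \<forall>u \<in> seqs d L p. \<forall>w \<in> seqs d L p.
            measure_pmf.prob (rand W)
              {\<rho>. \<not> (hmr_sound d L u w (recover \<rho> (sketch \<rho> u) (sketch \<rho> w)) \<and>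
                      hmr_complete d L \<kappa> R u w (recover \<rho> (sketch \<rho> u) (sketch \<rho> w)))} \<le> \<delta>) \<and>
         (\<forall>\<rho> \<in> rand_words W. \<forall>u \<in> seqs d L p.
            real (length (sketch \<rho> u))
              \<le> C * (real (\<kappa> 0) * log 2 (real p) *
                     ((\<Sum>j=1..d. log 2 (real (L j))) + log_inv \<delta>))) \<and>
         (\<forall>\<rho> \<in> rand_words W. \<forall>u \<in> seqs d L p.
            runs_within W \<rho> hmr_sketch (dense_input d L u s0)
              (C * (real (\<Prod>j=1..d. L j) * log 2 (real p) ^ e * log_inv \<delta>))
              (sketch_output (sketch \<rho> u))) \<and>
         (\<forall>\<rho> \<in> rand_words W. \<forall>u \<in> seqs d L p. \<forall>w \<in> seqs d L p.
            runs_within W \<rho> hmr_recover (sketch_input (sketch \<rho> u) (sketch \<rho> w) s0)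
              (C * (real (\<kappa> 0) * log 2 (real p) ^ e * log_inv \<delta>))
              (triples_output (recover \<rho> (sketch \<rho> u) (sketch \<rho> w)))) \<and>
         (\<forall>\<rho> \<in> rand_words W. \<forall>u \<in> seqs d L p. \<forall>xs. sparse_rep d L u xs \<longrightarrow>
            runs_within W \<rho> hmr_sketch_sparse (sparse_input L xs s0)
              (C * ((real (\<kappa> 0) + real (card (supp d L u))) * log 2 (real p) ^ e * log_inv \<delta>))
              (sketch_output (sketch \<rho> u))) \<and>
         (\<forall>\<rho> \<in> rand_words W. \<forall>u \<in> seqs d L p. \<forall>w \<in> seqs d L p.
            length (recover \<rho> (sketch \<rho> u) (sketch \<rho> w)) \<le> \<kappa> 0)))"
\<comment> \<open>The exponent 2 counts one logarithm for the repetitions and one for either the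
  levels visited per leaf or the bits per cell.\<close>
proof (rule exI[of _ dense_prog], rule exI[of _ sparse_prog], rule exI[of _ recover_prog], rule exI[of _ 8],
    rule exI[of _ 100000], rule exI[of _ 2], rule conjI, simp, intro allI impI, elim conjE, unfold Let_def, goal_cases)
  case (1 d L \<kappa> p \<delta>)
  note par = 1(1) and \<delta> = 1(2)
  let ?W = "word_length 8 d p \<delta>" and ?s0 = "param_state d L \<kappa> p \<delta>"
  note li = delta_bits_bounds(2)[OF \<delta>] log_inv_ge[of \<delta>]
  show ?case
  proof (cases "4 * d < \<kappa> 0")
    case True
    interpret hmr d L \<kappa> p "delta_bits \<delta>" ?W
      using par word_length_bound[OF par] True by unfold_locales
    show ?thesis
    proof (rule exI[of _ "\<lambda>\<rho> u. sketch \<rho> (by_index u)"], rule exI[of _ recover], intro conjI allI ballI impI)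
      fix R u w assume "4 * d \<le> R" "u \<in> seqs d L p" "w \<in> seqs d L p"
      then show "measure_pmf.prob (rand ?W)
          {\<rho>. \<not> (hmr_sound d L u w (recover \<rho> (sketch \<rho> (by_index u)) (sketch \<rho> (by_index w))) \<and>
            hmr_complete d L \<kappa> R u w (recover \<rho> (sketch \<rho> (by_index u)) (sketch \<rho> (by_index w))))} \<le> \<delta>"
        using prob_fail_le delta_bits_bounds(1)[OF \<delta>] by (meson order_trans)
    next
      fix \<rho> :: "nat \<Rightarrow> nat" and u :: "nat list \<Rightarrow> nat"
      have "real (length (sketch \<rho> (by_index u)))
          \<le> 216 * (real (\<kappa> 0) * lp * ((\<Sum>j=1..d. log 2 (real (L j))) + log_inv \<delta>))"
        by (rule length_sketch_le[OF li])
      also have "\<dots> \<le> 100000 * (real (\<kappa> 0) * lp * ((\<Sum>j=1..d. log 2 (real (L j))) + log_inv \<delta>))"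
        unfolding clog_N_eq using lp_ge li(2) by (intro mult_right_mono mult_nonneg_nonneg) auto
      finally show "real (length (sketch \<rho> (by_index u)))
          \<le> 100000 * (real (\<kappa> 0) * lp * ((\<Sum>j=1..d. log 2 (real (L j))) + log_inv \<delta>))" .
    qed (use runs_dense[OF refl _ li] runs_recover_within[OF refl _ _ li] runs_sparse[OF refl _ _ li] length_recover
        in blast)+
  next
    case False
    have k: "1 \<le> \<kappa> 0"
    proof -
      obtain k where "\<kappa> 0 = 2 ^ k" using par unfolding hmr_params_def by force
      then show ?thesis by simp
    qed
    have N: "\<kappa> 0 \<le> (\<Prod>j=1..d. L j)" using par by (simp add: hmr_params_def)
    have "2 \<le> p" using p_ge_4[OF par] by simp
    then have "log 2 2 \<le> log 2 (real p)" by (intro log_mono) auto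
    then have lp: "1 \<le> log 2 (real p) ^ 2" by simp
    have B: "real 20 \<le> 100000 * (X * log 2 (real p) ^ 2 * log_inv \<delta>)" if "1 \<le> X" for X
    proof -
      have "1 * 1 * 1 \<le> X * log 2 (real p) ^ 2 * log_inv \<delta>"
        using that lp li(2) by (intro mult_mono) auto
      then have "1 \<le> X * log 2 (real p) ^ 2 * log_inv \<delta>" by (simp only: mult_1)
      then have "20 * 1 \<le> 100000 * (X * log 2 (real p) ^ 2 * log_inv \<delta>)" by (intro mult_mono) auto
      then show ?thesis by (simp only: of_nat_numeral mult_1_right)
    qed
    have "0 \<le> real (\<kappa> 0) * log 2 (real p) * ((\<Sum>j=1..d. log 2 (real (L j))) + log_inv \<delta>)"
      using \<open>2 \<le> p\<close> li(2) sum_log_nonneg[OF par] by (intro mult_nonneg_nonneg add_nonneg_nonneg) auto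
    then have size_nonneg: "real (length ([] :: bool list)) \<le> 100000 * (real (\<kappa> 0) * log 2 (real p) *
          ((\<Sum>j=1..d. log 2 (real (L j))) + log_inv \<delta>))"
      by (simp only: list.size of_nat_0 mult_nonneg_nonneg zero_le_numeral)
    note triv = runs_trivial[OF par False, of _ \<delta>]
    \<comment> \<open>Empty sketches and an empty output are always sound, and complete because no
      leaf is accessible with a mismatch.\<close>
    show ?thesis
    proof (rule exI[of _ "\<lambda>_ _. []"], rule exI[of _ "\<lambda>_ _ _. []"], intro conjI allI ballI impI)
      fix R u w assume "4 * d \<le> R"
      then have "target d L \<kappa> R u w = {}" using False by (intro target_empty[OF par]) auto
      then have "hmr_sound d L u w [] \<and> hmr_complete d L \<kappa> R u w []"
        by (simp add: hmr_sound_def hmr_complete_def MIS_target_def)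
      then have "{\<rho> :: nat \<Rightarrow> nat. \<not> (hmr_sound d L u w [] \<and> hmr_complete d L \<kappa> R u w [])} = {}" by blast
      then show "measure_pmf.prob (rand ?W) {\<rho>. \<not> (hmr_sound d L u w [] \<and> hmr_complete d L \<kappa> R u w [])} \<le> \<delta>"
        using \<delta> by (simp only: measure_empty less_imp_le)
    next
      fix \<rho> :: "nat \<Rightarrow> nat" and u :: "nat list \<Rightarrow> nat"
      show "real (length ([] :: bool list)) \<le> 100000 * (real (\<kappa> 0) * log 2 (real p) *
          ((\<Sum>j=1..d. log 2 (real (L j))) + log_inv \<delta>))"
        by (rule size_nonneg)
    next
      fix \<rho> u
      show "runs_within ?W \<rho> dense_prog (dense_input d L u ?s0)
          (100000 * (real (\<Prod>j=1..d. L j) * log 2 (real p) ^ 2 * log_inv \<delta>)) (sketch_output [])"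
        unfolding dense_prog_def
        by (rule runs_within_mono[OF triv(1) B]) (use k N in \<open>simp_all add: dense_input_def flip: of_nat_prod\<close>)
    next
      fix \<rho> :: "nat \<Rightarrow> nat" and u w :: "nat list \<Rightarrow> nat"
      show "runs_within ?W \<rho> recover_prog (sketch_input [] [] ?s0)
          (100000 * (real (\<kappa> 0) * log 2 (real p) ^ 2 * log_inv \<delta>)) (triples_output [])"
        by (rule runs_within_mono[OF triv(2) B]) (use k in \<open>simp_all add: sketch_input_def\<close>)
    next
      fix \<rho> u xs
      show "runs_within ?W \<rho> sparse_prog (sparse_input L xs ?s0)
          (100000 * ((real (\<kappa> 0) + real (card (supp d L u))) * log 2 (real p) ^ 2 * log_inv \<delta>)) (sketch_output [])"
        unfolding sparse_prog_def
        by (rule runs_within_mono[OF triv(1) B]) (use k in \<open>simp_all add: sparse_input_def\<close>)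
    qed simp
  qed
qed

end
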